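(* Let $a\colon\mathbb{R}_+\to\mathbb{R}$ be a Hardy field function such that $t^d\log t\prec a(t)\prec t^{d+1}$ for some $d\in\mathbb{Z}_+$, or $a(t)\sim t^d\log t$ for some $d\in\mathbb{N}$. Then for every ergodic sequence $b\colon\mathbb{N}\to\mathbb{N}$ and every $\alpha\in\mathbb{R}\setminus\mathbb{Q}$, the sequences $\big(a(b(n))\big)_{n\in\mathbb{N}}$ and $\big([a(b(n))]\alpha\big)_{n\in\mathbb{N}}$ are equidistributed $\bmod\ 1$, and the sequence $\big([a(b(n))]\big)_{n\in\mathbb{N}}$ is equidistributed $\bmod\ q$ for every $q\in\mathbb{N}$.
   Context: Notation: $\mathbb{N}$ is the set of positive integers, $\mathbb{Z}_+$ the non-negative integers, $[t]$ denotes the integer part of $t\in\mathbb{R}$. For functions on $\mathbb{R}_+$: $a(t)\prec b(t)$ means $\lim_{t\to+\infty}a(t)/b(t)=0$; $a(t)\sim b(t)$ means $\lim_{t\to+\infty}a(t)/b(t)$ exists (in $\mathbb{R}$) and is non-zero. Hardy fields: let $B$ be the ring of germs at $+\infty$ of real valued functions defined on half lines $[c,+\infty)$. A Hardy field is a subfield of $B$ closed under differentiation. All Hardy fields are assumed translation invariant: if $a(t)$ belongs to the field, so does $a(t+h)$ for every $h\in\mathbb{R}$. A Hardy field function is a function whose germ belongs to some Hardy field. Ergodic sequences: let $\mathbb{U}$ be the closed complex unit disc. For $w\colon\mathbb{N}\to\mathbb{U}$, extended to $\mathbb{Z}$ arbitrarily (the extension does not matter), let $X:=\mathbb{U}^{\mathbb{Z}}$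 and let $T$ be the shift, $(Tx)(n):=x(n+1)$. A Furstenberg system of $w$ is a system $(X,\mu,T)$ where $\mu=\lim_{k\to\infty}\frac1{M_k}\sum_{m=1}^{M_k}\delta_{T^m w}$ (weak-star limit) for some strictly increasing sequence $M_k\to\infty$ of positive integers along which the limit exists. The sequence $w$ is ergodic if all its Furstenberg systems are ergodic. A sequence $b\colon\mathbb{N}\to\mathbb{N}$ is ergodic if it is strictly increasing, its range $E:=b(\mathbb{N})$ has positive density (i.e. $d(E)=\lim_{N\to\infty}|E\cap\{1,\dots,N\}|/N$ exists and is positive), and the $\{0,1\}$-valued sequence $\mathbf{1}_E$ is ergodic. *)

theory Defs
  imports "HOL-Probability.Probability"
begin

text \<open>
  The positive integers are encoded as \<open>{1..} :: nat set\<close>: a sequence indexed by them is a function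
  on \<^typ>\<open>nat\<close> whose value at 0 is never used.
\<close>

definition asymp_less :: "(real \<Rightarrow> real) \<Rightarrow> (real \<Rightarrow> real) \<Rightarrow> bool" (infix \<open>\<prec>\<^sub>\<infinity>\<close> 50)
  where "f \<prec>\<^sub>\<infinity> g \<longleftrightarrow>
    (\<forall>\<^sub>F t in at_top. g t \<noteq> 0) \<and> ((\<lambda>t. f t / g t) \<longlongrightarrow> 0) at_top"

definition asymp_same_growth :: "(real \<Rightarrow> real) \<Rightarrow> (real \<Rightarrow> real) \<Rightarrow> bool" (infix \<open>\<sim>\<^sub>\<infinity>\<close> 50)
  where "f \<sim>\<^sub>\<infinity> g \<longleftrightarrow>
    (\<forall>\<^sub>F t in at_top. g t \<noteq> 0) \<and> (\<exists>c. c \<noteq> 0 \<and> ((\<lambda>t. f t / g t) \<longlongrightarrow> c) at_top)"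

text \<open>
  The requirement that the denominator is eventually non-zero makes the quotients meaningful; without
  it, \<open>x / 0 = 0\<close> would put every function below the zero function.

  A set of germs at infinity is represented by the set of all functions whose germ belongs to it, that
  is, by a set of functions closed under eventual equality (the first clause below). The other clauses
  say that these germs form a unital subfield of the ring of all germs which is closed under
  differentiation.
\<close>

definition hardy_field :: "(real \<Rightarrow> real) set \<Rightarrow> bool"
  where "hardy_field H \<longleftrightarrow>
    (\<forall>f g. f \<in> H \<longrightarrow> (\<forall>\<^sub>F t in at_top. f t = g t) \<longrightarrow> g \<in> H) \<and>
    (\<lambda>_. 1) \<in> H \<and>
    (\<forall>f\<in>H. \<forall>g\<in>H. (\<lambda>t. f t - g t) \<in> H) \<and>
    (\<forall>f\<in>H. \<forall>g\<in>H. (\<lambda>t. f t * g t) \<in> H) \<and>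
    (\<forall>f\<in>H. \<not> (\<forall>\<^sub>F t in at_top. f t = 0) \<longrightarrow>
       (\<exists>g\<in>H. \<forall>\<^sub>F t in at_top. f t * g t = 1)) \<and>
    (\<forall>f\<in>H. \<exists>g\<in>H. \<forall>\<^sub>F t in at_top. (f has_real_derivative g t) (at t))"

definition translation_invariant :: "(real \<Rightarrow> real) set \<Rightarrow> bool"
  where "translation_invariant H \<longleftrightarrow> (\<forall>f\<in>H. \<forall>h. (\<lambda>t. f (t + h)) \<in> H)"

definition hardy_field_function :: "(real \<Rightarrow> real) \<Rightarrow> bool"
  where "hardy_field_function f \<longleftrightarrow> (\<exists>H. hardy_field H \<and> translation_invariant H \<and> f \<in> H)"

definition measure_preserving_system :: "'a measure \<Rightarrow> ('a \<Rightarrow> 'a) \<Rightarrow> bool"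
  where "measure_preserving_system M T \<longleftrightarrow> prob_space M \<and> T \<in> measurable M M \<and> distr M M T = M"

definition ergodic_system :: "'a measure \<Rightarrow> ('a \<Rightarrow> 'a) \<Rightarrow> bool"
  where "ergodic_system M T \<longleftrightarrow> measure_preserving_system M T \<and>
    (\<forall>A\<in>sets M. T -` A \<inter> space M = A \<longrightarrow> measure M A = 0 \<or> measure M A = 1)"

definition disc_seqs :: "(int \<Rightarrow> complex) set"
  where "disc_seqs = {x. \<forall>n. x n \<in> cball 0 1}"

definition shift :: "(int \<Rightarrow> complex) \<Rightarrow> (int \<Rightarrow> complex)"
  where "shift x = (\<lambda>n. x (n + 1))"

definition extend_seq :: "(nat \<Rightarrow> complex) \<Rightarrow> (int \<Rightarrow> complex)"
  where "extend_seq w = (\<lambda>n. if n \<ge> 1 then w (nat n) else 0)"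

text \<open>
  \<^term>\<open>disc_seqs\<close> carries the product topology and the corresponding Borel sigma-algebra. The averages
  below are the integrals of \<open>f\<close> against the empirical measures, so that the last line is their
  weak-star convergence to \<open>\<mu>\<close>.
\<close>

definition furstenberg_measure :: "(nat \<Rightarrow> complex) \<Rightarrow> (int \<Rightarrow> complex) measure \<Rightarrow> bool"
  where "furstenberg_measure w \<mu> \<longleftrightarrow>
    sets \<mu> = sets (restrict_space borel disc_seqs) \<and> prob_space \<mu> \<and>
    (\<exists>M :: nat \<Rightarrow> nat. strict_mono M \<and> (\<forall>k. M k \<ge> 1) \<and>
      (\<forall>f :: (int \<Rightarrow> complex) \<Rightarrow> real. continuous_on disc_seqs f \<longrightarrow>
        (\<lambda>k. (\<Sum>m=1..M k. f ((shift ^^ m) (extend_seq w))) / real (M k))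
          \<longlonglongrightarrow> integral\<^sup>L \<mu> f))"

definition ergodic_disc_seq :: "(nat \<Rightarrow> complex) \<Rightarrow> bool"
  where "ergodic_disc_seq w \<longleftrightarrow> (\<forall>n\<ge>1. w n \<in> cball 0 1) \<and>
    (\<forall>\<mu>. furstenberg_measure w \<mu> \<longrightarrow> ergodic_system \<mu> shift)"

definition has_density :: "nat set \<Rightarrow> real \<Rightarrow> bool"
  where "has_density E \<delta> \<longleftrightarrow> (\<lambda>N. real (card (E \<inter> {1..N})) / real N) \<longlonglongrightarrow> \<delta>"

definition ergodic_nat_seq :: "(nat \<Rightarrow> nat) \<Rightarrow> bool"
  where "ergodic_nat_seq b \<longleftrightarrow>
    (\<forall>n\<ge>1. b n \<ge> 1) \<and> strict_mono_on {1..} b \<and>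
    (\<exists>\<delta>>0. has_density (b ` {1..}) \<delta>) \<and>
    ergodic_disc_seq (indicator (b ` {1..}))"

definition equidistributed_mod_1 :: "(nat \<Rightarrow> real) \<Rightarrow> bool"
  where "equidistributed_mod_1 x \<longleftrightarrow>
    (\<forall>u v. 0 \<le> u \<longrightarrow> u < v \<longrightarrow> v \<le> 1 \<longrightarrow>
      (\<lambda>N. real (card {n\<in>{1..N}. frac (x n) \<in> {u..<v}}) / real N) \<longlonglongrightarrow> v - u)"

definition equidistributed_mod :: "nat \<Rightarrow> (nat \<Rightarrow> int) \<Rightarrow> bool"
  where "equidistributed_mod q x \<longleftrightarrow>
    (\<forall>r\<in>{0..<int q}.
      (\<lambda>N. real (card {n\<in>{1..N}. x n mod int q = r}) / real N) \<longlonglongrightarrow> 1 / real q)"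

end

theory Submission
  imports Defs
begin

text \<open>
  Writing \<open>e(t)\<close> for \<open>exp (2 \<pi> \<i> t)\<close>, Weyl's criterion reduces everything to showing that the averages of
  \<open>w n * e(\<beta> * a n)\<close> vanish for every real \<open>\<beta> \<noteq> 0\<close>, where \<open>w\<close> is the indicator of the range of \<open>b\<close>:
  \<open>e(l * \<lfloor>x\<rfloor> * \<alpha>)\<close> is \<open>e(l * \<alpha> * x)\<close> times a function of the fractional part of \<open>x\<close>, and the residue of
  \<open>\<lfloor>x\<rfloor>\<close> modulo \<open>q\<close> is determined by \<open>x / q\<close> modulo 1.
  If the averages do not vanish, pass to a subsequence along which they stay away from 0 and which
  generates a Furstenberg measure. Van der Corput's inequality replaces \<open>a t\<close> by \<open>a (t + h) - a t\<close> and
  \<open>w n\<close> by \<open>w (n + h) * w n\<close>, which is a continuous function of the same ergodic orbit. After \<open>d\<close> steps the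
  phase has derivative tending to 0, so that the weight may be replaced by its averages over short
  intervals, and these are almost constant by the ergodic theorem. What remains are the unweighted
  averages, which are estimated by partial summation. For \<open>a t \<sim> c * t ^ d * ln t\<close> they do not vanish, but
  their size is of order \<open>1 / h\<close>, which still suffices for van der Corput.
\<close>

subsection \<open>Averages and van der Corput's inequality\<close>

text \<open>The induction on \<open>d\<close> has to close on itself, which dictates the class of
  weights. Van der Corput turns \<open>v n\<close> into \<open>v (n + h) * v n\<close>, so the
  weights are all the continuous functions bounded by 1, read along one orbit: this class is stable
  under such products, and one Furstenberg measure serves every member of it. Ergodicity of
  \<open>w\<close> is known only through limits along subsequences, hence the weighted estimates are
  stated for filters below \<open>sequentially\<close>. The gain of order \<open>1 / h\<close> has a
  simple origin. Growth is measured by the limit \<Lambda> of \<open>1 / (t * g t)\<close>, with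
  \<open>g\<close> the derivative of order \<open>d + 1\<close>. A difference of step
  \<open>h\<close> lowers the order by one and, by the mean value theorem, multiplies the size of
  that derivative by \<open>h\<close>, so \<Lambda> becomes \<open>\<Lambda> / h\<close>. A finite
  \<Lambda> is thus enough as soon as one difference is taken. For \<open>d = 0\<close> none is
  taken and \<Lambda> = 0 is required: the values of \<open>ln t\<close> at the integers are not
  equidistributed modulo 1.\<close>

definition avg :: "(nat \<Rightarrow> 'a::real_normed_field) \<Rightarrow> nat \<Rightarrow> 'a" where
  "avg u N = (\<Sum>n=1..N. u n) / of_nat N"

lemma avg_add: "avg (\<lambda>n. u n + v n) N = avg u N + avg v N"
  by (simp add: avg_def sum.distrib add_divide_distrib)

lemma avg_diff: "avg (\<lambda>n. u n - v n) N = avg u N - avg v N"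
  by (simp add: avg_def sum_subtractf diff_divide_distrib)

lemma avg_cmult: "avg (\<lambda>n. c * u n) N = c * avg u N"
  by (simp add: avg_def sum_distrib_left)

lemma avg_sum: "avg (\<lambda>n. \<Sum>i\<in>I. u i n) N = (\<Sum>i\<in>I. avg (u i) N)"
  unfolding avg_def by (subst sum.swap) (simp add: sum_divide_distrib)

lemma avg_of_real: "avg (\<lambda>n. of_real (u n)) N = of_real (avg u N)"
  by (simp add: avg_def)

lemma avg_cnj: "avg (\<lambda>n. cnj (u n)) N = cnj (avg u N)"
  by (simp add: avg_def)

lemma avg_mono: "(\<And>n. u n \<le> v n) \<Longrightarrow> avg u N \<le> (avg v N :: real)"
  by (auto simp: avg_def intro!: divide_right_mono sum_mono)

lemma norm_avg_le:
  fixes u :: "nat \<Rightarrow> 'a::real_normed_field"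
  assumes "\<And>n. norm (u n) \<le> v n"
  shows "norm (avg u N) \<le> avg v N"
  by (auto simp: avg_def norm_divide intro!: divide_right_mono sum_norm_le assms)

lemma avg_const_le: "0 \<le> c \<Longrightarrow> avg (\<lambda>_. c) N \<le> (c::real)"
  by (cases "N = 0") (auto simp: avg_def)

lemma norm_avg_le_const:
  fixes u :: "nat \<Rightarrow> 'a::real_normed_field"
  assumes "\<And>n. norm (u n) \<le> B"
  shows "norm (avg u N) \<le> B"
  using norm_avg_le[of u "\<lambda>_. B" N] assms avg_const_le[of B N] order_trans[OF norm_ge_zero assms[of 0]]
  by simp

lemma avg_shift_tendsto:
  fixes u :: "nat \<Rightarrow> 'a::real_normed_field"
  assumes "\<And>n. norm (u n) \<le> B"
  shows "(\<lambda>N. avg (\<lambda>n. u (n + h)) N - avg u N) \<longlonglongrightarrow> 0"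
proof (induction h)
  case (Suc h)
  have eq: "avg (\<lambda>n. u (n + Suc h)) N - avg (\<lambda>n. u (n + h)) N = (u (N + Suc h) - u (Suc h)) / of_nat N" for N
  proof -
    have "(\<Sum>n=1..N. u (n + Suc h)) - (\<Sum>n=1..N. u (n + h)) = u (N + Suc h) - u (Suc h)"
      by (induction N) (auto simp: algebra_simps)
    thus ?thesis by (simp add: avg_def flip: diff_divide_distrib)
  qed
  have "(\<lambda>N. avg (\<lambda>n. u (n + Suc h)) N - avg (\<lambda>n. u (n + h)) N) \<longlonglongrightarrow> 0"
  proof (rule Lim_null_comparison)
    show "\<forall>\<^sub>F N in sequentially. norm (avg (\<lambda>n. u (n + Suc h)) N - avg (\<lambda>n. u (n + h)) N) \<le> 2 * B / of_nat N"
      unfolding eq norm_divide norm_of_nat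
    proof (intro always_eventually allI divide_right_mono)
      fix N
      show "norm (u (N + Suc h) - u (Suc h)) \<le> 2 * B"
        using norm_triangle_ineq4[of "u (N + Suc h)" "u (Suc h)"] assms[of "N + Suc h"] assms[of "Suc h"]
        by simp
    qed simp
    show "(\<lambda>N. 2 * B / of_nat N) \<longlonglongrightarrow> 0"
      by (rule lim_const_over_n)
  qed
  from tendsto_add[OF this Suc] show ?case by simp
qed auto

text \<open>Each shift changes an average by boundary terms only, so a bounded sequence may be
  replaced by its means over progressions of step \<open>D\<close>. Large \<open>D\<close> serves
  van der Corput's inequality, \<open>D = 1\<close> the passage to short intervals.\<close>

lemma avg_smooth_tendsto:
  fixes u :: "nat \<Rightarrow> 'a::real_normed_field"
  assumes B: "\<And>n. norm (u n) \<le> B" and K: "K \<ge> 1"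
  shows "(\<lambda>N. avg (\<lambda>n. (\<Sum>i<K. u (n + i * D)) / of_nat K) N - avg u N) \<longlonglongrightarrow> 0"
proof -
  have eq: "avg (\<lambda>n. (\<Sum>i<K. u (n + i * D)) / of_nat K) N - avg u N
      = (\<Sum>i<K. avg (\<lambda>n. u (n + i * D)) N - avg u N) / of_nat K" for N
  proof -
    have "avg (\<lambda>n. (\<Sum>i<K. u (n + i * D)) / of_nat K) N = (\<Sum>i<K. avg (\<lambda>n. u (n + i * D)) N) / of_nat K"
      unfolding avg_sum[symmetric]
      using avg_cmult[of "1 / of_nat K" "\<lambda>n. \<Sum>i<K. u (n + i * D)" N] by simp
    thus ?thesis using K by (simp add: sum_subtractf field_simps)
  qed
  have "(\<lambda>N. (\<Sum>i<K. avg (\<lambda>n. u (n + i * D)) N - avg u N) / of_nat K) \<longlonglongrightarrow> (\<Sum>i<K. 0) / of_nat K"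
    by (intro tendsto_divide tendsto_sum tendsto_const avg_shift_tendsto[OF B]) (use K in auto)
  thus ?thesis unfolding eq by simp
qed

lemma avg_tendsto_zero:
  fixes u :: "nat \<Rightarrow> 'a::real_normed_field"
  assumes "u \<longlonglongrightarrow> 0"
  shows "avg u \<longlonglongrightarrow> 0"
proof (rule tendstoI)
  fix e :: real assume e: "e > 0"
  obtain m where m: "\<And>n. n \<ge> m \<Longrightarrow> norm (u n) < e / 2"
    using assms e unfolding lim_sequentially dist_norm by (metis diff_zero half_gt_zero)
  define C where "C = (\<Sum>n=1..m. norm (u n))"
  have "\<forall>\<^sub>F N in sequentially. real N > 2 * C / e" "\<forall>\<^sub>F N in sequentially. N \<ge> Suc m"
    using filterlim_real_sequentially by (auto simp: filterlim_at_top_dense eventually_ge_at_top)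
  thus "\<forall>\<^sub>F N in sequentially. dist (avg u N) 0 < e"
  proof eventually_elim
    case (elim N)
    have "norm (\<Sum>n=1..N. u n) \<le> (\<Sum>n=1..N. norm (u n))" by (rule norm_sum)
    also have "(\<Sum>n=1..N. norm (u n)) = C + (\<Sum>n=m+1..N. norm (u n))"
    proof -
      have "{1..N} = {1..m} \<union> {m+1..N}" using elim by auto
      moreover have "(\<Sum>n\<in>{1..m} \<union> {m+1..N}. norm (u n)) = C + (\<Sum>n=m+1..N. norm (u n))"
        unfolding C_def by (rule sum.union_disjoint) auto
      ultimately show ?thesis by simp
    qed
    also have "(\<Sum>n=m+1..N. norm (u n)) \<le> (\<Sum>n=m+1..N. e / 2)"
      by (intro sum_mono less_imp_le m) auto
    also have "(\<Sum>n=m+1..N. e / 2) \<le> real N * (e / 2)"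
      using e by (simp add: mult_right_mono)
    finally have "norm (\<Sum>n=1..N. u n) \<le> C + real N * (e / 2)" by simp
    also have "C < real N * (e / 2)" using elim(1) e by (simp add: field_simps)
    finally have "norm (\<Sum>n=1..N. u n) < real N * e" by (simp add: field_simps)
    thus ?case using elim(2) by (simp add: avg_def norm_divide pos_divide_less_eq mult.commute)
  qed
qed

lemma norm_avg_power2_le:
  fixes u :: "nat \<Rightarrow> 'a::real_normed_field"
  shows "(norm (avg u N))\<^sup>2 \<le> avg (\<lambda>n. (norm (u n))\<^sup>2) N"
proof -
  have "(norm (\<Sum>n=1..N. u n))\<^sup>2 \<le> (\<Sum>n=1..N. norm (u n))\<^sup>2"
    by (intro power_mono norm_sum) auto
  also have "\<dots> \<le> (\<Sum>n=1..N. (norm (u n))\<^sup>2) * (\<Sum>n=1..N. 1\<^sup>2)"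
    using Cauchy_Schwarz_ineq_sum[of "\<lambda>n. norm (u n)" "\<lambda>_. 1" "{1..N}"] by simp
  finally have "(norm (\<Sum>n=1..N. u n))\<^sup>2 \<le> (\<Sum>n=1..N. (norm (u n))\<^sup>2) * real N" by simp
  thus ?thesis
    by (cases "N = 0") (auto simp: avg_def norm_divide power_divide field_simps power2_eq_square)
qed

text \<open>Cauchy-Schwarz is applied to means of \<open>u\<close> over \<open>K\<close> points in
  progression of step \<open>D\<close>. The lags off the diagonal are then nonzero multiples of
  \<open>D\<close>, so small lags, where estimates of order \<open>1 / h\<close> are useless, never
  appear. Only finitely many lags occur, so the bounds need not be uniform in
  \<open>h\<close>.\<close>

theorem van_der_Corput:
  fixes u :: "nat \<Rightarrow> complex"
  assumes F: "F \<le> sequentially" and B: "\<And>n. norm (u n) \<le> B"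
    and corr: "\<And>\<epsilon>. \<epsilon> > 0 \<Longrightarrow> \<exists>D\<ge>1. \<forall>h\<ge>D. \<forall>\<^sub>F N in F. norm (avg (\<lambda>n. u (n + h) * cnj (u n)) N) \<le> \<epsilon>"
  shows "(avg u \<longlongrightarrow> 0) F"
proof -
  have B0: "B \<ge> 0" by (rule order_trans[OF norm_ge_zero B])
  have main: "\<forall>\<^sub>F N in F. norm (avg u N) < 2 * e" if "e > 0" for e :: real
  proof -
    \<comment> \<open>The off-diagonal correlations will contribute \<open>2 * \<epsilon>\<close>
      and the diagonal at most \<epsilon>, in total
      \<open>3 * \<epsilon> < e\<^sup>2\<close>.\<close>
    define \<epsilon> where "\<epsilon> = e\<^sup>2 / 4"
    have \<epsilon>: "\<epsilon> > 0" using that by (simp add: \<epsilon>_def)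
    obtain D where D: "D \<ge> 1" "\<And>h. h \<ge> D \<Longrightarrow> \<forall>\<^sub>F N in F. norm (avg (\<lambda>n. u (n + h) * cnj (u n)) N) \<le> \<epsilon>"
      using corr[OF \<epsilon>] by blast
    obtain K :: nat where K: "B\<^sup>2 / \<epsilon> < real K" using reals_Archimedean2 by blast
    have "0 \<le> B\<^sup>2 / \<epsilon>" using \<epsilon> by simp
    hence K0: "0 < K" using K by (cases K) auto
    have K1: "B\<^sup>2 \<le> \<epsilon> * real K" using K \<epsilon> by (simp add: field_simps)
    define S where "S n = (\<Sum>i<K. u (n + i * D)) / of_nat K" for n
    have shift: "((\<lambda>N. avg (\<lambda>n. v (n + h)) N - avg v N) \<longlongrightarrow> 0) F"
      if "\<And>n. norm (v n) \<le> C" for v :: "nat \<Rightarrow> complex" and h C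
      by (rule tendsto_mono[OF F avg_shift_tendsto[OF that]])
    have "((\<lambda>N. avg S N - avg u N) \<longlongrightarrow> 0) F"
      unfolding S_def by (rule tendsto_mono[OF F avg_smooth_tendsto[OF B]]) (use K0 in simp)
    hence diff: "\<forall>\<^sub>F N in F. norm (avg S N - avg u N) < e / 2"
      using that by (auto simp: tendsto_iff dist_norm dest!: spec[of _ "e/2"])
    define c where "c i j N = avg (\<lambda>n. u (n + i * D) * cnj (u (n + j * D))) N" for i j N
    have cB: "norm (c i j N) \<le> B\<^sup>2" for i j N
      unfolding c_def power2_eq_square using B B0
      by (intro norm_avg_le_const) (auto simp: norm_mult intro!: mult_mono)
    \<comment> \<open>Moving the average by \<open>j * D\<close> leaves a correlation of lag
      \<open>(i - j) * D\<close>, which is at least \<open>D\<close>; the move costs another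
      \<epsilon>, hence the factor 2.\<close>
    have lt: "\<forall>\<^sub>F N in F. norm (c i j N) \<le> 2 * \<epsilon>" if "j < i" for i j
    proof -
      define g where "g n = u (n + (i - j) * D) * cnj (u n)" for n
      have "norm (g n) \<le> B\<^sup>2" for n
        unfolding g_def power2_eq_square using B B0 by (auto simp: norm_mult intro!: mult_mono)
      from shift[where v=g and h="j * D", OF this] have ev1:
        "\<forall>\<^sub>F N in F. norm (avg (\<lambda>n. g (n + j * D)) N - avg g N) < \<epsilon>"
        using \<epsilon> by (auto simp: tendsto_iff dist_norm)
      have "1 \<le> i - j" using that by linarith
      from mult_le_mono1[OF this, of D] have "D \<le> (i - j) * D" by simp
      hence ev2: "\<forall>\<^sub>F N in F. norm (avg g N) \<le> \<epsilon>" unfolding g_def by (rule D)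
      have "i * D = j * D + (i - j) * D" using that
        by (simp add: add_mult_distrib[symmetric])
      hence "g (n + j * D) = u (n + i * D) * cnj (u (n + j * D))" for n
        by (simp add: g_def add.assoc)
      hence cg: "avg (\<lambda>n. g (n + j * D)) N = c i j N" for N by (simp add: c_def)
      from ev1 ev2 show ?thesis
      proof eventually_elim
        case (elim N)
        thus ?case unfolding cg using norm_triangle_sub[of "c i j N" "avg g N"] by simp
      qed
    qed
    have csym: "norm (c i j N) = norm (c j i N)" for i j N
    proof -
      have "c i j N = cnj (c j i N)" unfolding c_def avg_cnj[symmetric] by (simp add: mult.commute)
      thus ?thesis by simp
    qed
    have "\<forall>\<^sub>F N in F. \<forall>i<K. \<forall>j<K. i \<noteq> j \<longrightarrow> norm (c i j N) \<le> 2 * \<epsilon>"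
    proof -
      have "\<forall>\<^sub>F N in F. i \<noteq> j \<longrightarrow> norm (c i j N) \<le> 2 * \<epsilon>" for i j
        by (cases i j rule: linorder_cases) (use lt[of i j] lt[of j i] csym[of i j] in simp_all)
      hence "\<forall>\<^sub>F N in F. \<forall>i\<in>{..<K}. \<forall>j\<in>{..<K}. i \<noteq> j \<longrightarrow> norm (c i j N) \<le> 2 * \<epsilon>"
        by (intro eventually_ball_finite ballI finite_lessThan)
      thus ?thesis by (auto elim: eventually_mono)
    qed
    hence "\<forall>\<^sub>F N in F. norm (avg S N) < e"
    proof eventually_elim
      case (elim N)
      have S2: "complex_of_real ((norm (S n))\<^sup>2) = (\<Sum>i<K. \<Sum>j<K. u (n + i * D) * cnj (u (n + j * D))) / (of_nat K)\<^sup>2" for n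
        unfolding complex_norm_square S_def by (simp add: sum_product power2_eq_square)
      have "complex_of_real (avg (\<lambda>n. (norm (S n))\<^sup>2) N) = avg (\<lambda>n. complex_of_real ((norm (S n))\<^sup>2)) N"
        by (simp only: avg_of_real)
      also have "\<dots> = (\<Sum>i<K. \<Sum>j<K. c i j N) / (of_nat K)\<^sup>2"
        unfolding S2 c_def avg_sum[symmetric]
        using avg_cmult[of "1 / (of_nat K)\<^sup>2" "\<lambda>n. \<Sum>i<K. \<Sum>j<K. u (n + i * D) * cnj (u (n + j * D))" N]
        by simp
      finally have e1: "complex_of_real (avg (\<lambda>n. (norm (S n))\<^sup>2) N) = (\<Sum>i<K. \<Sum>j<K. c i j N) / (of_nat K)\<^sup>2" .
      have "avg (\<lambda>n. (norm (S n))\<^sup>2) N \<le> norm (complex_of_real (avg (\<lambda>n. (norm (S n))\<^sup>2) N))"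
        by simp
      also have "\<dots> = norm (\<Sum>i<K. \<Sum>j<K. c i j N) / (real K)\<^sup>2"
        unfolding e1 by (simp only: norm_divide norm_power norm_of_nat)
      also have "norm (\<Sum>i<K. \<Sum>j<K. c i j N) \<le> (\<Sum>i<K. \<Sum>j<K. 2 * \<epsilon> + (if j = i then B\<^sup>2 else 0))"
      proof (intro sum_norm_le)
        fix i j assume "i \<in> {..<K}" "j \<in> {..<K}"
        thus "norm (c i j N) \<le> 2 * \<epsilon> + (if j = i then B\<^sup>2 else 0)"
          using elim cB[of i j N] \<epsilon> by (cases "j = i") auto
      qed
      also have "(\<Sum>i<K. \<Sum>j<K. 2 * \<epsilon> + (if j = i then B\<^sup>2 else 0)) = (real K)\<^sup>2 * (2 * \<epsilon>) + real K * B\<^sup>2"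
        by (simp add: sum.distrib power2_eq_square algebra_simps)
      also have "\<dots> \<le> (real K)\<^sup>2 * (3 * \<epsilon>)"
        using mult_left_mono[OF K1, of "real K"] by (simp add: power2_eq_square algebra_simps)
      finally have "avg (\<lambda>n. (norm (S n))\<^sup>2) N \<le> 3 * \<epsilon>" using K0 by (simp add: field_simps)
      hence "(norm (avg S N))\<^sup>2 \<le> 3 * \<epsilon>" by (rule order_trans[OF norm_avg_power2_le])
      also have "\<dots> < e\<^sup>2" using that by (simp add: \<epsilon>_def)
      finally show "norm (avg S N) < e"
        by (rule power_less_imp_less_base) (use that in simp)
    qed
    with diff show ?thesis
    proof eventually_elim
      case (elim N)
      have "norm (avg u N) \<le> norm (avg S N) + norm (avg S N - avg u N)"
        using norm_triangle_sub[of "avg u N" "avg S N"] by (simp add: norm_minus_commute)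
      with elim that show ?case by simp
    qed
  qed
  show ?thesis
  proof (rule tendstoI)
    fix e :: real assume "e > 0"
    with main[of "e/2"] show "\<forall>\<^sub>F N in F. dist (avg u N) 0 < e" by simp
  qed
qed

subsection \<open>Slowly varying phases\<close>

definition ee :: "real \<Rightarrow> complex" where "ee t = cis (2 * pi * t)"

lemma norm_ee [simp]: "norm (ee t) = 1"
  by (simp add: ee_def)

lemma ee_0 [simp]: "ee 0 = 1"
  by (simp add: ee_def)

lemma ee_add: "ee (s + t) = ee s * ee t"
  by (simp add: ee_def cis_mult algebra_simps)

lemma ee_diff: "ee (s - t) = ee s * cnj (ee t)"
  by (simp add: ee_def cis_mult cis_cnj algebra_simps)

lemma ee_of_int [simp]: "ee (of_int k) = 1"
  using cis_multiple_2pi[of "of_int k"] by (simp add: ee_def algebra_simps)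

lemma norm_ee_sub_linear_le: "norm (ee t - 1 - 2 * pi * t * \<i>) \<le> (2 * pi * t)\<^sup>2 / 2"
proof -
  have "norm (iexp (2 * pi * t) - (\<Sum>k\<le>1. (\<i> * complex_of_real (2 * pi * t))^k / fact k)) \<le> \<bar>2 * pi * t\<bar>^(Suc 1) / fact (Suc 1)"
    by (rule iexp_approx1)
  moreover have "iexp (2 * pi * t) - (\<Sum>k\<le>1. (\<i> * complex_of_real (2 * pi * t))^k / fact k) = ee t - 1 - 2 * pi * t * \<i>"
    by (simp add: ee_def cis_conv_exp algebra_simps)
  moreover have "\<bar>2 * pi * t\<bar>^(Suc 1) / fact (Suc 1) = (2 * pi * t)\<^sup>2 / 2"
    by (simp add: numeral_2_eq_2 flip: power2_abs)
  ultimately show ?thesis by metis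
qed

text \<open>Summation by parts leaves two boundary terms and the sum of \<open>E\<close> against the
  increments of \<open>\<phi>\<close>, which are nonnegative and telescope. The upper boundary term
  stays on the left so that the induction on \<open>N\<close> closes.\<close>

lemma abel_summation_bound:
  fixes E :: "nat \<Rightarrow> complex" and \<phi> :: "nat \<Rightarrow> real"
  assumes E: "\<And>n. norm (E n) \<le> 1" and mono: "\<And>n. n \<ge> m \<Longrightarrow> \<phi> n \<le> \<phi> (Suc n)" and "N \<ge> m"
  shows "norm ((\<Sum>n=m..N. \<phi> n * (E (Suc n) - E n)) - \<phi> N * E (Suc N)) \<le> \<bar>\<phi> m\<bar> + (\<phi> N - \<phi> m)"
  using \<open>N \<ge> m\<close>
proof (induction N rule: dec_induct)
  case base
  have "norm (\<phi> m * (E (Suc m) - E m) - \<phi> m * E (Suc m)) = \<bar>\<phi> m\<bar> * norm (E m)"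
    by (simp add: algebra_simps norm_mult)
  also have "\<dots> \<le> \<bar>\<phi> m\<bar>" using mult_left_mono[OF E[of m], of "\<bar>\<phi> m\<bar>"] by simp
  finally show ?case by simp
next
  case (step N)
  have "(\<Sum>n=m..Suc N. \<phi> n * (E (Suc n) - E n)) - \<phi> (Suc N) * E (Suc (Suc N))
     = ((\<Sum>n=m..N. \<phi> n * (E (Suc n) - E n)) - \<phi> N * E (Suc N)) - of_real (\<phi> (Suc N) - \<phi> N) * E (Suc N)"
    using step(1) by (simp add: algebra_simps)
  also have "norm \<dots> \<le> norm ((\<Sum>n=m..N. \<phi> n * (E (Suc n) - E n)) - \<phi> N * E (Suc N)) + norm (of_real (\<phi> (Suc N) - \<phi> N) * E (Suc N))"
    by (rule norm_triangle_ineq4)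
  also have "norm (of_real (\<phi> (Suc N) - \<phi> N) * E (Suc N)) \<le> \<phi> (Suc N) - \<phi> N"
    using mono[OF step(1)] mult_left_mono[OF E[of "Suc N"], of "\<phi> (Suc N) - \<phi> N"]
    by (simp add: norm_mult del: of_real_diff)
  finally show ?case using step.IH by simp
qed

lemma abel_summation_bound_abs:
  fixes E :: "nat \<Rightarrow> complex" and \<phi> :: "nat \<Rightarrow> real"
  assumes E: "\<And>n. norm (E n) \<le> 1" and "N \<ge> m"
    and mono: "(\<forall>n\<ge>m. \<phi> n \<le> \<phi> (Suc n)) \<or> (\<forall>n\<ge>m. \<phi> (Suc n) \<le> \<phi> n)"
  shows "norm (\<Sum>n=m..N. \<phi> n * (E (Suc n) - E n)) \<le> 2 * \<bar>\<phi> m\<bar> + 2 * \<bar>\<phi> N\<bar>"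
proof -
  have "norm (\<Sum>n=m..N. \<phi> n * (E (Suc n) - E n)) \<le> 2 * \<bar>\<phi> m\<bar> + 2 * \<bar>\<phi> N\<bar>"
    if mono: "\<And>n. n \<ge> m \<Longrightarrow> \<phi> n \<le> \<phi> (Suc n)" for \<phi> :: "nat \<Rightarrow> real"
  proof -
    have "norm (\<Sum>n=m..N. \<phi> n * (E (Suc n) - E n))
        \<le> norm ((\<Sum>n=m..N. \<phi> n * (E (Suc n) - E n)) - \<phi> N * E (Suc N)) + norm (\<phi> N * E (Suc N))"
      using norm_triangle_sub[of "\<Sum>n=m..N. \<phi> n * (E (Suc n) - E n)" "\<phi> N * E (Suc N)"] by simp
    also have "norm (\<phi> N * E (Suc N)) \<le> \<bar>\<phi> N\<bar>"
      using mult_left_mono[OF E[of "Suc N"], of "\<bar>\<phi> N\<bar>"] by (simp add: norm_mult)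
    finally show ?thesis using abel_summation_bound[of E m \<phi> N, OF E mono \<open>N \<ge> m\<close>] by simp
  qed
  from this[of \<phi>] this[of "\<lambda>n. - \<phi> n"] mono show ?thesis
    by (auto simp: sum_negf)
qed

text \<open>
  With \<open>E n = e(\<alpha> n)\<close>, we have \<open>E n \<approx> (E (n + 1) - E n) / (2 \<pi> \<i> \<theta> n)\<close>, and the right-hand side can be
  summed by parts because \<open>1 / \<theta> n\<close> is monotone.
\<close>

lemma avg_ee_slowly_varying:
  fixes \<alpha> :: "nat \<Rightarrow> real"
  defines "\<theta> \<equiv> \<lambda>n. \<alpha> (Suc n) - \<alpha> n"
  assumes m: "m \<ge> 1" and \<theta>0: "\<theta> \<longlonglongrightarrow> 0" and nz: "\<And>n. n \<ge> m \<Longrightarrow> \<theta> n \<noteq> 0"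
    and mono: "(\<forall>n\<ge>m. 1 / \<theta> n \<le> 1 / \<theta> (Suc n)) \<or> (\<forall>n\<ge>m. 1 / \<theta> (Suc n) \<le> 1 / \<theta> n)"
    and lim: "(\<lambda>n. 1 / (real n * \<theta> n)) \<longlonglongrightarrow> \<Lambda>" and \<epsilon>: "\<epsilon> > 0"
  shows "\<forall>\<^sub>F N in sequentially. norm (avg (\<lambda>n. ee (\<alpha> n)) N) \<le> \<bar>\<Lambda>\<bar> + \<epsilon>"
proof -
  define E where "E n = ee (\<alpha> n)" for n
  define \<phi> where "\<phi> n = 1 / \<theta> n" for n
  have E1: "norm (E n) \<le> 1" for n by (simp add: E_def)
  \<comment> \<open>The Taylor remainder of \<open>ee (\<theta> n)\<close> is quadratic in
    \<open>\<theta> n\<close>, so after division by \<open>\<theta> n\<close> the error is still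
    linear and its mean tends to 0. The numeral 4 only bounds \<open>pi\<close>.\<close>
  have approx: "norm (2 * pi * E n - (- \<i>) * (\<phi> n * (E (Suc n) - E n))) \<le> 2 * pi * (4 * \<bar>\<theta> n\<bar>)" if "n \<ge> m" for n
  proof -
    have t: "\<theta> n \<noteq> 0" using nz that by blast
    have "E (Suc n) = E n * ee (\<theta> n)" unfolding E_def \<theta>_def by (simp flip: ee_add)
    hence "2 * pi * E n - (- \<i>) * (\<phi> n * (E (Suc n) - E n)) = \<i> * \<phi> n * E n * (ee (\<theta> n) - 1 - 2 * pi * \<theta> n * \<i>)"
      using t by (simp add: \<phi>_def field_simps)
    also have "norm \<dots> = \<bar>\<phi> n\<bar> * norm (ee (\<theta> n) - 1 - 2 * pi * \<theta> n * \<i>)"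
      by (simp add: norm_mult E_def)
    also have "\<dots> \<le> \<bar>\<phi> n\<bar> * ((2 * pi * \<theta> n)\<^sup>2 / 2)"
      by (intro mult_left_mono norm_ee_sub_linear_le) auto
    also have "\<dots> = 2 * pi * (pi * \<bar>\<theta> n\<bar>)"
      using t by (simp add: \<phi>_def field_simps power2_eq_square abs_if)
    also have "\<dots> \<le> 2 * pi * (4 * \<bar>\<theta> n\<bar>)"
      using pi_less_4 by (intro mult_left_mono mult_right_mono) auto
    finally show ?thesis .
  qed
  have tail: "norm (\<Sum>n=m..N. E n) \<le> 4 * (\<Sum>n=m..N. \<bar>\<theta> n\<bar>) + \<bar>\<phi> m\<bar> + \<bar>\<phi> N\<bar>" if "N \<ge> m" for N
  proof -
    define X where "X = (\<Sum>n=m..N. 2 * pi * E n - (- \<i>) * (\<phi> n * (E (Suc n) - E n)))"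
    define Y where "Y = (\<Sum>n=m..N. \<phi> n * (E (Suc n) - E n))"
    have X: "norm X \<le> 2 * pi * (4 * (\<Sum>n=m..N. \<bar>\<theta> n\<bar>))"
      unfolding X_def sum_distrib_left by (intro sum_norm_le approx) auto
    have Y: "norm Y \<le> 2 * \<bar>\<phi> m\<bar> + 2 * \<bar>\<phi> N\<bar>"
      unfolding Y_def by (rule abel_summation_bound_abs[OF E1 that]) (use mono in \<open>simp add: \<phi>_def\<close>)
    have XY: "2 * pi * (\<Sum>n=m..N. E n) = X + (- \<i>) * Y"
      unfolding X_def Y_def sum_distrib_left sum_subtractf by simp
    have "2 * pi * norm (\<Sum>n=m..N. E n) = norm (2 * pi * (\<Sum>n=m..N. E n))"
      by (simp add: norm_mult)
    also have "\<dots> \<le> norm X + norm Y"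
      unfolding XY using norm_triangle_ineq[of X "(- \<i>) * Y"] by (simp add: norm_mult)
    finally have "2 * pi * norm (\<Sum>n=m..N. E n) \<le> norm X + norm Y" .
    moreover have "2 * \<bar>\<phi> m\<bar> + 2 * \<bar>\<phi> N\<bar> \<le> 2 * pi * (\<bar>\<phi> m\<bar> + \<bar>\<phi> N\<bar>)"
      using mult_right_mono[of 1 pi "\<bar>\<phi> m\<bar> + \<bar>\<phi> N\<bar>"] pi_ge_two by simp
    ultimately have "2 * pi * norm (\<Sum>n=m..N. E n) \<le> 2 * pi * (4 * (\<Sum>n=m..N. \<bar>\<theta> n\<bar>)) + 2 * pi * (\<bar>\<phi> m\<bar> + \<bar>\<phi> N\<bar>)"
      using X Y by linarith
    hence "2 * pi * norm (\<Sum>n=m..N. E n) \<le> 2 * pi * (4 * (\<Sum>n=m..N. \<bar>\<theta> n\<bar>) + (\<bar>\<phi> m\<bar> + \<bar>\<phi> N\<bar>))"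
      by (simp only: distrib_left)
    thus ?thesis by simp
  qed
  \<comment> \<open>As \<open>N\<close> grows, the first term vanishes, the second does by Cesaro's
    theorem, and the third tends to \<open>\<bar>\<Lambda>\<bar>\<close>: only the upper endpoint of
    the summation by parts survives.\<close>
  have bound: "norm (avg E N) \<le> (real m + \<bar>\<phi> m\<bar>) / real N + 4 * avg (\<lambda>n. \<bar>\<theta> n\<bar>) N + \<bar>1 / (real N * \<theta> N)\<bar>"
    if N: "N \<ge> Suc m" for N
  proof -
    have "norm (\<Sum>n=1..N. E n) \<le> real m + (4 * (\<Sum>n=1..N. \<bar>\<theta> n\<bar>) + \<bar>\<phi> m\<bar> + \<bar>\<phi> N\<bar>)"
    proof -
      have "{1..N} = {1..<m} \<union> {m..N}" using m N by auto
      hence eq: "sum E {1..N} = sum E {1..<m} + sum E {m..N}"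
        by (simp add: sum.union_disjoint ivl_disj_int)
      have "norm (sum E {1..<m}) \<le> (\<Sum>n\<in>{1..<m}. 1)" by (intro sum_norm_le E1)
      hence 1: "norm (sum E {1..<m}) \<le> real m" by simp
      have "(\<Sum>n=m..N. \<bar>\<theta> n\<bar>) \<le> (\<Sum>n=1..N. \<bar>\<theta> n\<bar>)"
        using m by (intro sum_mono2) auto
      with 1 tail[of N] N show ?thesis unfolding eq using norm_triangle_ineq[of "sum E {1..<m}" "sum E {m..N}"] by simp
    qed
    hence "norm (\<Sum>n=1..N. E n) / real N \<le> (real m + (4 * (\<Sum>n=1..N. \<bar>\<theta> n\<bar>) + \<bar>\<phi> m\<bar> + \<bar>\<phi> N\<bar>)) / real N"
      by (rule divide_right_mono) simp
    thus ?thesis by (simp add: avg_def norm_divide add_divide_distrib \<phi>_def abs_mult mult.commute)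
  qed
  have "(\<lambda>N. (real m + \<bar>\<phi> m\<bar>) / real N + 4 * avg (\<lambda>n. \<bar>\<theta> n\<bar>) N + \<bar>1 / (real N * \<theta> N)\<bar>) \<longlonglongrightarrow> 0 + 4 * 0 + \<bar>\<Lambda>\<bar>"
    by (intro tendsto_add tendsto_mult tendsto_const tendsto_rabs lim lim_const_over_n avg_tendsto_zero
        tendsto_rabs_zero \<theta>0)
  hence "\<forall>\<^sub>F N in sequentially. (real m + \<bar>\<phi> m\<bar>) / real N + 4 * avg (\<lambda>n. \<bar>\<theta> n\<bar>) N + \<bar>1 / (real N * \<theta> N)\<bar> < \<bar>\<Lambda>\<bar> + \<epsilon>"
    using \<epsilon> by (intro order_tendstoD(2)) auto
  moreover have "\<forall>\<^sub>F N in sequentially. N \<ge> Suc m" by (rule eventually_ge_at_top)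
  ultimately show ?thesis
  proof eventually_elim
    case (elim N)
    thus ?case using bound[of N] unfolding E_def[abs_def] by simp
  qed
qed

text \<open>The mean ergodic theorem as seen from one sequence: the window length \<open>H\<close>
  is fixed first, and only then does \<open>N\<close> run along \<open>F\<close>.\<close>

definition short_averages :: "nat filter \<Rightarrow> (nat \<Rightarrow> real) \<Rightarrow> real \<Rightarrow> bool" where
  "short_averages F v c \<longleftrightarrow>
     (\<forall>\<epsilon>>0. \<exists>H\<ge>1. \<forall>\<^sub>F N in F. avg (\<lambda>n. \<bar>(\<Sum>h<H. v (n + h)) / real H - c\<bar>) N \<le> \<epsilon>)"

text \<open>Because \<open>H\<close> is chosen before \<open>N\<close> grows, the phase is
  asymptotically constant on windows of length \<open>H\<close> and can be taken out of them. The
  unweighted average then enters multiplied by \<open>c\<close>, hence the factor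
  \<open>B\<close>.\<close>

lemma avg_weighted_ee_slowly_varying:
  fixes \<alpha> :: "nat \<Rightarrow> real"
  assumes F: "F \<le> sequentially" and v: "\<And>n. \<bar>v n\<bar> \<le> B" and c: "\<bar>c\<bar> \<le> B" and sh: "short_averages F v c"
    and \<theta>0: "(\<lambda>n. \<alpha> (Suc n) - \<alpha> n) \<longlonglongrightarrow> 0"
    and bnd: "\<And>\<epsilon>. \<epsilon> > 0 \<Longrightarrow> \<forall>\<^sub>F N in sequentially. norm (avg (\<lambda>n. ee (\<alpha> n)) N) \<le> \<Lambda> + \<epsilon>"
    and \<epsilon>: "\<epsilon> > 0"
  shows "\<forall>\<^sub>F N in F. norm (avg (\<lambda>n. v n * ee (\<alpha> n)) N) \<le> B * \<Lambda> + \<epsilon>"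
proof -
  define E where "E n = ee (\<alpha> n)" for n
  have B0: "B \<ge> 0" using c by linarith
  \<comment> \<open>Four errors arise below: three of size \<delta> and one of size
    \<open>B * \<delta>\<close>, each at most \<open>\<epsilon> / 4\<close>.\<close>
  define \<delta> where "\<delta> = \<epsilon> / (4 * (B + 1))"
  have \<delta>: "\<delta> > 0" and B\<delta>: "B * \<delta> \<le> \<epsilon> / 4" "\<delta> \<le> \<epsilon> / 4"
    using \<epsilon> B0 by (auto simp: \<delta>_def field_simps)
  obtain H where H: "H \<ge> 1" "\<forall>\<^sub>F N in F. avg (\<lambda>n. \<bar>(\<Sum>h<H. v (n + h)) / real H - c\<bar>) N \<le> \<delta>"
    using sh \<delta> unfolding short_averages_def by blast
  define A where "A n = (\<Sum>h<H. v (n + h)) / real H" for n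
  define S where "S n = (\<Sum>h<H. v (n + h) * E (n + h)) / of_nat H" for n
  have "(\<lambda>N. avg S N - avg (\<lambda>n. v n * E n) N) \<longlonglongrightarrow> 0"
    unfolding S_def using avg_smooth_tendsto[of "\<lambda>n. v n * E n" B H 1] v H(1) by (simp add: norm_mult E_def)
  hence 1: "\<forall>\<^sub>F N in F. norm (avg S N - avg (\<lambda>n. v n * E n) N) < \<delta>"
    using \<delta> by (auto simp: tendsto_iff intro: filter_leD[OF F])
  have Ed: "(\<lambda>n. E (n + h) - E n) \<longlonglongrightarrow> 0" for h
  proof (induction h)
    case (Suc h)
    have "(\<lambda>n. ee (\<alpha> (Suc n) - \<alpha> n) - 1) \<longlonglongrightarrow> ee 0 - 1"
      unfolding ee_def cis_conv_exp by (intro tendsto_intros \<theta>0)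
    hence "(\<lambda>n. norm (ee (\<alpha> (Suc n) - \<alpha> n) - 1)) \<longlonglongrightarrow> 0"
      by (simp add: tendsto_norm_zero)
    moreover have "norm (E (Suc n) - E n) = norm (ee (\<alpha> (Suc n) - \<alpha> n) - 1)" for n
    proof -
      have "E (Suc n) - E n = E n * (ee (\<alpha> (Suc n) - \<alpha> n) - 1)"
        unfolding E_def by (simp add: algebra_simps flip: ee_add)
      thus ?thesis by (simp add: norm_mult E_def)
    qed
    ultimately have "(\<lambda>n. E (Suc n) - E n) \<longlonglongrightarrow> 0"
      by (intro tendsto_norm_zero_cancel[of "\<lambda>n. E (Suc n) - E n"]) simp
    from tendsto_add[OF LIMSEQ_ignore_initial_segment[OF this, of h] Suc] show ?case by simp
  qed auto
  have S_diff: "S n - A n * E n = (\<Sum>h<H. v (n + h) * (E (n + h) - E n)) / of_nat H" for n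
    unfolding S_def A_def by (simp add: right_diff_distrib sum_subtractf sum_distrib_right diff_divide_distrib sum_divide_distrib)
  have "(\<lambda>n. v (n + h) * (E (n + h) - E n)) \<longlonglongrightarrow> 0" for h
  proof (rule Lim_null_comparison)
    show "\<forall>\<^sub>F n in sequentially. norm (v (n + h) * (E (n + h) - E n)) \<le> B * norm (E (n + h) - E n)"
      using v by (auto simp: norm_mult intro!: always_eventually mult_right_mono)
    show "(\<lambda>n. B * norm (E (n + h) - E n)) \<longlonglongrightarrow> 0"
      using tendsto_mult[OF tendsto_const[of B] tendsto_norm_zero[OF Ed[of h]]] by simp
  qed
  hence "(\<lambda>n. S n - A n * E n) \<longlonglongrightarrow> (\<Sum>h<H. 0) / of_nat H"
    unfolding S_diff by (intro tendsto_divide tendsto_sum tendsto_const) (use H(1) in auto)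
  hence "avg (\<lambda>n. S n - A n * E n) \<longlonglongrightarrow> 0" by (intro avg_tendsto_zero) simp
  hence 2: "\<forall>\<^sub>F N in F. norm (avg (\<lambda>n. S n - A n * E n) N) < \<delta>"
    using \<delta> by (auto simp: tendsto_iff intro: filter_leD[OF F])
  have 3: "\<forall>\<^sub>F N in F. norm (avg E N) \<le> \<Lambda> + \<delta>"
    unfolding E_def by (rule filter_leD[OF F bnd[OF \<delta>]])
  from 1 2 3 H(2) show ?thesis
  proof eventually_elim
    case (elim N)
    have "norm (avg (\<lambda>n. of_real (A n - c) * E n) N) \<le> avg (\<lambda>n. \<bar>A n - c\<bar>) N"
      by (rule norm_avg_le) (simp add: norm_mult E_def del: of_real_diff)
    also have "\<dots> \<le> \<delta>" using elim(4) by (simp add: A_def)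
    finally have 4: "norm (avg (\<lambda>n. of_real (A n - c) * E n) N) \<le> \<delta>" .
    have 5: "norm (c * avg E N) \<le> B * (\<Lambda> + \<delta>)"
      unfolding norm_mult using elim(3) c B0 by (intro mult_mono) auto
    have "avg (\<lambda>n. v n * E n) N = - (avg S N - avg (\<lambda>n. v n * E n) N) + avg (\<lambda>n. S n - A n * E n) N
       + avg (\<lambda>n. of_real (A n - c) * E n) N + c * avg E N"
      unfolding avg_diff avg_cmult[symmetric] by (simp add: algebra_simps avg_diff)
    hence "norm (avg (\<lambda>n. v n * E n) N) \<le> norm (- (avg S N - avg (\<lambda>n. v n * E n) N)) + norm (avg (\<lambda>n. S n - A n * E n) N)
       + norm (avg (\<lambda>n. of_real (A n - c) * E n) N) + norm (c * avg E N)"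
      by (rule ssubst) (intro order_trans[OF norm_triangle_ineq] add_mono order_refl)
    also have "\<dots> \<le> \<delta> + \<delta> + \<delta> + B * (\<Lambda> + \<delta>)" using elim 4 5 by (intro add_mono) (auto simp: norm_minus_commute)
    also have "\<dots> \<le> B * \<Lambda> + \<epsilon>" using B\<delta> by (simp add: algebra_simps)
    finally show ?case by (simp add: E_def)
  qed
qed

subsection \<open>Growth of functions and of their derivatives\<close>

lemma monotone_limit_at_top:
  fixes f :: "real \<Rightarrow> real"
  assumes mono: "\<And>s t. T \<le> s \<Longrightarrow> s \<le> t \<Longrightarrow> f s \<le> f t"
  shows "(\<exists>L. (f \<longlongrightarrow> L) at_top) \<or> filterlim f at_top at_top"
proof (cases "bdd_above (f ` {T..})")
  case True
  define L where "L = Sup (f ` {T..})"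
  have "(f \<longlongrightarrow> L) at_top"
  proof (rule order_tendstoI)
    fix y assume "y < L"
    then obtain s where s: "s \<ge> T" "y < f s"
      unfolding L_def using less_cSup_iff[OF _ True, of y] by auto
    have "\<forall>\<^sub>F t in at_top. t \<ge> s" by (rule eventually_ge_at_top)
    thus "\<forall>\<^sub>F t in at_top. y < f t"
    proof eventually_elim
      case (elim t)
      with s mono[of s t] show ?case by simp
    qed
  next
    fix y assume y: "L < y"
    have "\<forall>\<^sub>F t in at_top. t \<ge> T" by (rule eventually_ge_at_top)
    thus "\<forall>\<^sub>F t in at_top. f t < y"
    proof eventually_elim
      case (elim t)
      hence "f t \<le> L" unfolding L_def by (intro cSup_upper True) auto
      with y show ?case by simp
    qed
  qed
  thus ?thesis by blast
next
  case False
  have "filterlim f at_top at_top"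
    unfolding filterlim_at_top
  proof
    fix Z
    obtain s where s: "s \<ge> T" "f s \<ge> Z"
      using False unfolding bdd_above_def by (auto simp: not_le intro: less_imp_le)
    have "\<forall>\<^sub>F t in at_top. t \<ge> s" by (rule eventually_ge_at_top)
    thus "\<forall>\<^sub>F t in at_top. Z \<le> f t"
    proof eventually_elim
      case (elim t)
      with s mono[of s t] show ?case by simp
    qed
  qed
  thus ?thesis by blast
qed

definition eventual_deriv :: "(real \<Rightarrow> real) \<Rightarrow> (real \<Rightarrow> real) \<Rightarrow> bool" where
  "eventual_deriv f g \<longleftrightarrow> (\<forall>\<^sub>F t in at_top. (f has_real_derivative g t) (at t))"

text \<open>L'Hopital's rule in the form that asks only the denominator to tend to infinity, so that
  an asymptotic of \<open>f'\<close> can be integrated with no prior knowledge of the behaviour of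
  \<open>f\<close>.\<close>

lemma tendsto_div_power_of_deriv:
  assumes d: "eventual_deriv f f'" and lim: "((\<lambda>t. f' t / t ^ k) \<longlongrightarrow> L) at_top"
  shows "((\<lambda>t. f t / t ^ Suc k) \<longlongrightarrow> L / real (Suc k)) at_top"
proof (rule lhospital_at_top_at_top)
  show "LIM x at_top. (x::real) ^ Suc k :> at_top"
    by (intro filterlim_pow_at_top filterlim_ident) simp
  show "\<forall>\<^sub>F x in at_top. real (Suc k) * x ^ k \<noteq> 0"
    using eventually_gt_at_top[of "0::real"] by eventually_elim simp
  show "\<forall>\<^sub>F x in at_top. (f has_real_derivative f' x) (at x)"
    using d by (simp add: eventual_deriv_def)
  show "\<forall>\<^sub>F x::real in at_top. ((\<lambda>x. x ^ Suc k) has_real_derivative real (Suc k) * x ^ k) (at x)"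
    using DERIV_pow[of "Suc k"] by simp
  have "((\<lambda>t. f' t / t ^ k / real (Suc k)) \<longlongrightarrow> L / real (Suc k)) at_top"
    by (intro tendsto_divide lim tendsto_const) simp
  thus "((\<lambda>x. f' x / (real (Suc k) * x ^ k)) \<longlongrightarrow> L / real (Suc k)) at_top"
    by (simp add: mult.commute del: of_nat_Suc)
qed

lemma tendsto_div_ln_of_deriv:
  assumes d: "eventual_deriv f f'" and lim: "((\<lambda>t. t * f' t) \<longlongrightarrow> L) at_top"
  shows "((\<lambda>t. f t / ln t) \<longlongrightarrow> L) at_top"
proof (rule lhospital_at_top_at_top)
  show "LIM x at_top. ln (x::real) :> at_top" by (rule ln_at_top)
  show "\<forall>\<^sub>F x in at_top. 1 / (x::real) \<noteq> 0"
    using eventually_gt_at_top[of "0::real"] by eventually_elim simp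
  show "\<forall>\<^sub>F x in at_top. (f has_real_derivative f' x) (at x)"
    using d by (simp add: eventual_deriv_def)
  show "\<forall>\<^sub>F x::real in at_top. (ln has_real_derivative 1 / x) (at x)"
    using eventually_gt_at_top[of "0::real"] by eventually_elim (rule DERIV_ln_divide)
  show "((\<lambda>x. f' x / (1 / x)) \<longlongrightarrow> L) at_top"
    using lim by (simp add: mult.commute)
qed

text \<open>The derivative of \<open>t ^ Suc k * ln t\<close> is \<open>t ^ k * ln t\<close> times
  \<open>Suc k + 1 / ln t\<close>, and the correction vanishes at infinity.\<close>

lemma tendsto_div_power_ln_of_deriv:
  assumes d: "eventual_deriv f f'" and lim: "((\<lambda>t. f' t / (t ^ k * ln t)) \<longlongrightarrow> L) at_top"
  shows "((\<lambda>t. f t / (t ^ Suc k * ln t)) \<longlongrightarrow> L / real (Suc k)) at_top"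
proof (rule lhospital_at_top_at_top)
  let ?g' = "\<lambda>x::real. real (Suc k) * x ^ k * ln x + x ^ k"
  have pos: "\<forall>\<^sub>F x in at_top. ?g' x \<noteq> 0 \<and> x > 1 \<and> ln x \<noteq> 0"
    using eventually_gt_at_top[of "1::real"]
  proof eventually_elim
    case (elim x)
    have "0 < real (Suc k) * x ^ k * ln x" using elim by (simp del: of_nat_Suc)
    hence "0 < ?g' x" using elim by (intro add_pos_pos) auto
    thus ?case using elim by simp
  qed
  show "LIM x at_top. (x::real) ^ Suc k * ln x :> at_top"
    by (intro filterlim_at_top_mult_at_top filterlim_pow_at_top filterlim_ident ln_at_top) simp
  show "\<forall>\<^sub>F x in at_top. ?g' x \<noteq> 0" using pos by eventually_elim simp
  show "\<forall>\<^sub>F x in at_top. (f has_real_derivative f' x) (at x)"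
    using d by (simp add: eventual_deriv_def)
  show "\<forall>\<^sub>F x in at_top. ((\<lambda>x. x ^ Suc k * ln x) has_real_derivative ?g' x) (at x)"
    using pos
  proof eventually_elim
    case (elim x)
    have "((\<lambda>x. x ^ Suc k * ln x) has_real_derivative (real (Suc k) * x ^ k) * ln x + 1 / x * x ^ Suc k) (at x)"
      by (rule DERIV_mult) (use elim DERIV_pow[of "Suc k" x] DERIV_ln_divide[of x] in auto)
    thus ?case using elim by simp
  qed
  have inv: "((\<lambda>x::real. 1 / ln x) \<longlongrightarrow> 0) at_top"
    using tendsto_inverse_0_at_top[OF ln_at_top] by (simp add: inverse_eq_divide)
  have "((\<lambda>x. (f' x / (x ^ k * ln x)) / (real (Suc k) + 1 / ln x)) \<longlongrightarrow> L / (real (Suc k) + 0)) at_top"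
    by (intro tendsto_divide tendsto_add lim inv tendsto_const) simp
  moreover have "\<forall>\<^sub>F x in at_top. (f' x / (x ^ k * ln x)) / (real (Suc k) + 1 / ln x) = f' x / ?g' x"
    using pos
  proof eventually_elim
    case (elim x)
    hence "?g' x = (x ^ k * ln x) * (real (Suc k) + 1 / ln x)"
      by (simp add: field_simps)
    thus ?case by simp
  qed
  ultimately have "((\<lambda>x. f' x / ?g' x) \<longlongrightarrow> L / (real (Suc k) + 0)) at_top"
    by (rule Lim_transform_eventually)
  thus "((\<lambda>x. f' x / ?g' x) \<longlongrightarrow> L / real (Suc k)) at_top" by simp
qed

text \<open>Integration gives the constant \<open>c / Suc k\<close> up to the value at the starting
  point; half of the constant is given up to absorb that value. The factor \<open>\<sigma>\<close>,
  later 1 or -1, treats both signs at once.\<close>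

lemma power_lower_bound_of_deriv:
  assumes d: "eventual_deriv f f'" and lb: "\<forall>\<^sub>F t in at_top. \<sigma> * f' t \<ge> c * t ^ k" and c: "c > 0"
  shows "\<forall>\<^sub>F t in at_top. \<sigma> * f t \<ge> c / (2 * real (Suc k)) * t ^ Suc k"
proof -
  obtain T where T: "\<And>t. t \<ge> T \<Longrightarrow> (f has_real_derivative f' t) (at t) \<and> \<sigma> * f' t \<ge> c * t ^ k"
    using eventually_conj[OF d[unfolded eventual_deriv_def] lb] unfolding eventually_at_top_linorder by blast
  define p where "p t = \<sigma> * f t - c / real (Suc k) * t ^ Suc k" for t
  have p: "p T \<le> p t" if "t \<ge> T" for t
  proof (rule DERIV_nonneg_imp_nondecreasing[OF that])
    fix x assume x: "T \<le> x" "x \<le> t"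
    have "(p has_real_derivative \<sigma> * f' x - c / real (Suc k) * (real (Suc k) * x ^ k)) (at x)"
      unfolding p_def using T[OF x(1)] DERIV_pow[of "Suc k" x] by (intro DERIV_diff DERIV_cmult) auto
    moreover have "\<sigma> * f' x - c / real (Suc k) * (real (Suc k) * x ^ k) \<ge> 0"
      using T[OF x(1)] by simp
    ultimately show "\<exists>y. (p has_real_derivative y) (at x) \<and> y \<ge> 0" by blast
  qed
  define c' where "c' = c / (2 * real (Suc k))"
  have c': "c' > 0" using c by (simp add: c'_def)
  have "LIM t at_top. c' * (t::real) ^ Suc k :> at_top"
    by (intro filterlim_tendsto_pos_mult_at_top[OF tendsto_const c'] filterlim_pow_at_top filterlim_ident) simp
  hence "\<forall>\<^sub>F t in at_top. c' * t ^ Suc k \<ge> - p T" by (simp add: filterlim_at_top)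
  moreover have "\<forall>\<^sub>F t in at_top. t \<ge> T" by (rule eventually_ge_at_top)
  ultimately have "\<forall>\<^sub>F t in at_top. \<sigma> * f t \<ge> c' * t ^ Suc k"
  proof eventually_elim
    case (elim t)
    have "c / real (Suc k) = 2 * c'" unfolding c'_def by (simp add: field_simps)
    hence "p t = \<sigma> * f t - 2 * (c' * t ^ Suc k)" unfolding p_def by simp
    with p[OF elim(2)] elim(1) show ?case by linarith
  qed
  thus ?thesis by (simp add: c'_def)
qed

text \<open>By the mean value theorem the difference is \<open>h * g \<xi>\<close> with \<xi>
  between \<open>t\<close> and \<open>t + h\<close>, and \<open>\<xi> / t\<close> tends to 1. This
  is the source of the gain \<open>1 / h\<close> in van der Corput's inequality.\<close>

lemma difference_limits:
  assumes d: "eventual_deriv p g" and nz: "\<forall>\<^sub>F t in at_top. g t \<noteq> 0" and g0: "(g \<longlongrightarrow> 0) at_top"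
    and lim: "((\<lambda>t. 1 / (t * g t)) \<longlongrightarrow> \<Lambda>) at_top" and h: "h > 0"
  shows "\<forall>\<^sub>F t in at_top. p (t + h) - p t \<noteq> 0"
    and "((\<lambda>t. p (t + h) - p t) \<longlongrightarrow> 0) at_top"
    and "((\<lambda>t. 1 / (t * (p (t + h) - p t))) \<longlongrightarrow> \<Lambda> / h) at_top"
proof -
  obtain T0 where T0: "\<And>t. t \<ge> T0 \<Longrightarrow> (p has_real_derivative g t) (at t) \<and> g t \<noteq> 0"
    using eventually_conj[OF d[unfolded eventual_deriv_def] nz] unfolding eventually_at_top_linorder by blast
  define T where "T = max T0 1"
  have T: "(p has_real_derivative g t) (at t)" "g t \<noteq> 0" "t \<ge> 1" if "t \<ge> T" for t
    using T0[of t] that by (auto simp: T_def)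
  have "\<exists>\<xi>. t < \<xi> \<and> \<xi> < t + h \<and> p (t + h) - p t = h * g \<xi>" if "t \<ge> T" for t
  proof -
    have "\<exists>z>t. z < t + h \<and> p (t + h) - p t = (t + h - t) * g z"
      by (rule MVT2) (use h that T in auto)
    thus ?thesis by auto
  qed
  then obtain \<xi> where \<xi>: "\<And>t. t \<ge> T \<Longrightarrow> t < \<xi> t \<and> \<xi> t < t + h \<and> p (t + h) - p t = h * g (\<xi> t)"
    by metis
  have evT: "\<forall>\<^sub>F t in at_top. t \<ge> T" by (rule eventually_ge_at_top)
  have \<xi>top: "filterlim \<xi> at_top at_top"
  proof (rule filterlim_at_top_mono[OF filterlim_ident])
    show "\<forall>\<^sub>F t in at_top. t \<le> \<xi> t" using evT by eventually_elim (simp add: \<xi> less_imp_le)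
  qed
  show "\<forall>\<^sub>F t in at_top. p (t + h) - p t \<noteq> 0"
    using evT
  proof eventually_elim
    case (elim t)
    with \<xi>[OF elim] T(2)[of "\<xi> t"] h show ?case by simp
  qed
  have "((\<lambda>t. h * g (\<xi> t)) \<longlongrightarrow> h * 0) at_top"
    by (intro tendsto_mult tendsto_const filterlim_compose[OF g0 \<xi>top])
  moreover have "\<forall>\<^sub>F t in at_top. h * g (\<xi> t) = p (t + h) - p t"
    using evT by eventually_elim (use \<xi> in simp)
  ultimately have "((\<lambda>t. p (t + h) - p t) \<longlongrightarrow> h * 0) at_top"
    by (rule Lim_transform_eventually)
  thus "((\<lambda>t. p (t + h) - p t) \<longlongrightarrow> 0) at_top" by simp
  have "((\<lambda>t. \<xi> t / t) \<longlongrightarrow> 1) at_top"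
  proof (rule tendsto_sandwich)
    show "\<forall>\<^sub>F t in at_top. 1 \<le> \<xi> t / t"
      using evT
    proof eventually_elim
      case (elim t)
      with \<xi>[OF elim] T(3)[OF elim] show ?case by (simp add: le_divide_eq)
    qed
    show "\<forall>\<^sub>F t in at_top. \<xi> t / t \<le> 1 + h / t"
      using evT
    proof eventually_elim
      case (elim t)
      hence "\<xi> t / t \<le> (t + h) / t"
        using \<xi>[OF elim] T(3)[OF elim] by (intro divide_right_mono) auto
      with T(3)[OF elim] show ?case by (simp add: add_divide_distrib)
    qed
    have "((\<lambda>t. 1 + h / t) \<longlongrightarrow> 1 + 0) at_top"
      by (intro tendsto_add tendsto_const tendsto_divide_0[OF tendsto_const] filterlim_at_top_imp_at_infinity filterlim_ident)
    thus "((\<lambda>t. 1 + h / t) \<longlongrightarrow> 1) at_top" by simp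
  qed simp
  hence "((\<lambda>t. (\<xi> t / t) * (1 / (\<xi> t * g (\<xi> t))) / h) \<longlongrightarrow> 1 * \<Lambda> / h) at_top"
    by (intro tendsto_divide tendsto_mult tendsto_const filterlim_compose[OF lim \<xi>top]) (use h in auto)
  moreover have "\<forall>\<^sub>F t in at_top. (\<xi> t / t) * (1 / (\<xi> t * g (\<xi> t))) / h = 1 / (t * (p (t + h) - p t))"
    using evT
  proof eventually_elim
    case (elim t)
    have "\<xi> t \<noteq> 0" using \<xi>[OF elim] T(3)[OF elim] by simp
    thus ?case using \<xi>[OF elim] by (simp add: mult.commute)
  qed
  ultimately have "((\<lambda>t. 1 / (t * (p (t + h) - p t))) \<longlongrightarrow> 1 * \<Lambda> / h) at_top"
    by (rule Lim_transform_eventually)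
  thus "((\<lambda>t. 1 / (t * (p (t + h) - p t))) \<longlongrightarrow> \<Lambda> / h) at_top" by simp
qed

subsection \<open>Hardy fields\<close>

locale hardy =
  fixes H :: "(real \<Rightarrow> real) set"
  assumes hardy_field: "hardy_field H" and translation_invariant: "translation_invariant H"
begin

lemma diff_mem: "f \<in> H \<Longrightarrow> g \<in> H \<Longrightarrow> (\<lambda>t. f t - g t) \<in> H"
  and inverse_mem: "f \<in> H \<Longrightarrow> \<not> (\<forall>\<^sub>F t in at_top. f t = 0) \<Longrightarrow> \<exists>g\<in>H. \<forall>\<^sub>F t in at_top. f t * g t = 1"
  and deriv_mem: "f \<in> H \<Longrightarrow> \<exists>g\<in>H. eventual_deriv f g"
  using hardy_field unfolding hardy_field_def eventual_deriv_def by blast+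

lemma shift_mem: "f \<in> H \<Longrightarrow> (\<lambda>t. f (t + h)) \<in> H"
  using translation_invariant unfolding translation_invariant_def by blast

lemma difference_mem: "f \<in> H \<Longrightarrow> (\<lambda>t. f (t + h) - f t) \<in> H"
  by (intro diff_mem shift_mem)

text \<open>Invertibility of nonzero germs is what excludes oscillation: a function with an inverse
  germ has no zeros far out.\<close>

lemma eventually_nonzero:
  assumes "f \<in> H" "\<not> (\<forall>\<^sub>F t in at_top. f t = 0)"
  shows "\<forall>\<^sub>F t in at_top. f t \<noteq> 0"
proof -
  obtain g where "\<forall>\<^sub>F t in at_top. f t * g t = 1" using inverse_mem[OF assms] by blast
  thus ?thesis by eventually_elim auto
qed

text \<open>A nonzero element has no large zeros and, being eventually differentiable, is eventually
  continuous, so the intermediate value theorem fixes its sign.\<close>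

lemma eventual_sign:
  assumes f: "f \<in> H"
  shows "(\<forall>\<^sub>F t in at_top. f t \<ge> 0) \<or> (\<forall>\<^sub>F t in at_top. f t \<le> 0)"
proof (cases "\<forall>\<^sub>F t in at_top. f t = 0")
  case True
  hence "\<forall>\<^sub>F t in at_top. f t \<ge> 0" by eventually_elim simp
  thus ?thesis ..
next
  case False
  obtain f' where "eventual_deriv f f'" using deriv_mem[OF f] by blast
  from eventually_conj[OF eventually_nonzero[OF f False] this[unfolded eventual_deriv_def]]
  obtain T where T: "\<And>t. t \<ge> T \<Longrightarrow> f t \<noteq> 0 \<and> (f has_real_derivative f' t) (at t)"
    unfolding eventually_at_top_linorder by blast
  have cont: "continuous_on {T..t} f" for t
    by (intro continuous_at_imp_continuous_on ballI DERIV_isCont[of f]) (use T in force)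
  have ge: "\<forall>\<^sub>F t in at_top. t \<ge> T" by (rule eventually_ge_at_top)
  show ?thesis
  proof (cases "f T > 0")
    case True
    have "f t \<ge> 0" if "t \<ge> T" for t
    proof (rule ccontr)
      assume "\<not> f t \<ge> 0"
      hence "\<exists>x. T \<le> x \<and> x \<le> t \<and> f x = 0"
        using IVT2'[of f t 0 T] True that cont by auto
      with T show False by blast
    qed
    hence "\<forall>\<^sub>F t in at_top. f t \<ge> 0" using ge by (rule eventually_mono[rotated])
    thus ?thesis ..
  next
    case F: False
    have "f t \<le> 0" if "t \<ge> T" for t
    proof (rule ccontr)
      assume "\<not> f t \<le> 0"
      hence "\<exists>x. T \<le> x \<and> x \<le> t \<and> f x = 0"
        using IVT'[of f T 0 t] F that cont by auto
      with T show False by blast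
    qed
    hence "\<forall>\<^sub>F t in at_top. f t \<le> 0" using ge by (rule eventually_mono[rotated])
    thus ?thesis ..
  qed
qed

lemma eventually_monotone:
  assumes f: "f \<in> H"
  shows "\<exists>T. (\<forall>s t. T \<le> s \<longrightarrow> s \<le> t \<longrightarrow> f s \<le> f t) \<or> (\<forall>s t. T \<le> s \<longrightarrow> s \<le> t \<longrightarrow> f t \<le> f s)"
proof -
  obtain f' where f': "f' \<in> H" "eventual_deriv f f'" using deriv_mem[OF f] by blast
  from eventual_sign[OF f'(1)] show ?thesis
  proof
    assume "\<forall>\<^sub>F t in at_top. f' t \<ge> 0"
    from eventually_conj[OF this f'(2)[unfolded eventual_deriv_def]]
    obtain T where T: "\<And>t. t \<ge> T \<Longrightarrow> f' t \<ge> 0 \<and> (f has_real_derivative f' t) (at t)"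
      unfolding eventually_at_top_linorder by blast
    have "f s \<le> f t" if "T \<le> s" "s \<le> t" for s t
      by (rule DERIV_nonneg_imp_nondecreasing[OF that(2)]) (meson T that(1) order_trans)
    thus ?thesis by blast
  next
    assume "\<forall>\<^sub>F t in at_top. f' t \<le> 0"
    from eventually_conj[OF this f'(2)[unfolded eventual_deriv_def]]
    obtain T where T: "\<And>t. t \<ge> T \<Longrightarrow> f' t \<le> 0 \<and> (f has_real_derivative f' t) (at t)"
      unfolding eventually_at_top_linorder by blast
    have "f t \<le> f s" if "T \<le> s" "s \<le> t" for s t
      by (rule DERIV_nonpos_imp_nonincreasing[OF that(2)]) (meson T that(1) order_trans)
    thus ?thesis by blast
  qed
qed

lemma limit_exists:
  assumes "f \<in> H"
  obtains L where "(f \<longlongrightarrow> L) at_top" | "filterlim f at_top at_top" | "filterlim (\<lambda>t. - f t) at_top at_top"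
proof -
  obtain T where "(\<forall>s t. T \<le> s \<longrightarrow> s \<le> t \<longrightarrow> f s \<le> f t) \<or> (\<forall>s t. T \<le> s \<longrightarrow> s \<le> t \<longrightarrow> f t \<le> f s)"
    using eventually_monotone[OF assms] by blast
  thus ?thesis
  proof
    assume "\<forall>s t. T \<le> s \<longrightarrow> s \<le> t \<longrightarrow> f s \<le> f t"
    with monotone_limit_at_top[of T f] that show ?thesis by blast
  next
    assume "\<forall>s t. T \<le> s \<longrightarrow> s \<le> t \<longrightarrow> f t \<le> f s"
    hence "(\<exists>L. ((\<lambda>t. - f t) \<longlongrightarrow> L) at_top) \<or> filterlim (\<lambda>t. - f t) at_top at_top"
      by (intro monotone_limit_at_top[of T]) auto
    with that show ?thesis using tendsto_minus_cancel_left by blast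
  qed
qed

text \<open>A relation, because a derivative is determined only up to eventual equality. The
  intermediate derivatives are kept in \<open>H\<close>, so that the closure properties apply to
  each of them.\<close>

fun nth_deriv :: "nat \<Rightarrow> (real \<Rightarrow> real) \<Rightarrow> (real \<Rightarrow> real) \<Rightarrow> bool" where
  "nth_deriv 0 f g \<longleftrightarrow> f = g"
| "nth_deriv (Suc n) f g \<longleftrightarrow> (\<exists>f'\<in>H. eventual_deriv f f' \<and> nth_deriv n f' g)"

lemma nth_deriv_exists: "f \<in> H \<Longrightarrow> \<exists>g\<in>H. nth_deriv n f g"
proof (induction n arbitrary: f)
  case (Suc n)
  obtain f' where f': "f' \<in> H" "eventual_deriv f f'" using deriv_mem[OF Suc.prems] by blast
  with Suc.IH[OF f'(1)] show ?case by auto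
qed simp

text \<open>\<open>nth_deriv\<close> unfolds from the first derivative; replacing a derivative by a
  difference needs the last step instead, from \<open>p\<close> to \<open>g\<close>.\<close>

lemma nth_deriv_Suc_last:
  "f \<in> H \<Longrightarrow> nth_deriv (Suc n) f g \<Longrightarrow> \<exists>p\<in>H. nth_deriv n f p \<and> eventual_deriv p g"
proof (induction n arbitrary: f)
  case (Suc n)
  then obtain f' where f': "f' \<in> H" "eventual_deriv f f'" "nth_deriv (Suc n) f' g" by auto
  from Suc.IH[OF f'(1,3)] f' show ?case by auto
qed auto

lemma nth_deriv_difference:
  "nth_deriv n f g \<Longrightarrow> nth_deriv n (\<lambda>t. f (t + h) - f t) (\<lambda>t. g (t + h) - g t)"
proof (induction n arbitrary: f)
  case (Suc n)
  then obtain f' where f': "f' \<in> H" "eventual_deriv f f'" "nth_deriv n f' g" by auto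
  have "LIM t at_top. t + h :> at_top"
    using filterlim_tendsto_add_at_top[OF tendsto_const[of h] filterlim_ident] by (simp add: add.commute)
  from eventually_compose_filterlim[OF f'(2)[unfolded eventual_deriv_def] this] f'(2)[unfolded eventual_deriv_def]
  have "eventual_deriv (\<lambda>t. f (t + h) - f t) (\<lambda>t. f' (t + h) - f' t)"
    unfolding eventual_deriv_def
    by eventually_elim (auto simp: DERIV_shift intro!: DERIV_diff)
  with Suc.IH[OF f'(3)] difference_mem[OF f'(1)] show ?case by auto
qed simp

lemma nth_deriv_tendsto: "nth_deriv n f g \<Longrightarrow> (g \<longlongrightarrow> L) at_top \<Longrightarrow> ((\<lambda>t. f t / t ^ n) \<longlongrightarrow> L / fact n) at_top"
proof (induction n arbitrary: f)
  case (Suc n)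
  then obtain f' where f': "f' \<in> H" "eventual_deriv f f'" "nth_deriv n f' g" by auto
  from tendsto_div_power_of_deriv[OF f'(2) Suc.IH[OF f'(3) Suc.prems(2)]]
  show ?case by (simp add: mult.commute)
qed simp

lemma nth_deriv_lower_bound:
  "nth_deriv n f g \<Longrightarrow> \<forall>\<^sub>F t in at_top. \<sigma> * g t \<ge> c \<Longrightarrow> c > 0 \<Longrightarrow> \<exists>c'>0. \<forall>\<^sub>F t in at_top. \<sigma> * f t \<ge> c' * t ^ n"
proof (induction n arbitrary: f)
  case (Suc n)
  then obtain f' where f': "f' \<in> H" "eventual_deriv f f'" "nth_deriv n f' g" by auto
  obtain c' where c': "c' > 0" "\<forall>\<^sub>F t in at_top. \<sigma> * f' t \<ge> c' * t ^ n"
    using Suc.IH[OF f'(3) Suc.prems(2,3)] by blast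
  have "c' / (2 * real (Suc n)) > 0" using c'(1) by simp
  with power_lower_bound_of_deriv[OF f'(2) c'(2,1)] show ?case by blast
qed auto

text \<open>The innermost integration turns \<open>1 / t\<close> into \<open>ln t\<close>; each
  further one raises the power of \<open>t\<close>, and the factors \<open>1 / Suc k\<close> build
  up the factorial.\<close>

lemma nth_deriv_tendsto_ln:
  "nth_deriv (Suc n) f g \<Longrightarrow> ((\<lambda>t. t * g t) \<longlongrightarrow> L) at_top \<Longrightarrow> ((\<lambda>t. f t / (t ^ n * ln t)) \<longlongrightarrow> L / fact n) at_top"
proof (induction n arbitrary: f)
  case 0
  thus ?case using tendsto_div_ln_of_deriv[of f g L] by auto
next
  case (Suc n)
  then obtain f' where f': "f' \<in> H" "eventual_deriv f f'" "nth_deriv (Suc n) f' g" by auto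
  from tendsto_div_power_ln_of_deriv[OF f'(2) Suc.IH[OF f'(3) Suc.prems(2)]]
  show ?case by (simp add: mult.commute mult.left_commute)
qed

text \<open>
  In terms of the derivative \<open>g\<close> of order \<open>d + 1\<close>, growth like \<open>t ^ d * ln t\<close> means that \<open>1 / (t * g t)\<close>
  has a limit \<open>\<Lambda> \<noteq> 0\<close>, and faster growth means \<open>\<Lambda> = 0\<close>.
\<close>

definition tempered :: "nat \<Rightarrow> (real \<Rightarrow> real) \<Rightarrow> real \<Rightarrow> bool" where
  "tempered d a \<Lambda> \<longleftrightarrow> a \<in> H \<and> (\<exists>g\<in>H. nth_deriv (Suc d) a g \<and> (\<forall>\<^sub>F t in at_top. g t \<noteq> 0) \<and>
     (g \<longlongrightarrow> 0) at_top \<and> ((\<lambda>t. 1 / (t * g t)) \<longlongrightarrow> \<Lambda>) at_top)"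

text \<open>One difference replaces one derivative: with \<open>p\<close> of one order less than
  \<open>g\<close>, the function \<open>p (t + h) - p t\<close> takes over the role of
  \<open>g\<close>.\<close>

lemma tempered_difference:
  assumes "tempered (Suc d) a \<Lambda>" and h: "h > 0"
  shows "tempered d (\<lambda>t. a (t + h) - a t) (\<Lambda> / h)"
proof -
  from assms obtain g where a: "a \<in> H" and g: "nth_deriv (Suc (Suc d)) a g" "\<forall>\<^sub>F t in at_top. g t \<noteq> 0"
     "(g \<longlongrightarrow> 0) at_top" "((\<lambda>t. 1 / (t * g t)) \<longlongrightarrow> \<Lambda>) at_top" unfolding tempered_def by blast
  obtain p where p: "p \<in> H" "nth_deriv (Suc d) a p" "eventual_deriv p g"
    using nth_deriv_Suc_last[OF a g(1)] by blast
  show ?thesis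
    unfolding tempered_def
    by (intro conjI difference_mem[OF a] bexI[of _ "\<lambda>t. p (t + h) - p t"] nth_deriv_difference p
        difference_limits[OF p(3) g(2-4) h] difference_mem)
qed

text \<open>
  Neither \<open>t\<close> nor \<open>ln t\<close> need belong to \<open>H\<close>, so that \<open>t * g t\<close> is not known to have a limit a priori. It has
  one because the derivative of \<open>1 / g\<close>, an element of \<open>H\<close>, has a limit, which by L'Hopital's rule is also
  the limit of \<open>1 / (t * g t)\<close>.
\<close>

lemma tempered_of_growth:
  assumes a: "a \<in> H" and upper: "((\<lambda>t. a t / t ^ Suc d) \<longlongrightarrow> 0) at_top"
    and lower: "\<not> ((\<lambda>t. a t / (t ^ d * ln t)) \<longlongrightarrow> 0) at_top"
  obtains \<Lambda> where "tempered d a \<Lambda>" "\<Lambda> \<noteq> 0 \<Longrightarrow> ((\<lambda>t. a t / (t ^ d * ln t)) \<longlongrightarrow> 1 / \<Lambda> / fact d) at_top"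
proof -
  obtain g where g: "g \<in> H" "nth_deriv (Suc d) a g" using nth_deriv_exists[OF a] by blast
  \<comment> \<open>If \<open>g\<close> or \<open>- g\<close> tended to infinity, integrating
    \<open>d + 1\<close> times would make \<open>a\<close> at least of the size of
    \<open>t ^ Suc d\<close>, against \<open>upper\<close>.\<close>
  have no_lower: False if "\<sigma> = 1 \<or> \<sigma> = -1" "filterlim (\<lambda>t. \<sigma> * g t) at_top at_top" for \<sigma>
  proof -
    have "\<forall>\<^sub>F t in at_top. \<sigma> * g t \<ge> 1" using that(2) by (simp add: filterlim_at_top)
    then obtain c where c: "c > 0" "\<forall>\<^sub>F t in at_top. \<sigma> * a t \<ge> c * t ^ Suc d"
      using nth_deriv_lower_bound[OF g(2), of 1 \<sigma>] by auto
    have "\<forall>\<^sub>F t in at_top. c \<le> \<bar>a t / t ^ Suc d\<bar>"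
      using c(2) eventually_gt_at_top[of "0::real"]
    proof eventually_elim
      case (elim t)
      have "c * t ^ Suc d \<le> \<bar>a t\<bar>" using elim(1) that(1) by auto
      thus ?case using elim(2) by (simp add: abs_divide pos_le_divide_eq)
    qed
    hence "c \<le> 0" by (rule tendsto_lowerbound[OF tendsto_rabs_zero[OF upper]]) simp
    with c(1) show False by simp
  qed
  have g0: "(g \<longlongrightarrow> 0) at_top"
  proof (rule limit_exists[OF g(1)])
    fix L assume L: "(g \<longlongrightarrow> L) at_top"
    from tendsto_unique[OF _ nth_deriv_tendsto[OF g(2) L] upper] have "L = 0" by simp
    with L show ?thesis by simp
  qed (use no_lower[of 1] no_lower[of "-1"] in auto)
  \<comment> \<open>The lower growth bound enters here: if \<open>t * g t\<close> tended to 0, then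
    \<open>a\<close> would be negligible against \<open>t ^ d * ln t\<close>.\<close>
  have not0: "\<not> ((\<lambda>t. t * g t) \<longlongrightarrow> 0) at_top"
    using nth_deriv_tendsto_ln[OF g(2), of 0] lower by auto
  have nonzero: "\<not> (\<forall>\<^sub>F t in at_top. g t = 0)"
  proof
    assume "\<forall>\<^sub>F t in at_top. g t = 0"
    hence "\<forall>\<^sub>F t in at_top. 0 = t * g t" by eventually_elim simp
    from Lim_transform_eventually[OF tendsto_const this] not0 show False by simp
  qed
  obtain q where q: "q \<in> H" "\<forall>\<^sub>F t in at_top. g t * q t = 1" using inverse_mem[OF g(1) nonzero] by blast
  obtain r where r: "r \<in> H" "eventual_deriv q r" using deriv_mem[OF q(1)] by blast
  \<comment> \<open>If the derivative \<open>r\<close> of \<open>q = 1 / g\<close> were unbounded in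
    this way, \<open>q\<close> would outgrow every multiple of \<open>t\<close>, and
    \<open>t * g t\<close> would tend to 0.\<close>
  have no_inf: False if "\<sigma> = 1 \<or> \<sigma> = -1" "filterlim (\<lambda>t. \<sigma> * r t) at_top at_top" for \<sigma>
  proof -
    have "((\<lambda>t. t * g t) \<longlongrightarrow> 0) at_top"
    proof (rule tendstoI)
      fix e :: real assume e: "e > 0"
      \<comment> \<open>Integration halves the constant to \<open>2 / e\<close>, which leaves
        \<open>\<bar>t * g t\<bar> \<le> e / 2\<close>, strictly below \<open>e\<close>.\<close>
      have "\<forall>\<^sub>F t in at_top. \<sigma> * r t \<ge> 4 / e * t ^ 0" using that(2) by (simp add: filterlim_at_top)
      from power_lower_bound_of_deriv[OF r(2) this] e
      have "\<forall>\<^sub>F t in at_top. \<sigma> * q t \<ge> 2 / e * t" by simp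
      with q(2) eventually_gt_at_top[of "0::real"]
      show "\<forall>\<^sub>F t in at_top. dist (t * g t) 0 < e"
      proof eventually_elim
        case (elim t)
        have "2 / e * t \<le> \<bar>q t\<bar>" using elim(3) that(1) by auto
        hence "2 * t \<le> e * \<bar>q t\<bar>" using e by (simp add: field_simps)
        hence "2 * t * \<bar>g t\<bar> \<le> e * \<bar>q t\<bar> * \<bar>g t\<bar>" by (rule mult_right_mono) simp
        also have "\<dots> = e" using elim(1) by (simp add: mult.assoc abs_mult[symmetric] mult.commute)
        finally have "2 * \<bar>t * g t\<bar> \<le> e" using elim(2) by (simp add: abs_mult)
        thus ?case using e by simp
      qed
    qed
    with not0 show False by blast
  qed
  show ?thesis
  proof (rule limit_exists[OF r(1)])
    fix \<Lambda> assume L: "(r \<longlongrightarrow> \<Lambda>) at_top"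
    have "((\<lambda>t. q t / t) \<longlongrightarrow> \<Lambda>) at_top"
      using tendsto_div_power_of_deriv[OF r(2), of 0 \<Lambda>] L by simp
    moreover have "\<forall>\<^sub>F t in at_top. q t / t = 1 / (t * g t)"
      using q(2)
    proof eventually_elim
      case (elim t)
      hence "q t = 1 / g t" by (auto simp: eq_divide_eq mult.commute)
      thus ?case by simp
    qed
    ultimately have lim: "((\<lambda>t. 1 / (t * g t)) \<longlongrightarrow> \<Lambda>) at_top" by (rule Lim_transform_eventually)
    have "tempered d a \<Lambda>"
      unfolding tempered_def by (intro conjI bexI[of _ g] a g g0 lim eventually_nonzero[OF g(1) nonzero])
    moreover have "((\<lambda>t. a t / (t ^ d * ln t)) \<longlongrightarrow> 1 / \<Lambda> / fact d) at_top" if "\<Lambda> \<noteq> 0"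
    proof (rule nth_deriv_tendsto_ln[OF g(2)])
      from tendsto_divide[OF tendsto_const[of 1] lim that]
      show "((\<lambda>t. t * g t) \<longlongrightarrow> 1 / \<Lambda>) at_top" by simp
    qed
    ultimately show thesis by (rule that)
  qed (use no_inf[of 1] no_inf[of "-1"] in auto)
qed

text \<open>Partial summation needs the inverse phase increments to be monotone, and the Hardy field
  supplies this: by translation invariance \<open>a (t + 1) - a t\<close> lies in \<open>H\<close>,
  hence so does an inverse of it, which is eventually monotone.\<close>

lemma avg_weighted_ee_tempered_0:
  assumes a: "tempered 0 a \<Lambda>" and \<beta>: "\<beta> \<noteq> 0"
    and F: "F \<le> sequentially" and v: "\<And>n. \<bar>v n\<bar> \<le> 1" and c: "\<bar>c\<bar> \<le> 1" and sh: "short_averages F v c"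
    and \<epsilon>: "\<epsilon> > 0"
  shows "\<forall>\<^sub>F N in F. norm (avg (\<lambda>n. v n * ee (\<beta> * a (real n))) N) \<le> \<bar>\<Lambda> / \<beta>\<bar> + \<epsilon>"
proof -
  from a obtain g where aH: "a \<in> H" and g: "eventual_deriv a g" "\<forall>\<^sub>F t in at_top. g t \<noteq> 0"
     "(g \<longlongrightarrow> 0) at_top" "((\<lambda>t. 1 / (t * g t)) \<longlongrightarrow> \<Lambda>) at_top" unfolding tempered_def by auto
  define D where "D t = a (t + 1) - a t" for t
  note lims = difference_limits[OF g zero_less_one, folded D_def]
  have DH: "D \<in> H" unfolding D_def[abs_def] by (rule difference_mem[OF aH])
  have "\<not> (\<forall>\<^sub>F t in at_top. D t = 0)"
  proof
    assume "\<forall>\<^sub>F t in at_top. D t = 0"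
    with lims(1) have "\<forall>\<^sub>F t::real in at_top. False" by eventually_elim simp
    thus False by simp
  qed
  then obtain q where q: "q \<in> H" "\<forall>\<^sub>F t in at_top. D t * q t = 1" using inverse_mem[OF DH] by blast
  obtain T where T: "(\<forall>s t. T \<le> s \<longrightarrow> s \<le> t \<longrightarrow> q s \<le> q t) \<or> (\<forall>s t. T \<le> s \<longrightarrow> s \<le> t \<longrightarrow> q t \<le> q s)"
    using eventually_monotone[OF q(1)] by blast
  obtain T' where T': "\<And>t. t \<ge> T' \<Longrightarrow> D t * q t = 1"
    using q(2) unfolding eventually_at_top_linorder by blast
  \<comment> \<open>From \<open>m\<close> on, \<open>q\<close> is monotone and equals
    \<open>1 / D\<close>; the 1 keeps the starting index positive.\<close>
  define m where "m = nat \<lceil>max T (max T' 1)\<rceil>"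
  have m: "m \<ge> 1" "real m \<ge> T" "real m \<ge> T'" unfolding m_def by linarith+
  have Dq: "D (real n) \<noteq> 0" "1 / D (real n) = q (real n)" if "n \<ge> m" for n
  proof -
    have "D (real n) * q (real n) = 1" using that m by (intro T') linarith
    thus "D (real n) \<noteq> 0" "1 / D (real n) = q (real n)" by (auto simp: divide_eq_eq mult.commute)
  qed
  define \<alpha> where "\<alpha> n = \<beta> * a (real n)" for n
  have \<theta>: "\<alpha> (Suc n) - \<alpha> n = \<beta> * D (real n)" for n
    by (simp add: \<alpha>_def D_def algebra_simps)
  have lim0: "(\<lambda>n. \<alpha> (Suc n) - \<alpha> n) \<longlonglongrightarrow> 0"
    unfolding \<theta> using tendsto_mult[OF tendsto_const[of \<beta>] filterlim_compose[OF lims(2) filterlim_real_sequentially]] by simp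
  have "(\<lambda>n. 1 / (real n * D (real n)) / \<beta>) \<longlonglongrightarrow> \<Lambda> / 1 / \<beta>"
    by (intro tendsto_divide tendsto_const filterlim_compose[OF lims(3) filterlim_real_sequentially]) (use \<beta> in auto)
  hence lim1: "(\<lambda>n. 1 / (real n * (\<alpha> (Suc n) - \<alpha> n))) \<longlonglongrightarrow> \<Lambda> / \<beta>"
    unfolding \<theta> by (simp add: mult_ac)
  have mono: "(\<forall>n\<ge>m. 1 / (\<alpha> (Suc n) - \<alpha> n) \<le> 1 / (\<alpha> (Suc (Suc n)) - \<alpha> (Suc n)))
     \<or> (\<forall>n\<ge>m. 1 / (\<alpha> (Suc (Suc n)) - \<alpha> (Suc n)) \<le> 1 / (\<alpha> (Suc n) - \<alpha> n))"
  proof -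
    have eq: "1 / (\<alpha> (Suc n) - \<alpha> n) = q (real n) / \<beta>" if "n \<ge> m" for n
    proof -
      have "1 / (\<alpha> (Suc n) - \<alpha> n) = 1 / D (real n) / \<beta>" unfolding \<theta> by (simp add: mult.commute)
      thus ?thesis by (simp only: Dq[OF that])
    qed
    have "(\<forall>n\<ge>m. q (real n) \<le> q (real (Suc n))) \<or> (\<forall>n\<ge>m. q (real (Suc n)) \<le> q (real n))"
      using T
    proof
      assume *: "\<forall>s t. T \<le> s \<longrightarrow> s \<le> t \<longrightarrow> q s \<le> q t"
      have "q (real n) \<le> q (real (Suc n))" if "n \<ge> m" for n
        using *[rule_format, of "real n" "real (Suc n)"] m that by simp
      thus ?thesis by blast
    next
      assume *: "\<forall>s t. T \<le> s \<longrightarrow> s \<le> t \<longrightarrow> q t \<le> q s"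
      have "q (real (Suc n)) \<le> q (real n)" if "n \<ge> m" for n
        using *[rule_format, of "real n" "real (Suc n)"] m that by simp
      thus ?thesis by blast
    qed
    hence "(\<forall>n\<ge>m. q (real n) / \<beta> \<le> q (real (Suc n)) / \<beta>) \<or> (\<forall>n\<ge>m. q (real (Suc n)) / \<beta> \<le> q (real n) / \<beta>)"
      using \<beta> by (cases "\<beta> > 0") (auto simp: divide_le_cancel)
    thus ?thesis by (simp add: eq)
  qed
  have "\<forall>\<^sub>F N in F. norm (avg (\<lambda>n. v n * ee (\<alpha> n)) N) \<le> 1 * \<bar>\<Lambda> / \<beta>\<bar> + \<epsilon>"
  proof (rule avg_weighted_ee_slowly_varying[OF F v c sh lim0 _ \<epsilon>])
    fix e :: real assume "e > 0"
    show "\<forall>\<^sub>F N in sequentially. norm (avg (\<lambda>n. ee (\<alpha> n)) N) \<le> \<bar>\<Lambda> / \<beta>\<bar> + e"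
      by (rule avg_ee_slowly_varying[OF m(1) lim0 _ mono lim1 \<open>e > 0\<close>]) (use \<theta> Dq(1) \<beta> in auto)
  qed
  thus ?thesis by (simp add: \<alpha>_def)
qed

text \<open>Stability of \<open>V\<close> under \<open>v (n + h) * v n\<close> lets the induction
  hypothesis act on the correlations. The induction carries the bound
  \<open>\<bar>\<Lambda> / \<beta>\<bar>\<close> instead of a limit, since for \<open>d = 0\<close>
  only the bound is available; one difference divides it by \<open>h\<close>, so at higher order the
  averages vanish for every \<Lambda>.\<close>

lemma
  fixes V :: "(nat \<Rightarrow> real) set"
  assumes F: "F \<le> sequentially" and \<beta>: "\<beta> \<noteq> 0"
    and V: "\<And>v n. v \<in> V \<Longrightarrow> \<bar>v n\<bar> \<le> 1"
    and V_short: "\<And>v. v \<in> V \<Longrightarrow> \<exists>c. \<bar>c\<bar> \<le> 1 \<and> short_averages F v c"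
    and V_corr: "\<And>v h. v \<in> V \<Longrightarrow> (\<lambda>n. v (n + h) * v n) \<in> V"
  shows avg_weighted_ee_tempered: "tempered d a \<Lambda> \<Longrightarrow> v \<in> V \<Longrightarrow> \<epsilon> > 0 \<Longrightarrow>
      \<forall>\<^sub>F N in F. norm (avg (\<lambda>n. v n * ee (\<beta> * a (real n))) N) \<le> \<bar>\<Lambda> / \<beta>\<bar> + \<epsilon>"
    and avg_weighted_ee_tempered_Suc: "tempered (Suc d) a \<Lambda> \<Longrightarrow> v \<in> V \<Longrightarrow>
      (avg (\<lambda>n. v n * ee (\<beta> * a (real n))) \<longlongrightarrow> 0) F"
proof -
  have step: "(avg (\<lambda>n. v n * ee (\<beta> * a (real n))) \<longlongrightarrow> 0) F"
    if IH: "\<And>a \<Lambda> v \<epsilon>. tempered d a \<Lambda> \<Longrightarrow> v \<in> V \<Longrightarrow> \<epsilon> > 0 \<Longrightarrow>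
       \<forall>\<^sub>F N in F. norm (avg (\<lambda>n. v n * ee (\<beta> * a (real n))) N) \<le> \<bar>\<Lambda> / \<beta>\<bar> + \<epsilon>"
    and a: "tempered (Suc d) a \<Lambda>" and v: "v \<in> V" for d a \<Lambda> v
  proof (rule van_der_Corput[OF F])
    show "norm (v n * ee (\<beta> * a (real n))) \<le> 1" for n using V[OF v] by (simp add: norm_mult)
  next
    fix \<epsilon> :: real assume \<epsilon>: "\<epsilon> > 0"
    \<comment> \<open>For \<open>h \<ge> D\<close> this gives
      \<open>\<bar>\<Lambda> / \<beta>\<bar> / h \<le> \<epsilon> / 2\<close>; the other half of
      \<epsilon> is the error allowed in the induction hypothesis.\<close>
    define D where "D = nat \<lceil>2 * \<bar>\<Lambda> / \<beta>\<bar> / \<epsilon>\<rceil> + 1"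
    have "\<forall>\<^sub>F N in F. norm (avg (\<lambda>n. v (n + h) * ee (\<beta> * a (real (n + h))) * cnj (v n * ee (\<beta> * a (real n)))) N) \<le> \<epsilon>"
      if h: "h \<ge> D" for h
    proof -
      have h0: "real h > 0" and hD: "2 * \<bar>\<Lambda> / \<beta>\<bar> / \<epsilon> \<le> real h" using h unfolding D_def by linarith+
      have ev: "\<forall>\<^sub>F N in F. norm (avg (\<lambda>n. (v (n + h) * v n) * ee (\<beta> * (a (real n + real h) - a (real n)))) N) \<le> \<bar>(\<Lambda> / real h) / \<beta>\<bar> + \<epsilon> / 2"
        using IH[OF tempered_difference[OF a h0] V_corr[OF v]] \<epsilon> by simp
      have eq: "(v (n + h) * v n) * ee (\<beta> * (a (real n + real h) - a (real n)))
          = v (n + h) * ee (\<beta> * a (real (n + h))) * cnj (v n * ee (\<beta> * a (real n)))" for n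
        by (simp add: ee_diff right_diff_distrib)
      have le: "\<bar>(\<Lambda> / real h) / \<beta>\<bar> + \<epsilon> / 2 \<le> \<epsilon>"
      proof -
        have "2 * \<bar>\<Lambda> / \<beta>\<bar> \<le> real h * \<epsilon>" using hD pos_divide_le_eq[OF \<epsilon>] by blast
        hence "\<bar>\<Lambda> / \<beta>\<bar> \<le> \<epsilon> / 2 * real h" by (simp add: mult.commute)
        hence "\<bar>\<Lambda> / \<beta>\<bar> / real h \<le> \<epsilon> / 2" using pos_divide_le_eq[OF h0] by blast
        moreover have "\<bar>(\<Lambda> / real h) / \<beta>\<bar> = \<bar>\<Lambda> / \<beta>\<bar> / real h" by (simp add: abs_mult mult.commute)
        ultimately show ?thesis by linarith
      qed
      from ev show ?thesis unfolding eq by eventually_elim (use le in linarith)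
    qed
    moreover have "D \<ge> 1" by (simp add: D_def)
    ultimately show "\<exists>D\<ge>1. \<forall>h\<ge>D. \<forall>\<^sub>F N in F. norm (avg (\<lambda>n. v (n + h) * ee (\<beta> * a (real (n + h))) * cnj (v n * ee (\<beta> * a (real n)))) N) \<le> \<epsilon>"
      by blast
  qed
  show bound: "\<forall>\<^sub>F N in F. norm (avg (\<lambda>n. v n * ee (\<beta> * a (real n))) N) \<le> \<bar>\<Lambda> / \<beta>\<bar> + \<epsilon>"
    if "tempered d a \<Lambda>" "v \<in> V" "\<epsilon> > 0" for d a \<Lambda> v \<epsilon>
    using that
  proof (induction d arbitrary: a \<Lambda> v \<epsilon>)
    case 0
    from V_short[OF 0(2)] obtain c where "\<bar>c\<bar> \<le> 1" "short_averages F v c" by blast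
    thus ?case by (intro avg_weighted_ee_tempered_0[OF 0(1) \<beta> F] V 0)
  next
    case (Suc d)
    have "\<forall>\<^sub>F N in F. dist (avg (\<lambda>n. v n * ee (\<beta> * a (real n))) N) 0 < \<epsilon>"
      by (rule tendstoD[OF step[OF Suc.IH Suc.prems(1,2)] Suc.prems(3)])
    thus ?case
    proof eventually_elim
      case (elim N)
      thus ?case using abs_ge_zero[of "\<Lambda> / \<beta>"] unfolding dist_0_norm dist_commute[of _ 0] by linarith
    qed
  qed
  show "(avg (\<lambda>n. v n * ee (\<beta> * a (real n))) \<longlongrightarrow> 0) F" if "tempered (Suc d) a \<Lambda>" "v \<in> V"
    by (rule step[OF bound that])
qed

end

subsection \<open>The ergodic theorem\<close>

definition birkhoff_sum :: "('a \<Rightarrow> 'a) \<Rightarrow> ('a \<Rightarrow> real) \<Rightarrow> nat \<Rightarrow> 'a \<Rightarrow> real" where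
  "birkhoff_sum T f n x = (\<Sum>k<n. f ((T ^^ k) x))"

lemma birkhoff_sum_Suc: "birkhoff_sum T f (Suc n) x = f x + birkhoff_sum T f n (T x)"
  unfolding birkhoff_sum_def by (subst sum.lessThan_Suc_shift) (simp add: funpow_swap1)

text \<open>The maximum of 0 and the Birkhoff sums of lengths 1 to \<open>n\<close>. The recursion
  through \<open>T x\<close> is the identity on which Garsia's proof of the maximal theorem
  rests.\<close>

fun maximal_sum :: "('a \<Rightarrow> 'a) \<Rightarrow> ('a \<Rightarrow> real) \<Rightarrow> nat \<Rightarrow> 'a \<Rightarrow> real" where
  "maximal_sum T f 0 x = 0"
| "maximal_sum T f (Suc n) x = max 0 (f x + maximal_sum T f n (T x))"

lemma maximal_sum_nonneg: "0 \<le> maximal_sum T f n x"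
  by (cases n) auto

lemma maximal_sum_mono_Suc: "maximal_sum T f n x \<le> maximal_sum T f (Suc n) x"
proof (induction n arbitrary: x)
  case (Suc n)
  from Suc[of "T x"] show ?case by (auto simp: max_def)
qed simp

lemma birkhoff_sum_le_maximal_sum: "birkhoff_sum T f n x \<le> maximal_sum T f n x"
proof (induction n arbitrary: x)
  case 0
  show ?case by (simp add: birkhoff_sum_def)
next
  case (Suc n)
  from Suc[of "T x"] show ?case unfolding birkhoff_sum_Suc by (auto simp: max_def)
qed

locale mps =
  fixes M :: "'a measure" and T :: "'a \<Rightarrow> 'a"
  assumes mps: "measure_preserving_system M T"
begin

sublocale prob_space M
  using mps by (simp add: measure_preserving_system_def)

lemma measurable_T [measurable]: "T \<in> measurable M M"
  using mps by (simp add: measure_preserving_system_def)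

lemma measurable_funpow_T [measurable]: "(T ^^ n) \<in> measurable M M"
  by (rule measurable_compose_n[OF measurable_T])

lemma integral_T: "f \<in> borel_measurable M \<Longrightarrow> (\<integral>x. f (T x) \<partial>M) = (\<integral>x. f x \<partial>M :: real)"
  using mps integral_distr[OF measurable_T, of f] by (simp add: measure_preserving_system_def)

lemma measurable_birkhoff_sum [measurable]:
  "f \<in> borel_measurable M \<Longrightarrow> birkhoff_sum T f n \<in> borel_measurable M"
  unfolding birkhoff_sum_def[abs_def]
  by (intro borel_measurable_sum measurable_compose[OF measurable_funpow_T])

lemma measurable_maximal_sum:
  assumes [measurable]: "f \<in> borel_measurable M"
  shows "maximal_sum T f n \<in> borel_measurable M"
proof (induction n)
  case (Suc n)
  note [measurable] = Suc
  have "(\<lambda>x. max 0 (f x + maximal_sum T f n (T x))) \<in> borel_measurable M" by measurable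
  thus ?case by (simp add: fun_eq_iff[of "maximal_sum T f (Suc n)"] cong: measurable_cong)
qed simp

lemma maximal_sum_bound:
  assumes "\<And>x. x \<in> space M \<Longrightarrow> \<bar>f x\<bar> \<le> B" "x \<in> space M"
  shows "maximal_sum T f n x \<le> real n * B"
  using assms(2)
proof (induction n arbitrary: x)
  case (Suc n)
  have "T x \<in> space M" using Suc.prems measurable_space[OF measurable_T] by blast
  from Suc.IH[OF this] assms(1)[OF Suc.prems] maximal_sum_nonneg[of T f n "T x"]
  show ?case by (auto simp: algebra_simps)
qed simp

text \<open>Garsia's argument: where \<open>g n\<close> is positive it is at most
  \<open>f x + g n (T x)\<close>, elsewhere it is 0. By invariance the integrals of
  \<open>g n\<close> and of \<open>g n\<close> after \<open>T\<close> cancel, so \<open>f\<close>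
  has nonnegative integral over the set where \<open>g n > 0\<close>. These sets exhaust almost all
  of the space by hypothesis.\<close>

theorem maximal_ergodic:
  assumes [measurable]: "f \<in> borel_measurable M" and B: "\<And>x. x \<in> space M \<Longrightarrow> \<bar>f x\<bar> \<le> B"
    and pos: "AE x in M. \<exists>n. birkhoff_sum T f n x > 0"
  shows "(\<integral>x. f x \<partial>M) \<ge> 0"
proof -
  define g where "g n = maximal_sum T f (Suc n)" for n
  have g_meas [measurable]: "g n \<in> borel_measurable M" for n
    unfolding g_def by (rule measurable_maximal_sum) simp
  have T_space: "T x \<in> space M" if "x \<in> space M" for x using that measurable_space[OF measurable_T] by blast
  have g_int: "integrable M (g n)" "integrable M (\<lambda>x. g n (T x))" for n
  proof -
    have "norm (g n x) \<le> real (Suc n) * B" if "x \<in> space M" for x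
      using maximal_sum_bound[OF B that, where n="Suc n"] maximal_sum_nonneg[of T f "Suc n" x] by (simp only: g_def real_norm_def abs_of_nonneg)
    with T_space show "integrable M (g n)" "integrable M (\<lambda>x. g n (T x))"
      by (auto intro!: integrable_const_bound[where B="real (Suc n) * B"] AE_I2)
  qed
  let ?F = "\<lambda>n x. f x * indicator {x\<in>space M. g n x > 0} x"
  have F_int: "integrable M (?F n)" for n
    using B by (intro integrable_const_bound[where B="B"] AE_I2) (auto simp: indicator_def intro: order_trans[OF abs_ge_zero])
  have step: "0 \<le> (\<integral>x. ?F n x \<partial>M)" for n
  proof -
    have "(\<integral>x. g n x - g n (T x) \<partial>M) \<le> (\<integral>x. ?F n x \<partial>M)"
    proof (intro integral_mono F_int Bochner_Integration.integrable_diff g_int)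
      fix x assume x: "x \<in> space M"
      have "maximal_sum T f n (T x) \<le> g n (T x)" unfolding g_def by (rule maximal_sum_mono_Suc)
      moreover have "0 \<le> g n (T x)" unfolding g_def by (rule maximal_sum_nonneg)
      ultimately show "g n x - g n (T x) \<le> ?F n x"
        using x by (auto simp: g_def indicator_def max_def split: if_splits)
    qed
    moreover have "(\<integral>x. g n x - g n (T x) \<partial>M) = 0"
      using g_int integral_T[OF g_meas] by simp
    ultimately show ?thesis by simp
  qed
  have "(\<lambda>n. \<integral>x. ?F n x \<partial>M) \<longlonglongrightarrow> (\<integral>x. f x \<partial>M)"
  proof (rule integral_dominated_convergence[where w="\<lambda>_. B"])
    show "AE x in M. (\<lambda>n. ?F n x) \<longlonglongrightarrow> f x"
      using pos AE_space
    proof eventually_elim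
      case (elim x)
      then obtain n0 where n0: "birkhoff_sum T f n0 x > 0" by blast
      have "g n x > 0" if "n \<ge> n0" for n
      proof -
        have "maximal_sum T f n0 x \<le> maximal_sum T f (Suc n) x"
          by (rule lift_Suc_mono_le[of "\<lambda>n. maximal_sum T f n x"]) (use that maximal_sum_mono_Suc in auto)
        thus ?thesis using n0 birkhoff_sum_le_maximal_sum[of T f n0 x] unfolding g_def by linarith
      qed
      hence "\<forall>\<^sub>F n in sequentially. f x = ?F n x"
        using elim(2) by (intro eventually_sequentiallyI[of n0]) simp
      thus ?case by (rule Lim_transform_eventually[OF tendsto_const])
    qed
    show "AE x in M. norm (?F n x) \<le> B" for n
      using B by (intro AE_I2) (auto simp: indicator_def intro: order_trans[OF abs_ge_zero])
  qed auto
  thus ?thesis by (rule LIMSEQ_le_const) (use step in blast)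
qed

end

text \<open>
  For \<open>h = f - \<integral>f - \<epsilon>\<close> the set where the sums of \<open>h\<close> along orbits are unbounded above is strictly
  invariant, and it cannot have full measure, because then the maximal theorem would give \<open>\<integral>h \<ge> 0\<close>.
\<close>

lemma birkhoff_sum_bounded_above_AE:
  assumes erg: "ergodic_system M T" and [measurable]: "f \<in> borel_measurable M"
    and B: "\<And>x. x \<in> space M \<Longrightarrow> \<bar>f x\<bar> \<le> B" and \<epsilon>: "\<epsilon> > 0"
  shows "AE x in M. \<exists>C. \<forall>n. birkhoff_sum T f n x \<le> real n * ((\<integral>x. f x \<partial>M) + \<epsilon>) + C"
proof -
  interpret mps M T by standard (use erg in \<open>simp add: ergodic_system_def\<close>)
  define c where "c = (\<integral>x. f x \<partial>M) + \<epsilon>"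
  define h where "h x = f x - c" for x
  have h_meas [measurable]: "h \<in> borel_measurable M" unfolding h_def by measurable
  have hB: "\<bar>h x\<bar> \<le> B + \<bar>c\<bar>" if "x \<in> space M" for x using B[OF that] unfolding h_def by linarith
  have f_int: "integrable M f" using B by (intro integrable_const_bound[where B=B] AE_I2) auto
  have sum_h: "birkhoff_sum T h n x = birkhoff_sum T f n x - real n * c" for n x
    by (simp add: birkhoff_sum_def h_def sum_subtractf)
  define Q where "Q = {x\<in>space M. \<forall>k::nat. \<exists>n. birkhoff_sum T h n x > real k}"
  have Q_meas: "Q \<in> sets M" unfolding Q_def by measurable
  have "T -` Q \<inter> space M = Q"
  proof (intro set_eqI iffI)
    fix x assume "x \<in> T -` Q \<inter> space M"
    hence x: "x \<in> space M" and u: "\<And>k::nat. \<exists>n. birkhoff_sum T h n (T x) > real k" by (auto simp: Q_def)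
    have "\<exists>n. birkhoff_sum T h n x > real k" for k
    proof -
      obtain k' :: nat where "real k + \<bar>h x\<bar> \<le> real k'" using real_arch_simple by blast
      moreover obtain n where "birkhoff_sum T h n (T x) > real k'" using u by blast
      ultimately have "birkhoff_sum T h (Suc n) x > real k" unfolding birkhoff_sum_Suc by linarith
      thus ?thesis by blast
    qed
    with x show "x \<in> Q" by (simp add: Q_def)
  next
    fix x assume "x \<in> Q"
    hence x: "x \<in> space M" and u: "\<And>k::nat. \<exists>n. birkhoff_sum T h n x > real k" by (auto simp: Q_def)
    have "\<exists>n. birkhoff_sum T h n (T x) > real k" for k
    proof -
      obtain k' :: nat where k': "real k + \<bar>h x\<bar> \<le> real k'" using real_arch_simple by blast
      obtain n where n: "birkhoff_sum T h n x > real k'" using u by blast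
      \<comment> \<open>The empty sum is 0, which is not above \<open>k'\<close>, so there is a
        first summand to remove.\<close>
      then obtain m where "n = Suc m" by (cases n) (auto simp: birkhoff_sum_def)
      with k' n have "birkhoff_sum T h m (T x) > real k" by (auto simp: birkhoff_sum_Suc)
      thus ?thesis by blast
    qed
    with x measurable_space[OF measurable_T x] show "x \<in> T -` Q \<inter> space M" by (simp add: Q_def)
  qed
  hence "measure M Q = 0 \<or> measure M Q = 1" using erg Q_meas unfolding ergodic_system_def by blast
  moreover have "measure M Q \<noteq> 1"
  proof
    assume "measure M Q = 1"
    hence "AE x in M. x \<in> Q" using Q_meas by (simp add: prob_eq_1)
    hence "AE x in M. \<exists>n. birkhoff_sum T h n x > 0"
    proof eventually_elim
      case (elim x)
      hence "\<exists>n. birkhoff_sum T h n x > real 0" unfolding Q_def by blast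
      thus ?case by simp
    qed
    with hB have "(\<integral>x. h x \<partial>M) \<ge> 0" by (intro maximal_ergodic) auto
    moreover have "(\<integral>x. h x \<partial>M) = - \<epsilon>"
      unfolding h_def using f_int by (simp add: c_def prob_space)
    ultimately show False using \<epsilon> by simp
  qed
  ultimately have "AE x in M. x \<notin> Q" using Q_meas by (simp add: prob_eq_0)
  with AE_space show ?thesis
  proof eventually_elim
    case (elim x)
    then obtain k :: nat where "\<And>n. birkhoff_sum T h n x \<le> real k" by (auto simp: Q_def not_less)
    hence "birkhoff_sum T f n x - real n * c \<le> real k" for n unfolding sum_h .
    hence "birkhoff_sum T f n x \<le> real n * c + real k" for n by (simp add: algebra_simps)
    thus ?case unfolding c_def by blast
  qed
qed

text \<open>The one-sided bounds for \<open>f\<close> and \<open>- f\<close>, with all tolerances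
  \<open>1 / Suc j\<close> at once, give convergence almost everywhere, and boundedness turns it
  into convergence in mean. The latter transfers to an orbit, since it is a statement on
  integrals.\<close>

theorem ergodic_averages_L1:
  assumes erg: "ergodic_system M T" and f_meas [measurable]: "f \<in> borel_measurable M"
    and B: "\<And>x. x \<in> space M \<Longrightarrow> \<bar>f x\<bar> \<le> B"
  shows "(\<lambda>n. \<integral>x. \<bar>birkhoff_sum T f n x / real n - (\<integral>x. f x \<partial>M)\<bar> \<partial>M) \<longlonglongrightarrow> 0"
proof -
  interpret mps M T by standard (use erg in \<open>simp add: ergodic_system_def\<close>)
  define c where "c = (\<integral>x. f x \<partial>M)"
  have one_sided: "AE x in M. \<forall>j. \<exists>C. \<forall>n. birkhoff_sum T u n x \<le> real n * ((\<integral>x. u x \<partial>M) + 1 / real (Suc j)) + C"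
    if [measurable]: "u \<in> borel_measurable M" and "\<And>x. x \<in> space M \<Longrightarrow> \<bar>u x\<bar> \<le> B" for u
    unfolding AE_all_countable
    by (intro allI birkhoff_sum_bounded_above_AE[OF erg that]) auto
  have upper: "AE x in M. \<forall>j. \<exists>C. \<forall>n. birkhoff_sum T f n x \<le> real n * (c + 1 / real (Suc j)) + C"
    unfolding c_def by (rule one_sided[OF f_meas B])
  have lower: "AE x in M. \<forall>j. \<exists>C. \<forall>n. - birkhoff_sum T f n x \<le> real n * (- c + 1 / real (Suc j)) + C"
    using one_sided[of "\<lambda>x. - f x"] B by (simp add: birkhoff_sum_def sum_negf c_def)
  have conv: "AE x in M. (\<lambda>n. birkhoff_sum T f n x / real n) \<longlonglongrightarrow> c"
    using upper lower
  proof eventually_elim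
    case (elim x)
    show ?case
    proof (rule LIMSEQ_I)
      fix e :: real assume e: "e > 0"
      obtain j where j: "1 / real (Suc j) < e / 2"
        using nat_approx_posE[of "e / 2"] e by auto
      obtain C where C: "\<And>n. birkhoff_sum T f n x \<le> real n * (c + 1 / real (Suc j)) + C"
        using elim(1) by blast
      obtain C' where C': "\<And>n. - birkhoff_sum T f n x \<le> real n * (- c + 1 / real (Suc j)) + C'"
        using elim(2) by blast
      obtain m :: nat where m: "2 * (\<bar>C\<bar> + \<bar>C'\<bar>) / e < real m" using reals_Archimedean2 by blast
      have "norm (birkhoff_sum T f n x / real n - c) < e" if "n \<ge> Suc m" for n
      proof -
        have n: "real n > 0" using that by simp
        have "2 * (\<bar>C\<bar> + \<bar>C'\<bar>) / e < real n" using m that by linarith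
        hence *: "\<bar>C\<bar> + \<bar>C'\<bar> < real n * (e / 2)" using e by (simp add: field_simps)
        have **: "real n * (1 / real (Suc j)) < real n * (e / 2)" using j n by (intro mult_strict_left_mono)
        have "birkhoff_sum T f n x \<le> real n * c + real n * (1 / real (Suc j)) + C"
          "- birkhoff_sum T f n x \<le> - (real n * c) + real n * (1 / real (Suc j)) + C'"
          using C[of n] C'[of n] by (simp_all only: distrib_left mult_minus_right)
        moreover have "real n * (e / 2) + real n * (e / 2) = real n * e" by simp
        ultimately have "\<bar>birkhoff_sum T f n x - real n * c\<bar> < real n * e"
          using * ** by linarith
        moreover have "birkhoff_sum T f n x / real n - c = (birkhoff_sum T f n x - real n * c) / real n"
          using n by (simp add: field_simps)
        ultimately show ?thesis using n by (simp add: pos_divide_less_eq mult.commute)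
      qed
      thus "\<exists>m. \<forall>n\<ge>m. norm (birkhoff_sum T f n x / real n - c) < e" by blast
    qed
  qed
  have T_space: "(T ^^ k) x \<in> space M" if "x \<in> space M" for k x
    using that measurable_space[OF measurable_funpow_T] by blast
  have "(\<lambda>n. \<integral>x. \<bar>birkhoff_sum T f n x / real n - c\<bar> \<partial>M) \<longlonglongrightarrow> (\<integral>x. 0 \<partial>M)"
  proof (rule integral_dominated_convergence[where w="\<lambda>_. B + \<bar>c\<bar>"])
    show "AE x in M. (\<lambda>n. \<bar>birkhoff_sum T f n x / real n - c\<bar>) \<longlonglongrightarrow> 0"
      using conv by eventually_elim (simp add: LIM_zero tendsto_rabs_zero)
    show "AE x in M. norm \<bar>birkhoff_sum T f n x / real n - c\<bar> \<le> B + \<bar>c\<bar>" for n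
    proof (rule AE_I2)
      fix x assume x: "x \<in> space M"
      have "\<bar>birkhoff_sum T f n x\<bar> \<le> (\<Sum>k<n. \<bar>f ((T ^^ k) x)\<bar>)" unfolding birkhoff_sum_def by (rule sum_abs)
      also have "\<dots> \<le> (\<Sum>k<n. B)" by (intro sum_mono B T_space x)
      finally have "\<bar>birkhoff_sum T f n x\<bar> \<le> real n * B" by simp
      hence "\<bar>birkhoff_sum T f n x / real n\<bar> \<le> B"
        using B[OF x] by (cases "n = 0") (auto simp: pos_divide_le_eq mult.commute)
      thus "norm \<bar>birkhoff_sum T f n x / real n - c\<bar> \<le> B + \<bar>c\<bar>"
        unfolding real_norm_def abs_abs by linarith
    qed
  qed auto
  thus ?thesis by (simp add: c_def)
qed

subsection \<open>Existence of Furstenberg measures of binary sequences\<close>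

definition binary_seqs :: "(int \<Rightarrow> complex) set" where
  "binary_seqs = {x. \<forall>n. x n \<in> {0, 1}}"

lemma binary_seqs_subset: "binary_seqs \<subseteq> disc_seqs"
proof
  fix x assume x: "x \<in> binary_seqs"
  have "norm (x n) \<le> 1" for n
  proof -
    have "x n = 0 \<or> x n = 1" using x by (auto simp: binary_seqs_def)
    thus ?thesis by auto
  qed
  thus "x \<in> disc_seqs" by (simp add: disc_seqs_def)
qed

lemma compact_binary_seqs: "compact binary_seqs"
proof -
  have "compactin (product_topology (\<lambda>i::int. (euclidean :: complex topology)) UNIV) (PiE UNIV (\<lambda>_. {0, 1}))"
    unfolding compactin_PiE by simp
  moreover have "PiE UNIV (\<lambda>_. {0, 1}) = binary_seqs" by (auto simp: binary_seqs_def PiE_def)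
  ultimately show ?thesis by (simp add: euclidean_product_topology)
qed

text \<open>
  Base 3 makes the encoding injective (no carries), so that \<^term>\<open>binary_seqs\<close> becomes a Cantor set on
  the line and Helly's selection theorem applies.
\<close>

definition ternary_code :: "(int \<Rightarrow> complex) \<Rightarrow> real" where
  "ternary_code x = (\<Sum>i. Re (x (int_decode i)) / 3 ^ i)"

lemma binary_term_bound: "x \<in> binary_seqs \<Longrightarrow> norm (Re (x (int_decode i)) / 3 ^ i) \<le> (1/3) ^ i"
proof -
  assume "x \<in> binary_seqs"
  hence "x (int_decode i) = 0 \<or> x (int_decode i) = 1" by (auto simp: binary_seqs_def)
  thus ?thesis by (auto simp: power_divide)
qed

lemma summable_third: "summable (\<lambda>i. (1/3 :: real) ^ i)"
  by (rule summable_geometric) simp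

lemma summable_ternary: "x \<in> binary_seqs \<Longrightarrow> summable (\<lambda>i. Re (x (int_decode i)) / 3 ^ i)"
  by (rule summable_comparison_test'[OF summable_third, of 0]) (rule binary_term_bound)

lemma ternary_code_bounds:
  assumes "x \<in> binary_seqs"
  shows "0 \<le> ternary_code x" "ternary_code x \<le> 3 / 2"
proof -
  have "0 \<le> Re (x (int_decode i)) / 3 ^ i" for i
  proof -
    have "x (int_decode i) = 0 \<or> x (int_decode i) = 1" using assms by (auto simp: binary_seqs_def)
    thus ?thesis by auto
  qed
  thus "0 \<le> ternary_code x" unfolding ternary_code_def by (intro suminf_nonneg summable_ternary assms)
  have "ternary_code x \<le> (\<Sum>i. (1/3 :: real) ^ i)"
    unfolding ternary_code_def
    by (intro suminf_le summable_ternary assms summable_third)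
       (use binary_term_bound[OF assms] in \<open>metis abs_ge_self order_trans real_norm_def\<close>)
  also have "\<dots> = 3 / 2" by (subst suminf_geometric) auto
  finally show "ternary_code x \<le> 3 / 2" .
qed

lemma continuous_on_ternary_code: "continuous_on binary_seqs ternary_code"
proof -
  have "uniform_limit binary_seqs (\<lambda>n x. \<Sum>i<n. Re (x (int_decode i)) / 3 ^ i)
      (\<lambda>x. \<Sum>i. Re (x (int_decode i)) / 3 ^ i) sequentially"
    by (rule Weierstrass_m_test[OF binary_term_bound summable_third])
  thus ?thesis
    unfolding ternary_code_def[abs_def]
    by (rule uniform_limit_theorem[rotated])
       (auto intro!: always_eventually continuous_intros continuous_on_product_then_coordinatewise[OF continuous_on_id])
qed

text \<open>The first differing digit, of index \<open>m\<close>, contributes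
  \<open>1 / 3 ^ m\<close> to the distance of the codes, while all later digits together contribute
  at most half of that. In base 2 the two amounts could be equal.\<close>

lemma inj_on_ternary_code: "inj_on ternary_code binary_seqs"
proof (rule inj_onI, rule ccontr)
  fix x y assume x: "x \<in> binary_seqs" and y: "y \<in> binary_seqs" and eq: "ternary_code x = ternary_code y" and ne: "x \<noteq> y"
  define D where "D i = Re (x (int_decode i)) - Re (y (int_decode i))" for i
  have vals: "D i = 0 \<and> x (int_decode i) = y (int_decode i) \<or> \<bar>D i\<bar> = 1" for i
  proof -
    have "x (int_decode i) = 0 \<or> x (int_decode i) = 1" "y (int_decode i) = 0 \<or> y (int_decode i) = 1"
      using x y by (auto simp: binary_seqs_def)
    thus ?thesis by (auto simp: D_def)
  qed
  obtain k where "x k \<noteq> y k" using ne by auto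
  hence "x (int_decode (int_encode k)) \<noteq> y (int_decode (int_encode k))" by simp
  hence "D (int_encode k) \<noteq> 0" using vals[of "int_encode k"] by auto
  hence ex: "\<exists>i. D i \<noteq> 0" ..
  define m where "m = (LEAST i. D i \<noteq> 0)"
  have m: "D m \<noteq> 0" "\<And>i. i < m \<Longrightarrow> D i = 0"
    using LeastI_ex[OF ex] not_less_Least unfolding m_def by blast+
  have sm: "summable (\<lambda>i. D i / 3 ^ i)"
    unfolding D_def diff_divide_distrib by (intro summable_diff summable_ternary x y)
  have "(\<Sum>i. D i / 3 ^ i) = ternary_code x - ternary_code y"
    unfolding D_def diff_divide_distrib ternary_code_def by (intro suminf_diff[symmetric] summable_ternary x y)
  hence "0 = (\<Sum>i. D (i + Suc m) / 3 ^ (i + Suc m)) + (\<Sum>i<Suc m. D i / 3 ^ i)"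
    using suminf_split_initial_segment[OF sm, of "Suc m"] eq by simp
  also have "(\<Sum>i<Suc m. D i / 3 ^ i) = D m / 3 ^ m" using m(2) by simp
  finally have "\<bar>D m / 3 ^ m\<bar> = \<bar>\<Sum>i. D (i + Suc m) / 3 ^ (i + Suc m)\<bar>" by linarith
  also have "\<dots> \<le> (\<Sum>i. (1/3) ^ Suc m * (1/3) ^ i)"
  proof (rule order_trans[OF summable_rabs])
    have b: "\<bar>D (i + Suc m) / 3 ^ (i + Suc m)\<bar> \<le> (1/3) ^ Suc m * (1/3) ^ i" for i
    proof -
      have "\<bar>D (i + Suc m)\<bar> \<le> 1" using vals[of "i + Suc m"] by auto
      hence "\<bar>D (i + Suc m)\<bar> / 3 ^ (i + Suc m) \<le> 1 / 3 ^ (i + Suc m)" by (rule divide_right_mono) simp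
      thus ?thesis by (simp add: power_add power_divide abs_divide mult.commute)
    qed
    have s2: "summable (\<lambda>i. (1/3 :: real) ^ Suc m * (1/3) ^ i)" by (intro summable_mult summable_third)
    show s1: "summable (\<lambda>i. \<bar>D (i + Suc m) / 3 ^ (i + Suc m)\<bar>)"
      by (rule summable_comparison_test'[OF s2, of 0]) (use b in simp)
    show "(\<Sum>i. \<bar>D (i + Suc m) / 3 ^ (i + Suc m)\<bar>) \<le> (\<Sum>i. (1/3) ^ Suc m * (1/3) ^ i)"
      by (rule suminf_le[OF b s1 s2])
  qed
  also have "\<dots> = (1/3) ^ Suc m * (3 / 2)"
    by (subst suminf_mult[OF summable_third], subst suminf_geometric) auto
  finally have "\<bar>D m\<bar> / 3 ^ m \<le> 1 / 3 ^ m * (1 / 2)" by (simp add: power_divide)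
  hence "\<bar>D m\<bar> \<le> 1 / 2" by (simp add: field_simps)
  with vals[of m] m(1) show False by auto
qed

text \<open>The codes lie between 0 and 3/2, so their empirical distributions are tight and have a
  weakly convergent subsequence; the limit lives on the compact set of codes and is carried back by
  the inverse of the coding.\<close>

lemma binary_empirical_measures_converge:
  fixes s :: "nat \<Rightarrow> nat" and y :: "nat \<Rightarrow> int \<Rightarrow> complex"
  assumes y: "\<And>m. y m \<in> binary_seqs" and s: "strict_mono s"
  obtains r \<mu> where "strict_mono r" "sets \<mu> = sets (restrict_space borel disc_seqs)" "prob_space \<mu>"
    "\<And>f :: (int \<Rightarrow> complex) \<Rightarrow> real. continuous_on disc_seqs f \<Longrightarrow>
       (\<lambda>k. avg (\<lambda>m. f (y m)) (s (r k))) \<longlonglongrightarrow> integral\<^sup>L \<mu> f"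
proof -
  define K where "K = ternary_code ` binary_seqs"
  have K: "compact K" unfolding K_def by (intro compact_continuous_image continuous_on_ternary_code compact_binary_seqs)
  have Kc: "closed K" using K by (rule compact_imp_closed)
  have yK: "ternary_code (y m) \<in> K" for m using y by (auto simp: K_def)
  have K0: "K \<noteq> {}" using yK by blast
  define \<psi> where "\<psi> = the_inv_into binary_seqs ternary_code"
  have \<psi>_cont: "continuous_on K \<psi>"
    unfolding K_def \<psi>_def by (rule continuous_on_inv_into[OF continuous_on_ternary_code compact_binary_seqs inj_on_ternary_code])
  have \<psi>_code: "\<psi> (ternary_code x) = x" if "x \<in> binary_seqs" for x
    unfolding \<psi>_def by (rule the_inv_into_f_f[OF inj_on_ternary_code that])
  have \<psi>K: "\<psi> t \<in> binary_seqs" if "t \<in> K" for t using that \<psi>_code by (auto simp: K_def)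
  \<comment> \<open>\<open>max 1 N\<close> keeps this a probability measure for
    \<open>N = 0\<close>, so that tightness can be stated for the whole sequence.\<close>
  define \<nu> where "\<nu> N = distr (uniform_count_measure {1..max 1 N}) borel (\<lambda>m. ternary_code (y m))" for N
  have \<nu>: "real_distribution (\<nu> N)" for N
  proof -
    interpret prob_space "uniform_count_measure {1..max 1 N}"
      by (rule prob_space_uniform_count_measure) auto
    show ?thesis unfolding \<nu>_def by (rule real_distribution_distr) (simp add: uniform_count_measure_def)
  qed
  have \<nu>_int: "integral\<^sup>L (\<nu> N) g = avg (\<lambda>m. g (ternary_code (y m))) N"
    if [measurable]: "g \<in> borel_measurable borel" and "N \<ge> 1" for g :: "real \<Rightarrow> real" and N
  proof -
    have "(\<lambda>m. ternary_code (y m)) \<in> measurable (uniform_count_measure {1..max 1 N}) borel"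
      by (simp add: measurable_def)
    from integral_distr[OF this that(1)] show ?thesis
      using \<open>N \<ge> 1\<close> by (simp add: \<nu>_def integral_uniform_count_measure avg_def max_def)
  qed
  have "tight \<nu>"
    unfolding tight_def
  proof (intro conjI allI impI \<nu>)
    fix \<epsilon> :: real assume "\<epsilon> > 0"
    have "measure (\<nu> n) {-1<..2} = 1" for n
    proof -
      interpret real_distribution "\<nu> n" by (rule \<nu>)
      have "AE t in \<nu> n. t \<in> {-1<..2}"
        unfolding \<nu>_def
      proof (subst AE_distr_iff)
        show "AE m in uniform_count_measure {1..max 1 n}. ternary_code (y m) \<in> {-1<..2}"
        proof (rule AE_I2)
          fix m
          show "ternary_code (y m) \<in> {-1<..2}" using ternary_code_bounds[OF y[of m]] by simp
        qed
      qed (auto simp: uniform_count_measure_def)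
      thus ?thesis by (subst prob_eq_1) auto
    qed
    with \<open>\<epsilon> > 0\<close> show "\<exists>a b. a < b \<and> (\<forall>n. 1 - \<epsilon> < measure (\<nu> n) {a<..b})"
      by (intro exI[of _ "-1"] exI[of _ 2]) auto
  qed
  from tight_imp_convergent_subsubsequence[OF this s]
  obtain r Q where r: "strict_mono r" and Q: "real_distribution Q" and conv: "weak_conv_m (\<nu> \<circ> s \<circ> r) Q"
    by blast
  interpret Q: real_distribution Q by (rule Q)
  have sr: "\<forall>\<^sub>F k in sequentially. s (r k) \<ge> 1"
  proof (rule eventually_sequentiallyI[of 1])
    fix k :: nat assume "k \<ge> 1"
    moreover have "k \<le> r k" "r k \<le> s (r k)" using r s by (auto intro: strict_mono_imp_increasing)
    ultimately show "s (r k) \<ge> 1" by linarith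
  qed
  have weak: "(\<lambda>k. avg (\<lambda>m. g (ternary_code (y m))) (s (r k))) \<longlonglongrightarrow> integral\<^sup>L Q g"
    if g: "continuous_on UNIV g" and gB: "\<And>t. norm (g t) \<le> B" for g :: "real \<Rightarrow> real" and B
  proof -
    have "(\<lambda>k. integral\<^sup>L ((\<nu> \<circ> s \<circ> r) k) g) \<longlonglongrightarrow> integral\<^sup>L Q g"
      by (rule weak_conv_imp_integral_bdd_continuous_conv[OF _ Q conv _ gB])
         (use \<nu> g in \<open>auto simp: continuous_on_eq_continuous_at\<close>)
    moreover have "\<forall>\<^sub>F k in sequentially. integral\<^sup>L ((\<nu> \<circ> s \<circ> r) k) g = avg (\<lambda>m. g (ternary_code (y m))) (s (r k))"
      using sr by eventually_elim (use g in \<open>auto intro!: \<nu>_int borel_measurable_continuous_onI\<close>)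
    ultimately show ?thesis by (rule Lim_transform_eventually)
  qed
  have QK: "AE t in Q. t \<in> K"
  proof -
    \<comment> \<open>A continuous function that vanishes exactly on \<open>K\<close>: its averages
      over the codes are 0, so \<open>Q\<close> gives no mass to the complement of
      \<open>K\<close>.\<close>
    define g where "g t = min 1 (infdist t K)" for t
    have g_cont: "continuous_on UNIV g" unfolding g_def by (intro continuous_intros)
    have g01: "0 \<le> g t" "g t \<le> 1" for t by (auto simp: g_def infdist_nonneg)
    have "(\<lambda>k. avg (\<lambda>m. g (ternary_code (y m))) (s (r k))) \<longlonglongrightarrow> integral\<^sup>L Q g"
      by (rule weak[OF g_cont, of 1]) (use g01 in auto)
    moreover have "avg (\<lambda>m. g (ternary_code (y m))) N = 0" for N
      using yK by (simp add: avg_def g_def)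
    ultimately have "integral\<^sup>L Q g = 0" by (simp add: LIMSEQ_const_iff)
    moreover have "integrable Q g"
      using g_cont g01 by (intro Q.integrable_const_bound[where B=1] AE_I2) (auto intro: borel_measurable_continuous_onI simp: measurable_cong_sets[OF Q.events_eq_borel refl])
    ultimately have "AE t in Q. g t = 0"
      using g01 by (subst (asm) integral_nonneg_eq_0_iff_AE) auto
    thus ?thesis
      by eventually_elim (auto simp: g_def min_def in_closed_iff_infdist_zero[OF Kc K0] split: if_splits)
  qed
  \<comment> \<open>Outside \<open>K\<close>, a null set for \<open>Q\<close>, the zero sequence is
    taken, so that the whole line is mapped into \<open>disc_seqs\<close>.\<close>
  define \<psi>' where "\<psi>' t = (if t \<in> K then \<psi> t else (\<lambda>_. 0))" for t
  have \<psi>'X: "\<psi>' t \<in> binary_seqs" for t using \<psi>K by (auto simp: \<psi>'_def binary_seqs_def)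
  have "\<psi>' \<in> borel_measurable borel"
    unfolding \<psi>'_def[abs_def]
    by (rule borel_measurable_continuous_on_if) (use Kc \<psi>_cont in auto)
  hence \<psi>'_meas [measurable]: "\<psi>' \<in> measurable Q (restrict_space borel disc_seqs)"
    using \<psi>'X binary_seqs_subset
    by (intro measurable_restrict_space2) (auto simp: measurable_cong_sets[OF Q.events_eq_borel refl])
  define \<mu> where "\<mu> = distr Q (restrict_space borel disc_seqs) \<psi>'"
  show ?thesis
  proof (rule that[OF r])
    show "sets \<mu> = sets (restrict_space borel disc_seqs)" by (simp add: \<mu>_def)
    show "prob_space \<mu>" unfolding \<mu>_def by (rule Q.prob_space_distr) simp
    fix f :: "(int \<Rightarrow> complex) \<Rightarrow> real" assume f: "continuous_on disc_seqs f"
    have f_meas: "f \<in> borel_measurable (restrict_space borel disc_seqs)"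
      by (rule borel_measurable_continuous_on_restrict[OF f])
    have fK: "continuous_on K (\<lambda>t. f (\<psi> t))"
      by (rule continuous_on_compose2[OF f \<psi>_cont]) (use \<psi>K binary_seqs_subset in auto)
    obtain B where B: "B > 0" "\<And>t. t \<in> K \<Longrightarrow> norm (f (\<psi> t)) \<le> B"
      using compact_imp_bounded[OF compact_continuous_image[OF fK K]] unfolding bounded_pos by blast
    \<comment> \<open>The pulled-back \<open>f\<close> is defined on \<open>K\<close> only; Tietze's
      theorem extends it to the line with the same bound, as weak convergence there needs a bounded
      continuous function.\<close>
    obtain g where g: "continuous_on UNIV g" "\<And>t. t \<in> K \<Longrightarrow> g t = f (\<psi> t)" "\<And>t. norm (g t) \<le> B"
      by (rule Tietze[OF fK, of UNIV B]) (use Kc B in auto)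
    have "integral\<^sup>L \<mu> f = (\<integral>t. f (\<psi>' t) \<partial>Q)" unfolding \<mu>_def by (rule integral_distr[OF \<psi>'_meas f_meas])
    also have "\<dots> = integral\<^sup>L Q g"
    proof (rule integral_cong_AE)
      show "AE t in Q. f (\<psi>' t) = g t" using QK by eventually_elim (simp add: \<psi>'_def g)
      show "(\<lambda>t. f (\<psi>' t)) \<in> borel_measurable Q" by (rule measurable_compose[OF \<psi>'_meas f_meas])
      show "g \<in> borel_measurable Q"
        using g(1) by (auto intro: borel_measurable_continuous_onI simp: measurable_cong_sets[OF Q.events_eq_borel refl])
    qed
    finally have "integral\<^sup>L \<mu> f = integral\<^sup>L Q g" .
    moreover have "g (ternary_code (y m)) = f (y m)" for m using g(2)[OF yK] \<psi>_code[OF y] by simp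
    ultimately show "(\<lambda>k. avg (\<lambda>m. f (y m)) (s (r k))) \<longlonglongrightarrow> integral\<^sup>L \<mu> f"
      using weak[OF g(1,3)] by simp
  qed
qed

subsection \<open>Ergodic weights\<close>

lemma shift_funpow: "(shift ^^ m) x = (\<lambda>n. x (n + int m))"
  by (induction m) (auto simp: shift_def fun_eq_iff algebra_simps)

lemma shift_funpow_disc_seqs: "x \<in> disc_seqs \<Longrightarrow> (shift ^^ m) x \<in> disc_seqs"
  by (simp add: shift_funpow disc_seqs_def)

lemma continuous_on_shift_funpow: "continuous_on S (shift ^^ m)"
  unfolding shift_funpow[abs_def]
  by (intro continuous_on_coordinatewise_then_product continuous_on_product_then_coordinatewise[OF continuous_on_id])

text \<open>The error of the ergodic average of length \<open>H\<close> is itself a continuous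
  function on \<open>disc_seqs\<close>, so its mean along the orbit converges to its \<mu>-integral,
  which ergodicity makes small for a suitable \<open>H\<close>.\<close>

lemma short_averages_of_furstenberg:
  assumes erg: "ergodic_system \<mu> shift" and sets: "sets \<mu> = sets (restrict_space borel disc_seqs)"
    and x: "x \<in> disc_seqs"
    and conv: "\<And>f :: (int \<Rightarrow> complex) \<Rightarrow> real. continuous_on disc_seqs f \<Longrightarrow>
       (\<lambda>k. avg (\<lambda>m. f ((shift ^^ m) x)) (M k)) \<longlonglongrightarrow> integral\<^sup>L \<mu> f"
    and f: "continuous_on disc_seqs f" and f1: "\<And>y. y \<in> disc_seqs \<Longrightarrow> \<bar>f y\<bar> \<le> 1"
  shows "\<exists>c. \<bar>c\<bar> \<le> 1 \<and> short_averages (filtermap M sequentially) (\<lambda>n. f ((shift ^^ n) x)) c"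
proof -
  define c where "c = integral\<^sup>L \<mu> f"
  have space: "space \<mu> = disc_seqs" using sets_eq_imp_space_eq[OF sets] by (simp add: space_restrict_space)
  have f_meas: "f \<in> borel_measurable \<mu>"
    using borel_measurable_continuous_on_restrict[OF f] by (simp add: measurable_cong_sets[OF sets refl])
  have "\<bar>c\<bar> \<le> 1"
  proof -
    have "(\<lambda>k. \<bar>avg (\<lambda>m. f ((shift ^^ m) x)) (M k)\<bar>) \<longlonglongrightarrow> \<bar>c\<bar>"
      unfolding c_def by (intro tendsto_rabs conv f)
    moreover have "\<bar>avg (\<lambda>m. f ((shift ^^ m) x)) (M k)\<bar> \<le> 1" for k
      using norm_avg_le_const[of "\<lambda>m. f ((shift ^^ m) x)" 1 "M k"] f1[OF shift_funpow_disc_seqs[OF x]] by simp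
    ultimately show ?thesis by (intro LIMSEQ_le_const2[of _ "\<bar>c\<bar>"]) auto
  qed
  moreover have "short_averages (filtermap M sequentially) (\<lambda>n. f ((shift ^^ n) x)) c"
    unfolding short_averages_def
  proof (intro allI impI)
    fix \<epsilon> :: real assume \<epsilon>: "\<epsilon> > 0"
    have "(\<lambda>n. \<integral>y. \<bar>birkhoff_sum shift f n y / real n - c\<bar> \<partial>\<mu>) \<longlonglongrightarrow> 0"
      unfolding c_def by (rule ergodic_averages_L1[OF erg f_meas]) (use f1 space in simp)
    from order_tendstoD(2)[OF this \<epsilon>]
    obtain H where H: "H \<ge> 1" "(\<integral>y. \<bar>birkhoff_sum shift f H y / real H - c\<bar> \<partial>\<mu>) < \<epsilon>"
      unfolding eventually_sequentially using nat_le_linear by blast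
    let ?G = "\<lambda>y. \<bar>birkhoff_sum shift f H y / real H - c\<bar>"
    have "continuous_on disc_seqs ?G"
      unfolding birkhoff_sum_def
      by (intro continuous_intros continuous_on_compose2[OF f] continuous_on_shift_funpow)
         (use H(1) shift_funpow_disc_seqs in auto)
    from order_tendstoD(2)[OF conv[OF this] H(2)]
    have ev: "\<forall>\<^sub>F k in sequentially. avg (\<lambda>m. ?G ((shift ^^ m) x)) (M k) < \<epsilon>" .
    have eq: "?G ((shift ^^ n) x) = \<bar>(\<Sum>h<H. f ((shift ^^ (n + h)) x)) / real H - c\<bar>" for n
      by (simp add: birkhoff_sum_def add.commute[of n] funpow_add)
    have "\<forall>\<^sub>F N in filtermap M sequentially. avg (\<lambda>n. \<bar>(\<Sum>h<H. f ((shift ^^ (n + h)) x)) / real H - c\<bar>) N \<le> \<epsilon>"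
      unfolding eventually_filtermap using ev unfolding eq by eventually_elim simp
    with H(1) show "\<exists>H\<ge>1. \<forall>\<^sub>F N in filtermap M sequentially. avg (\<lambda>n. \<bar>(\<Sum>h<H. f ((shift ^^ (n + h)) x)) / real H - c\<bar>) N \<le> \<epsilon>"
      by blast
  qed
  ultimately show ?thesis by blast
qed

lemma (in hardy) ergodic_binary_weights_avg_tendsto_zero:
  assumes w: "ergodic_disc_seq w" and w01: "\<And>n. n \<ge> 1 \<Longrightarrow> w n \<in> {0, 1}" and \<beta>: "\<beta> \<noteq> 0"
    and a: "tempered d a \<Lambda>" and d: "d = 0 \<Longrightarrow> \<Lambda> = 0"
  shows "avg (\<lambda>n. w n * ee (\<beta> * a (real n))) \<longlonglongrightarrow> 0"
proof (rule ccontr)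
  let ?u = "avg (\<lambda>n. w n * ee (\<beta> * a (real n)))"
  assume "\<not> ?u \<longlonglongrightarrow> 0"
  then obtain e where e: "e > 0" "\<not> (\<forall>\<^sub>F N in sequentially. norm (?u N) < e)"
    unfolding tendsto_iff by auto
  have "infinite {N. N \<ge> 1 \<and> norm (?u N) \<ge> e}"
    unfolding infinite_nat_iff_unbounded
  proof
    fix m
    have "\<not> (\<forall>N\<ge>Suc m. norm (?u N) < e)" using e(2) unfolding eventually_sequentially by blast
    then obtain N where "N \<ge> Suc m" "norm (?u N) \<ge> e" by (auto simp: not_less)
    thus "\<exists>N>m. N \<in> {N. N \<ge> 1 \<and> norm (?u N) \<ge> e}" by (intro exI[of _ N]) auto
  qed
  from infinite_enumerate[OF this] obtain s :: "nat \<Rightarrow> nat"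
    where s: "strict_mono s" and sN: "\<And>k. s k \<ge> 1 \<and> norm (?u (s k)) \<ge> e" by auto
  define x where "x = extend_seq w"
  have x01: "x \<in> binary_seqs"
    using w01 by (auto simp: x_def binary_seqs_def extend_seq_def)
  have y01: "(shift ^^ m) x \<in> binary_seqs" for m
    using x01 by (simp add: shift_funpow binary_seqs_def)
  have xd: "x \<in> disc_seqs" using x01 binary_seqs_subset by blast
  obtain r \<mu> where r: "strict_mono r" and \<mu>: "sets \<mu> = sets (restrict_space borel disc_seqs)" "prob_space \<mu>"
    and conv: "\<And>f :: (int \<Rightarrow> complex) \<Rightarrow> real. continuous_on disc_seqs f \<Longrightarrow>
       (\<lambda>k. avg (\<lambda>m. f ((shift ^^ m) x)) (s (r k))) \<longlonglongrightarrow> integral\<^sup>L \<mu> f"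
    using binary_empirical_measures_converge[of "\<lambda>m. (shift ^^ m) x", OF y01 s] by metis
  define M where "M k = s (r k)" for k
  have M: "strict_mono M" unfolding M_def using s r by (simp add: strict_mono_def)
  have "furstenberg_measure w \<mu>"
    unfolding furstenberg_measure_def
  proof (intro conjI \<mu> exI[of _ M] M allI impI)
    show "M k \<ge> 1" for k using sN by (simp add: M_def)
    fix f :: "(int \<Rightarrow> complex) \<Rightarrow> real" assume "continuous_on disc_seqs f"
    from conv[OF this] show "(\<lambda>k. (\<Sum>m=1..M k. f ((shift ^^ m) (extend_seq w))) / real (M k)) \<longlonglongrightarrow> integral\<^sup>L \<mu> f"
      by (simp add: avg_def M_def x_def)
  qed
  hence erg: "ergodic_system \<mu> shift" using w by (simp add: ergodic_disc_seq_def)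
  \<comment> \<open>Limits along \<open>F\<close> are limits along the subsequence \<open>M\<close>,
    the only one on which \<mu> gives information.\<close>
  define F where "F = filtermap M sequentially"
  have "filterlim M sequentially sequentially" using M by (rule filterlim_subseq)
  hence F: "F \<le> sequentially" by (simp add: F_def filterlim_def)
  \<comment> \<open>Products with shifts stay in this class, and \<open>conv\<close> applies to
    every observable in it.\<close>
  define V where "V = {v. \<exists>f. continuous_on disc_seqs f \<and> (\<forall>y\<in>disc_seqs. \<bar>f y\<bar> \<le> 1) \<and> v = (\<lambda>n. f ((shift ^^ n) x) :: real)}"
  have V1: "\<bar>v n\<bar> \<le> 1" if "v \<in> V" for v n
    using that shift_funpow_disc_seqs[OF xd] by (auto simp: V_def)
  have V2: "\<exists>c. \<bar>c\<bar> \<le> 1 \<and> short_averages F v c" if "v \<in> V" for v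
  proof -
    from that obtain f where f: "continuous_on disc_seqs f" "\<And>y. y \<in> disc_seqs \<Longrightarrow> \<bar>f y\<bar> \<le> 1" "v = (\<lambda>n. f ((shift ^^ n) x))"
      unfolding V_def by blast
    show ?thesis unfolding F_def f(3)
      by (rule short_averages_of_furstenberg[OF erg \<mu>(1) xd _ f(1,2)]) (use conv in \<open>simp add: M_def\<close>)
  qed
  have V3: "(\<lambda>n. v (n + h) * v n) \<in> V" if "v \<in> V" for v h
  proof -
    from that obtain f where f: "continuous_on disc_seqs f" "\<And>y. y \<in> disc_seqs \<Longrightarrow> \<bar>f y\<bar> \<le> 1" "v = (\<lambda>n. f ((shift ^^ n) x))"
      unfolding V_def by blast
    have "continuous_on disc_seqs (\<lambda>y. f ((shift ^^ h) y) * f y)"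
      by (intro continuous_intros f continuous_on_compose2[OF f(1)] continuous_on_shift_funpow)
         (use shift_funpow_disc_seqs in auto)
    moreover have "\<bar>f ((shift ^^ h) y) * f y\<bar> \<le> 1" if "y \<in> disc_seqs" for y
      unfolding abs_mult using f(2)[OF that] f(2)[OF shift_funpow_disc_seqs[OF that]] by (intro mult_le_one) auto
    moreover have "(\<lambda>n. v (n + h) * v n) = (\<lambda>n. f ((shift ^^ h) ((shift ^^ n) x)) * f ((shift ^^ n) x))"
      unfolding f(3) by (simp add: add.commute[of _ h] funpow_add)
    ultimately show ?thesis unfolding V_def by (intro CollectI exI[of _ "\<lambda>y. f ((shift ^^ h) y) * f y"]) auto
  qed
  \<comment> \<open>Reading coordinate 0 after \<open>n\<close> shifts recovers \<open>w n\<close>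
    for \<open>n \<ge> 1\<close>, and averages start at 1.\<close>
  define v where "v n = Re ((shift ^^ n) x 0)" for n
  have vV: "v \<in> V"
  proof -
    have "continuous_on disc_seqs (\<lambda>y :: int \<Rightarrow> complex. Re (y 0))"
      by (intro continuous_intros continuous_on_product_then_coordinatewise[OF continuous_on_id])
    moreover have "\<bar>Re (y 0)\<bar> \<le> 1" if "y \<in> disc_seqs" for y
      using that abs_Re_le_cmod[of "y 0"] by (auto simp: disc_seqs_def dist_norm intro: order_trans)
    ultimately show ?thesis unfolding V_def v_def[abs_def] by (intro CollectI exI[of _ "\<lambda>y. Re (y 0)"]) auto
  qed
  have vw: "complex_of_real (v n) = w n" if "n \<ge> 1" for n
    using w01[OF that] that by (auto simp: v_def shift_funpow x_def extend_seq_def)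
  have "(avg (\<lambda>n. v n * ee (\<beta> * a (real n))) \<longlongrightarrow> 0) F"
  proof (cases d)
    case 0
    show ?thesis
    proof (rule tendstoI)
      fix \<epsilon> :: real assume "\<epsilon> > 0"
      hence "\<forall>\<^sub>F N in F. norm (avg (\<lambda>n. v n * ee (\<beta> * a (real n))) N) \<le> \<bar>\<Lambda> / \<beta>\<bar> + \<epsilon> / 2"
        by (intro avg_weighted_ee_tempered[where V=V, OF F \<beta> _ _ _ a vV] V1 V2 V3) auto
      hence "\<forall>\<^sub>F N in F. norm (avg (\<lambda>n. v n * ee (\<beta> * a (real n))) N) \<le> \<epsilon> / 2"
        using d[OF 0] by simp
      thus "\<forall>\<^sub>F N in F. dist (avg (\<lambda>n. v n * ee (\<beta> * a (real n))) N) 0 < \<epsilon>"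
        by eventually_elim (use \<open>\<epsilon> > 0\<close> in simp)
    qed
  next
    case (Suc d')
    show ?thesis
      by (intro avg_weighted_ee_tempered_Suc[where V=V, OF F \<beta> _ _ _ a[unfolded Suc] vV] V1 V2 V3)
  qed
  moreover have "avg (\<lambda>n. v n * ee (\<beta> * a (real n))) = ?u"
    by (intro ext) (auto simp: avg_def vw intro!: sum.cong arg_cong2[where f="(/)"])
  ultimately have "\<forall>\<^sub>F N in F. dist (?u N) 0 < e" using tendstoD[OF _ e(1)] by metis
  hence "\<forall>\<^sub>F k in sequentially. norm (?u (M k)) < e" by (simp add: F_def eventually_filtermap)
  then obtain k where "norm (?u (M k)) < e" by (auto simp: eventually_sequentially)
  with sN[of "r k"] show False by (simp add: M_def)
qed

subsection \<open>Weyl's criterion\<close>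

inductive_set trig_polys :: "(real \<Rightarrow> complex) set" where
  monomial: "(\<lambda>t. c * ee (of_int k * t)) \<in> trig_polys"
| add: "f \<in> trig_polys \<Longrightarrow> g \<in> trig_polys \<Longrightarrow> (\<lambda>t. f t + g t) \<in> trig_polys"

lemma trig_polys_const: "(\<lambda>_. c) \<in> trig_polys"
  using trig_polys.monomial[of c 0] by simp

lemma trig_polys_mult:
  assumes "f \<in> trig_polys" "g \<in> trig_polys"
  shows "(\<lambda>t. f t * g t) \<in> trig_polys"
  using assms(1)
proof induction
  case (monomial c k)
  show ?case using assms(2)
  proof induction
    case (monomial c' k')
    have "ee (of_int (k + k') * t) = ee (of_int k * t) * ee (of_int k' * t)" for t
      by (simp add: distrib_right ee_add)
    hence "(\<lambda>t. c * ee (of_int k * t) * (c' * ee (of_int k' * t))) = (\<lambda>t. (c * c') * ee (of_int (k + k') * t))"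
      by (simp only: mult_ac)
    thus ?case by (simp only: trig_polys.monomial)
  next
    case (add f g)
    thus ?case by (simp add: distrib_left trig_polys.add)
  qed
next
  case (add f h)
  thus ?case by (simp add: distrib_right trig_polys.add)
qed

text \<open>On the circle, real and imaginary parts are combinations of \<open>ee t\<close> and
  \<open>ee (- t)\<close>. This converts the output of the Stone-Weierstrass theorem into
  trigonometric polynomials.\<close>

lemma trig_polys_real_polynomial:
  fixes p :: "complex \<Rightarrow> real"
  assumes "real_polynomial_function p"
  shows "(\<lambda>t. complex_of_real (p (ee t))) \<in> trig_polys"
  using assms
proof induction
  case (linear f)
  interpret bounded_linear f by (rule linear)
  have "f (ee t) = f (Re (ee t) *\<^sub>R 1 + Im (ee t) *\<^sub>R \<i>)" for t
    by (rule arg_cong[where f=f]) (simp add: complex_eq_iff)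
  also have "\<dots> t = Re (ee t) * f 1 + Im (ee t) * f \<i>" for t by (simp add: add scaleR)
  finally have *: "f (ee t) = Re (ee t) * f 1 + Im (ee t) * f \<i>" for t .
  have "complex_of_real (f (ee t)) = (f 1 / 2 + f \<i> / (2 * \<i>)) * ee (of_int 1 * t) + (f 1 / 2 - f \<i> / (2 * \<i>)) * ee (of_int (- 1) * t)" for t
    unfolding * by (simp add: ee_def complex_eq_iff field_simps)
  thus ?case by (simp only: trig_polys.intros)
next
  case (const c)
  show ?case by (rule trig_polys_const)
next
  case (add f g)
  thus ?case by (simp add: trig_polys.add)
next
  case (mult f g)
  thus ?case by (simp add: trig_polys_mult)
qed

lemma trig_polys_frac: "p \<in> trig_polys \<Longrightarrow> p (frac t) = p t"
proof (induction rule: trig_polys.induct)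
  case (monomial c k)
  have "ee (of_int k * t) = ee (of_int k * frac t + of_int (k * \<lfloor>t\<rfloor>))" by (simp add: frac_def algebra_simps)
  also have "\<dots> = ee (of_int k * frac t)" by (simp only: ee_add ee_of_int) simp
  finally show ?case by simp
qed simp

text \<open>\<open>ee\<close> maps a compact interval onto the circle and identifies only the
  endpoints, so \<open>\<gamma>\<close> descends to the circle; continuity follows because the
  preimage of a closed set under \<open>G\<close> is the image of a compact set.\<close>

lemma circle_lift:
  fixes \<gamma> :: "real \<Rightarrow> real"
  assumes "continuous_on {0..1} \<gamma>" "\<gamma> 0 = \<gamma> 1"
  obtains G where "continuous_on (sphere 0 1) G" "\<And>t. t \<in> {0..1} \<Longrightarrow> G (ee t) = \<gamma> t"
proof -
  define G where "G z = \<gamma> (Arg2pi z / (2 * pi))" for z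
  have G: "G (ee t) = \<gamma> t" if "t \<in> {0..1}" for t
  proof (cases "t = 1")
    \<comment> \<open>\<open>Arg2pi\<close> takes values below \<open>2 * pi\<close>, so it sends
      the point \<open>ee 1\<close> to 0; here the equality of the endpoint values is
      needed.\<close>
    case True
    have "ee 1 = 1" using ee_of_int[of 1] by simp
    moreover have "Arg2pi 1 = 0" by (simp add: Arg2pi_eq_0)
    ultimately show ?thesis using True assms(2) by (simp add: G_def)
  next
    case False
    have "Arg2pi (ee t) = 2 * pi * t"
      by (rule Arg2pi_unique[of 1]) (use False that in \<open>auto simp: ee_def cis_conv_exp\<close>)
    thus ?thesis by (simp add: G_def)
  qed
  have surj: "ee ` {0..1} = sphere 0 1"
  proof
    show "ee ` {0..1} \<subseteq> sphere 0 1" by auto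
    show "sphere 0 1 \<subseteq> ee ` {0..1}"
    proof
      fix z :: complex assume z: "z \<in> sphere 0 1"
      have "z = ee (Arg2pi z / (2 * pi))"
        using Arg2pi_eq[of z] z by (simp add: ee_def cis_conv_exp)
      moreover have "Arg2pi z / (2 * pi) \<in> {0..1}" using Arg2pi_ge_0[of z] Arg2pi_lt_2pi[of z] by simp
      ultimately show "z \<in> ee ` {0..1}" by blast
    qed
  qed
  have ee_cont: "continuous_on S ee" for S unfolding ee_def[abs_def] cis_conv_exp by (intro continuous_intros)
  have "continuous_on (sphere 0 1) G"
    unfolding continuous_on_closed_vimage[OF closed_sphere]
  proof (intro allI impI)
    fix C :: "real set" assume "closed C"
    hence "closed (\<gamma> -` C \<inter> {0..1})"
      using assms(1) continuous_on_closed_vimage[of "{0..1}" \<gamma>] by simp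
    hence "compact (\<gamma> -` C \<inter> {0..1})" by (auto simp: compact_eq_bounded_closed intro: bounded_subset[of "{0..1}"])
    hence "compact (ee ` (\<gamma> -` C \<inter> {0..1}))" by (intro compact_continuous_image ee_cont)
    moreover have "ee ` (\<gamma> -` C \<inter> {0..1}) = G -` C \<inter> sphere 0 1"
      unfolding surj[symmetric] using G by auto
    ultimately show "closed (G -` C \<inter> sphere 0 1)" by (simp add: compact_imp_closed)
  qed
  with G show ?thesis by (rule that[rotated])
qed

lemma trig_poly_approximation:
  fixes \<gamma> :: "real \<Rightarrow> real"
  assumes "continuous_on {0..1} \<gamma>" "\<gamma> 0 = \<gamma> 1" "e > 0"
  obtains p where "p \<in> trig_polys" "\<And>t. norm (complex_of_real (\<gamma> (frac t)) - p t) < e"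
proof -
  obtain G where G: "continuous_on (sphere 0 1) G" "\<And>t. t \<in> {0..1} \<Longrightarrow> G (ee t) = \<gamma> t"
    using circle_lift[OF assms(1,2)] by blast
  obtain P where P: "real_polynomial_function P" "\<And>z. z \<in> sphere 0 1 \<Longrightarrow> \<bar>G z - P z\<bar> < e"
    using Stone_Weierstrass_real_polynomial_function[OF _ G(1) assms(3)] by auto
  show ?thesis
  proof (rule that[OF trig_polys_real_polynomial[OF P(1)]])
    fix t :: real
    have f: "frac t \<in> {0..1}" using frac_lt_1[of t] by simp
    have "complex_of_real (P (ee (frac t))) = of_real (P (ee t))"
      by (rule trig_polys_frac[OF trig_polys_real_polynomial[OF P(1)]])
    moreover have "\<bar>\<gamma> (frac t) - P (ee (frac t))\<bar> < e" using P(2)[of "ee (frac t)"] G(2)[OF f] by simp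
    ultimately show "norm (complex_of_real (\<gamma> (frac t)) - complex_of_real (P (ee t))) < e"
      by (metis norm_of_real of_real_diff)
  qed
qed

lemma has_integral_ee:
  "((\<lambda>t. ee (of_int k * t)) has_integral (if k = 0 then 1 else 0)) {0..1}"
proof (cases "k = 0")
  case True
  thus ?thesis using has_integral_const_real[of "1::complex" 0 1] by simp
next
  case False
  define z where "z = 2 * pi * of_int k * \<i>"
  have z: "z \<noteq> 0" using False by (simp add: z_def)
  have ee: "ee (of_int k * t) = exp (z * of_real t)" for t
    by (simp add: ee_def cis_conv_exp z_def mult_ac)
  have "((\<lambda>t. exp (z * of_real t)) has_integral exp (z * of_real 1) / z - exp (z * of_real 0) / z) {0..1}"
  proof (rule fundamental_theorem_of_calculus)
    fix t :: real
    have "((\<lambda>w. exp (z * w) / z) has_field_derivative exp (z * of_real t)) (at (of_real t))"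
      using z by (auto intro!: derivative_eq_intros)
    from has_vector_derivative_real_field[OF this]
    show "((\<lambda>t. exp (z * of_real t) / z) has_vector_derivative exp (z * of_real t)) (at t within {0..1})"
      by simp
  qed simp
  moreover have "exp z = 1" using ee[of 1] ee_of_int[of k] by simp
  ultimately show ?thesis using False by (simp add: ee)
qed

lemma avg_const_tendsto: "avg (\<lambda>_. c) \<longlonglongrightarrow> c"
proof (rule Lim_transform_eventually[OF tendsto_const])
  show "\<forall>\<^sub>F N in sequentially. c = avg (\<lambda>_. c) N"
    by (rule eventually_sequentiallyI[of 1]) (simp add: avg_def)
qed

lemma avg_trig_poly_tendsto:
  assumes x: "\<And>k::int. k \<noteq> 0 \<Longrightarrow> avg (\<lambda>n. ee (of_int k * x n)) \<longlonglongrightarrow> 0" and "p \<in> trig_polys"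
  shows "\<exists>L. avg (\<lambda>n. p (x n)) \<longlonglongrightarrow> L \<and> (p has_integral L) {0..1}"
  using assms(2)
proof induction
  case (monomial c k)
  have "avg (\<lambda>n. ee (of_int k * x n)) \<longlonglongrightarrow> (if k = 0 then 1 else 0)"
    using x[of k] avg_const_tendsto[of "1::complex"] by auto
  from tendsto_mult[OF tendsto_const[of c] this] has_integral_mult_right[OF has_integral_ee, of c k]
  show ?case by (auto simp: avg_cmult[abs_def])
next
  case (add f g)
  then obtain L L' where L: "avg (\<lambda>n. f (x n)) \<longlonglongrightarrow> L" "(f has_integral L) {0..1}"
    "avg (\<lambda>n. g (x n)) \<longlonglongrightarrow> L'" "(g has_integral L') {0..1}" by blast
  from tendsto_add[OF L(1,3)] has_integral_add[OF L(2,4)] show ?case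
    by (auto simp: avg_add[abs_def])
qed

lemma avg_weighted_trig_poly_tendsto:
  assumes x: "\<And>k::int. avg (\<lambda>n. y n * ee (of_int k * x n)) \<longlonglongrightarrow> 0" and "p \<in> trig_polys"
  shows "avg (\<lambda>n. y n * p (x n)) \<longlonglongrightarrow> 0"
  using assms(2)
proof induction
  case (monomial c k)
  from tendsto_mult[OF tendsto_const[of c] x[of k]] show ?case
    by (simp add: avg_cmult[abs_def, symmetric] mult.left_commute)
next
  case (add f g)
  from tendsto_add[OF add.IH] show ?case
    by (simp add: avg_add[abs_def, symmetric] distrib_left)
qed

lemma weyl_continuous:
  fixes \<gamma> :: "real \<Rightarrow> real"
  assumes x: "\<And>k::int. k \<noteq> 0 \<Longrightarrow> avg (\<lambda>n. ee (of_int k * x n)) \<longlonglongrightarrow> 0"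
    and \<gamma>: "continuous_on {0..1} \<gamma>" "\<gamma> 0 = \<gamma> 1"
  shows "avg (\<lambda>n. \<gamma> (frac (x n))) \<longlonglongrightarrow> integral {0..1} \<gamma>"
proof (rule LIMSEQ_I)
  fix e :: real assume e: "e > 0"
  define I where "I = integral {0..1} \<gamma>"
  obtain p where p: "p \<in> trig_polys" "\<And>t. norm (complex_of_real (\<gamma> (frac t)) - p t) < e / 4"
    using trig_poly_approximation[OF \<gamma>, of "e / 4"] e by auto
  obtain L where L: "avg (\<lambda>n. p (x n)) \<longlonglongrightarrow> L" "(p has_integral L) {0..1}"
    using avg_trig_poly_tendsto[OF x p(1)] by blast
  \<comment> \<open>\<open>frac\<close> never takes the value 1, so that endpoint is treated through
    0, where both functions have the same value as at 1.\<close>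
  have p': "norm (complex_of_real (\<gamma> t) - p t) \<le> e / 4" if "t \<in> {0..1}" for t
  proof (cases "t = 1")
    case True
    have "p 1 = p 0" using trig_polys_frac[OF p(1), of 1] by (simp add: frac_def)
    thus ?thesis using p(2)[of 0] True \<gamma>(2) by (simp add: frac_def)
  next
    case False
    thus ?thesis using p(2)[of t] that frac_eq[of t] by simp
  qed
  have "(\<gamma> has_integral I) {0..1}"
    unfolding I_def using integrable_continuous_real[OF \<gamma>(1)] by (rule integrable_integral)
  hence "((\<lambda>t. complex_of_real (\<gamma> t)) has_integral of_real I) {0..1}"
    by (rule has_integral_of_real)
  from has_integral_diff[OF this L(2)] have "norm (of_real I - L) \<le> e / 4 * measure lborel (cbox 0 (1::real))"
    by (intro has_integral_bound) (use e p' in auto)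
  hence IL: "norm (of_real I - L) \<le> e / 4" by simp
  have "\<forall>\<^sub>F N in sequentially. dist (avg (\<lambda>n. p (x n)) N) L < e / 4" by (rule tendstoD[OF L(1)]) (use e in simp)
  then obtain N0 where N0: "\<And>N. N \<ge> N0 \<Longrightarrow> norm (avg (\<lambda>n. p (x n)) N - L) < e / 4"
    by (auto simp: eventually_sequentially dist_norm)
  have "norm (avg (\<lambda>n. \<gamma> (frac (x n))) N - I) < e" if "N \<ge> N0" for N
  proof -
    have "norm (avg (\<lambda>n. complex_of_real (\<gamma> (frac (x n))) - p (x n)) N) \<le> e / 4"
      by (rule norm_avg_le_const) (use p(2) less_imp_le in blast)
    hence 1: "norm (avg (\<lambda>n. of_real (\<gamma> (frac (x n)))) N - avg (\<lambda>n. p (x n)) N) \<le> e / 4"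
      by (simp add: avg_diff)
    have "norm (complex_of_real (avg (\<lambda>n. \<gamma> (frac (x n))) N - I))
      = norm ((avg (\<lambda>n. of_real (\<gamma> (frac (x n)))) N - avg (\<lambda>n. p (x n)) N) + (avg (\<lambda>n. p (x n)) N - L) - (of_real I - L))"
      by (simp add: avg_of_real)
    also have "\<dots> \<le> e / 4 + e / 4 + e / 4"
      by (rule norm_triangle_le_diff, rule add_mono[OF norm_triangle_le[OF add_mono[OF 1 less_imp_le[OF N0[OF that]]]] IL])
    finally show ?thesis using e by (simp only: norm_of_real) simp
  qed
  thus "\<exists>N0. \<forall>N\<ge>N0. norm (avg (\<lambda>n. \<gamma> (frac (x n))) N - integral {0..1} \<gamma>) < e" unfolding I_def by blast
qed

text \<open>For \<open>{u..<v}\<close> inside the unit interval this is a continuous minorant of the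
  indicator. It vanishes at 0 and 1, as periodic approximation requires, and its integral falls
  short by at most \<open>2 * \<eta>\<close>.\<close>

definition trapezoid :: "real \<Rightarrow> real \<Rightarrow> real \<Rightarrow> real \<Rightarrow> real" where
  "trapezoid \<eta> u v t = max 0 (min 1 (min ((t - u) / \<eta>) ((v - t) / \<eta>)))"

lemma continuous_on_trapezoid: "\<eta> > 0 \<Longrightarrow> continuous_on S (trapezoid \<eta> u v)"
  unfolding trapezoid_def[abs_def] by (intro continuous_intros) auto

lemma trapezoid_bounds: "0 \<le> trapezoid \<eta> u v t" "trapezoid \<eta> u v t \<le> 1"
  by (auto simp: trapezoid_def)

lemma trapezoid_outside:
  assumes "\<eta> > 0" "t \<le> u \<or> v \<le> t"
  shows "trapezoid \<eta> u v t = 0"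
proof -
  have "(t - u) / \<eta> \<le> 0 \<or> (v - t) / \<eta> \<le> 0" using assms by (simp add: divide_le_0_iff)
  thus ?thesis by (auto simp: trapezoid_def)
qed

lemma trapezoid_inside: "\<eta> > 0 \<Longrightarrow> u + \<eta> \<le> t \<Longrightarrow> t \<le> v - \<eta> \<Longrightarrow> trapezoid \<eta> u v t = 1"
  by (auto simp: trapezoid_def max_def min_def field_simps)

lemma integral_trapezoid_ge:
  assumes "\<eta> > 0" "0 \<le> u" "v \<le> 1" "2 * \<eta> \<le> v - u"
  shows "integral {0..1} (trapezoid \<eta> u v) \<ge> v - u - 2 * \<eta>"
proof -
  have "v - u - 2 * \<eta> = integral {u + \<eta>..v - \<eta>} (\<lambda>_. 1 :: real)"
    using assms by simp
  also have "\<dots> = integral {u + \<eta>..v - \<eta>} (trapezoid \<eta> u v)"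
    by (rule integral_cong) (use assms in \<open>simp add: trapezoid_inside\<close>)
  also have "\<dots> \<le> integral {0..1} (trapezoid \<eta> u v)"
    by (rule integral_subset_le) (use assms in \<open>auto intro!: integrable_continuous_real continuous_on_trapezoid trapezoid_bounds\<close>)
  finally show ?thesis .
qed

lemma weyl_interval_lower:
  assumes x: "\<And>k::int. k \<noteq> 0 \<Longrightarrow> avg (\<lambda>n. ee (of_int k * x n)) \<longlonglongrightarrow> 0"
    and uv: "0 \<le> u" "u \<le> v" "v \<le> 1" and e: "e > 0"
  shows "\<forall>\<^sub>F N in sequentially. avg (\<lambda>n. indicator {u..<v} (frac (x n))) N > v - u - e"
proof (cases "v - u < e")
  case True
  have "0 \<le> avg (\<lambda>n. indicator {u..<v} (frac (x n)) :: real) N" for N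
    unfolding avg_def by (intro divide_nonneg_nonneg sum_nonneg) auto
  thus ?thesis using True by (intro always_eventually allI) (smt (verit))
next
  case False
  \<comment> \<open>The loss \<open>2 * \<eta> = e / 2\<close> stays below \<open>e\<close>, and
    \<open>e \<le> v - u\<close> guarantees a nonempty plateau.\<close>
  define \<eta> where "\<eta> = e / 4"
  have \<eta>: "\<eta> > 0" "2 * \<eta> \<le> v - u" using e False by (auto simp: \<eta>_def)
  have "trapezoid \<eta> u v 0 = trapezoid \<eta> u v 1" using trapezoid_outside[OF \<eta>(1)] uv by simp
  hence "avg (\<lambda>n. trapezoid \<eta> u v (frac (x n))) \<longlonglongrightarrow> integral {0..1} (trapezoid \<eta> u v)"
    by (intro weyl_continuous x continuous_on_trapezoid \<eta>)
  moreover have "v - u - e < integral {0..1} (trapezoid \<eta> u v)"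
    using integral_trapezoid_ge[OF \<eta>(1) uv(1,3) \<eta>(2)] e by (simp add: \<eta>_def)
  ultimately have "\<forall>\<^sub>F N in sequentially. v - u - e < avg (\<lambda>n. trapezoid \<eta> u v (frac (x n))) N"
    by (rule order_tendstoD(1))
  thus ?thesis
  proof eventually_elim
    case (elim N)
    have "avg (\<lambda>n. trapezoid \<eta> u v (frac (x n))) N \<le> avg (\<lambda>n. indicator {u..<v} (frac (x n))) N"
    proof (rule avg_mono)
      fix n
      show "trapezoid \<eta> u v (frac (x n)) \<le> indicator {u..<v} (frac (x n))"
        using trapezoid_bounds[of \<eta> u v] trapezoid_outside[OF \<eta>(1), of "frac (x n)" u v]
        by (auto simp: indicator_def not_le not_less)
    qed
    with elim show ?case by simp
  qed
qed

text \<open>Lower bounds suffice: \<open>{0..<u}\<close>, \<open>{u..<v}\<close> and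
  \<open>{v..<1}\<close> partition the range of \<open>frac\<close>, so their frequencies add up to
  1, and lower bounds for the outer two bound the middle one from above.\<close>

theorem weyl_criterion:
  assumes x: "\<And>k::int. k \<noteq> 0 \<Longrightarrow> avg (\<lambda>n. ee (of_int k * x n)) \<longlonglongrightarrow> 0"
  shows "equidistributed_mod_1 x"
  unfolding equidistributed_mod_1_def
proof (intro allI impI)
  fix u v :: real assume uv: "0 \<le> u" "u < v" "v \<le> 1"
  define I where "I u v N = avg (\<lambda>n. indicator {u..<v} (frac (x n)) :: real) N" for u v N
  have card: "real (card {n\<in>{1..N}. frac (x n) \<in> {u..<v}}) / real N = I u v N" for N
  proof -
    have "(\<Sum>n=1..N. indicator {u..<v} (frac (x n)) :: real) = (\<Sum>n\<in>{n\<in>{1..N}. frac (x n) \<in> {u..<v}}. 1)"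
      unfolding sum.inter_filter[OF finite_atLeastAtMost] by (rule sum.cong) (auto simp: indicator_def)
    thus ?thesis by (simp add: I_def avg_def)
  qed
  have total: "I 0 u N + I u v N + I v 1 N = 1" if "N \<ge> 1" for N
  proof -
    have "indicator {0..<u} (frac (x n)) + indicator {u..<v} (frac (x n)) + indicator {v..<1} (frac (x n)) = (1::real)" for n
      using uv frac_ge_0[of "x n"] frac_lt_1[of "x n"] by (auto simp: indicator_def)
    hence "I 0 u N + I u v N + I v 1 N = avg (\<lambda>_. 1) N" unfolding I_def avg_add[symmetric] by simp
    thus ?thesis using that by (simp add: avg_def)
  qed
  have "I u v \<longlonglongrightarrow> v - u"
  proof (rule LIMSEQ_I)
    fix e :: real assume e: "e > 0"
    have low: "\<forall>\<^sub>F N in sequentially. I a b N > b - a - e / 2" if "0 \<le> a" "a \<le> b" "b \<le> 1" for a b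
      unfolding I_def by (intro weyl_interval_lower x that half_gt_zero e)
    have "\<forall>\<^sub>F N in sequentially. I u v N > v - u - e / 2" "\<forall>\<^sub>F N in sequentially. I 0 u N > u - 0 - e / 2"
      "\<forall>\<^sub>F N in sequentially. I v 1 N > 1 - v - e / 2" using low[of u v] low[of 0 u] low[of v 1] uv by auto
    with eventually_ge_at_top[of 1] have "\<forall>\<^sub>F N in sequentially. norm (I u v N - (v - u)) < e"
    proof eventually_elim
      case (elim N)
      thus ?case using total[of N] e by (simp add: abs_less_iff)
    qed
    thus "\<exists>no. \<forall>n\<ge>no. norm (I u v n - (v - u)) < e" by (simp add: eventually_sequentially)
  qed
  thus "(\<lambda>N. real (card {n\<in>{1..N}. frac (x n) \<in> {u..<v}}) / real N) \<longlonglongrightarrow> v - u" by (simp only: card)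
qed

subsection \<open>Equidistribution along ergodic sequences\<close>

text \<open>The factor \<open>ee (- \<kappa> * frac t)\<close> jumps at the integers, so it is no
  uniform limit of trigonometric polynomials. The trapezoid \<open>\<gamma>\<close> cuts the jump
  out at the cost of the mean of \<open>1 - \<gamma>\<close>, which is small by Weyl's criterion for
  \<open>x\<close> itself. Irrationality keeps every frequency \<open>\<kappa> + k\<close> different
  from 0.\<close>

lemma weyl_floor_multiple:
  assumes x: "\<And>\<beta>. \<beta> \<noteq> 0 \<Longrightarrow> avg (\<lambda>n. ee (\<beta> * x n)) \<longlonglongrightarrow> 0" and \<alpha>: "\<alpha> \<notin> \<rat>"
  shows "equidistributed_mod_1 (\<lambda>n. of_int \<lfloor>x n\<rfloor> * \<alpha>)"
proof (rule weyl_criterion)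
  fix l :: int assume l: "l \<noteq> 0"
  define \<kappa> where "\<kappa> = of_int l * \<alpha>"
  define y where "y n = ee (\<kappa> * x n)" for n
  have xk: "avg (\<lambda>n. ee (of_int k * x n)) \<longlonglongrightarrow> 0" if "k \<noteq> 0" for k :: int
    by (rule x) (use that in simp)
  have yk: "avg (\<lambda>n. y n * ee (of_int k * x n)) \<longlonglongrightarrow> 0" for k :: int
  proof -
    have "\<kappa> + of_int k \<noteq> 0"
    proof
      assume "\<kappa> + of_int k = 0"
      hence "\<alpha> = - of_int k / of_int l" using l by (simp add: \<kappa>_def field_simps eq_neg_iff_add_eq_0)
      also have "\<dots> \<in> \<rat>" by (intro Rats_divide) auto
      finally show False using \<alpha> by simp
    qed
    from x[OF this] show ?thesis by (simp add: y_def distrib_right ee_add)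
  qed
  show "avg (\<lambda>n. ee (of_int l * (of_int \<lfloor>x n\<rfloor> * \<alpha>))) \<longlonglongrightarrow> 0"
  proof (rule LIMSEQ_I)
    fix e :: real assume e: "e > 0"
    \<comment> \<open>\<open>e / 16\<close> makes the integral of \<open>\<gamma>\<close> at least
      \<open>1 - e / 8\<close>; \<open>1 / 4\<close> leaves room for a plateau.\<close>
    define \<eta> where "\<eta> = min (e / 16) (1 / 4)"
    have \<eta>: "\<eta> > 0" "2 * \<eta> \<le> 1 - 0" "2 * \<eta> \<le> e / 8" using e by (auto simp: \<eta>_def)
    define \<gamma> where "\<gamma> = trapezoid \<eta> 0 1"
    have \<gamma>_cont: "continuous_on {0..1} \<gamma>" unfolding \<gamma>_def by (rule continuous_on_trapezoid[OF \<eta>(1)])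
    have \<gamma>_end: "\<gamma> 0 = 0" "\<gamma> 1 = 0" unfolding \<gamma>_def using trapezoid_outside[OF \<eta>(1)] by auto
    have \<gamma>01: "0 \<le> \<gamma> t" "\<gamma> t \<le> 1" for t unfolding \<gamma>_def by (rule trapezoid_bounds)+
    define \<psi> where "\<psi> t = ee (- \<kappa> * t)" for t
    have ee_cont: "continuous_on {0..1} \<psi>" unfolding \<psi>_def ee_def cis_conv_exp by (intro continuous_intros)
    obtain p where p: "p \<in> trig_polys" "\<And>t. norm (complex_of_real (\<gamma> (frac t) * Re (\<psi> (frac t))) - p t) < e / 8"
      by (rule trig_poly_approximation[of "\<lambda>t. \<gamma> t * Re (\<psi> t)" "e / 8"])
         (use e \<gamma>_end in \<open>auto intro!: continuous_intros \<gamma>_cont ee_cont\<close>)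
    obtain q where q: "q \<in> trig_polys" "\<And>t. norm (complex_of_real (\<gamma> (frac t) * Im (\<psi> (frac t))) - q t) < e / 8"
      by (rule trig_poly_approximation[of "\<lambda>t. \<gamma> t * Im (\<psi> t)" "e / 8"])
         (use e \<gamma>_end in \<open>auto intro!: continuous_intros \<gamma>_cont ee_cont\<close>)
    define P where "P t = p t + \<i> * q t" for t
    have P: "P \<in> trig_polys" unfolding P_def[abs_def] by (intro trig_polys.add trig_polys_mult trig_polys_const p q)
    have approx: "norm (\<psi> (frac t) - P t) \<le> (1 - \<gamma> (frac t)) + e / 4" for t
    proof -
      have "\<psi> (frac t) - P t = complex_of_real (1 - \<gamma> (frac t)) * \<psi> (frac t)
        + (complex_of_real (\<gamma> (frac t) * Re (\<psi> (frac t))) - p t) + \<i> * (complex_of_real (\<gamma> (frac t) * Im (\<psi> (frac t))) - q t)"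
        by (simp add: P_def complex_eq_iff algebra_simps)
      also have "norm \<dots> \<le> (1 - \<gamma> (frac t)) + e / 8 + e / 8"
      proof (intro norm_triangle_le add_mono)
        show "norm (complex_of_real (1 - \<gamma> (frac t)) * \<psi> (frac t)) \<le> 1 - \<gamma> (frac t)"
          using \<gamma>01(2)[of "frac t"] by (simp add: norm_mult \<psi>_def del: of_real_diff)
      qed (use p(2)[of t] q(2)[of t] in \<open>auto simp: norm_mult intro: less_imp_le\<close>)
      finally show ?thesis by simp
    qed
    have eq: "ee (of_int l * (of_int \<lfloor>x n\<rfloor> * \<alpha>)) = y n * \<psi> (frac (x n))" for n
    proof -
      have "of_int l * (of_int \<lfloor>x n\<rfloor> * \<alpha>) = \<kappa> * x n + - \<kappa> * frac (x n)"
        by (simp add: \<kappa>_def frac_def algebra_simps)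
      thus ?thesis unfolding y_def \<psi>_def by (simp only: ee_add)
    qed
    have "avg (\<lambda>n. y n * P (x n)) \<longlonglongrightarrow> 0" by (rule avg_weighted_trig_poly_tendsto[OF yk P])
    from tendstoD[OF this, of "e / 4"] e
    have "\<forall>\<^sub>F N in sequentially. norm (avg (\<lambda>n. y n * P (x n)) N) < e / 4" by simp
    moreover have "\<forall>\<^sub>F N in sequentially. 1 - e / 4 < avg (\<lambda>n. \<gamma> (frac (x n))) N"
    proof (rule order_tendstoD(1))
      show "avg (\<lambda>n. \<gamma> (frac (x n))) \<longlonglongrightarrow> integral {0..1} \<gamma>"
        by (rule weyl_continuous[OF xk \<gamma>_cont]) (use \<gamma>_end in auto)
      show "1 - e / 4 < integral {0..1} \<gamma>"
        using integral_trapezoid_ge[OF \<eta>(1), of 0 1] \<eta> e unfolding \<gamma>_def by simp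
    qed
    ultimately have "\<forall>\<^sub>F N in sequentially. norm (avg (\<lambda>n. y n * \<psi> (frac (x n))) N) < e"
    proof eventually_elim
      case (elim N)
      have "norm (avg (\<lambda>n. y n * \<psi> (frac (x n)) - y n * P (x n)) N) \<le> avg (\<lambda>n. (1 + e / 4) - \<gamma> (frac (x n))) N"
      proof (rule norm_avg_le)
        fix n
        have "norm (y n * \<psi> (frac (x n)) - y n * P (x n)) = norm (\<psi> (frac (x n)) - P (x n))"
          by (simp add: y_def norm_mult flip: right_diff_distrib)
        thus "norm (y n * \<psi> (frac (x n)) - y n * P (x n)) \<le> (1 + e / 4) - \<gamma> (frac (x n))"
          using approx[of "x n"] by simp
      qed
      also have "\<dots> \<le> (1 + e / 4) - avg (\<lambda>n. \<gamma> (frac (x n))) N"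
        unfolding avg_diff using avg_const_le[of "1 + e / 4" N] e by simp
      also have "\<dots> < e / 2" using elim(2) by simp
      finally have "norm (avg (\<lambda>n. y n * \<psi> (frac (x n))) N - avg (\<lambda>n. y n * P (x n)) N) < e / 2"
        by (simp add: avg_diff)
      with elim(1) norm_triangle_sub[of "avg (\<lambda>n. y n * \<psi> (frac (x n))) N" "avg (\<lambda>n. y n * P (x n)) N"] e
      show ?case by linarith
    qed
    thus "\<exists>N0. \<forall>N\<ge>N0. norm (avg (\<lambda>n. ee (of_int l * (of_int \<lfloor>x n\<rfloor> * \<alpha>))) N - 0) < e"
      unfolding eq eventually_sequentially by simp
  qed
qed

text \<open>Modulo 1, \<open>x / q\<close> equals \<open>(s + frac x) / q\<close> with
  \<open>s\<close> the residue of the integer part, and this lies in the interval of length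
  \<open>1 / q\<close> that starts at \<open>s / q\<close>.\<close>

lemma frac_divide_in_residue_interval:
  assumes q: "q \<ge> 1" and r: "r \<in> {0..<int q}"
  shows "frac (x / real q) \<in> {of_int r / real q..<(of_int r + 1) / real q} \<longleftrightarrow> \<lfloor>x\<rfloor> mod int q = r"
proof -
  define s where "s = \<lfloor>x\<rfloor> mod int q"
  have s: "0 \<le> s" "s < int q" using q by (auto simp: s_def)
  have "\<lfloor>x\<rfloor> = \<lfloor>x\<rfloor> div int q * int q + s" by (simp add: s_def)
  hence "real_of_int \<lfloor>x\<rfloor> = of_int (\<lfloor>x\<rfloor> div int q) * real q + of_int s"
    by (metis of_int_add of_int_mult of_int_of_nat_eq)
  hence "x = of_int (\<lfloor>x\<rfloor> div int q) * real q + of_int s + frac x" by (simp add: frac_def)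
  hence "x / real q = (of_int (\<lfloor>x\<rfloor> div int q) * real q + (of_int s + frac x)) / real q" by simp
  also have "\<dots> = (of_int s + frac x) / real q + of_int (\<lfloor>x\<rfloor> div int q)" using q by (simp add: field_simps)
  finally have "frac (x / real q) = frac ((of_int s + frac x) / real q)" by (simp add: frac_def)
  also have "\<dots> = (of_int s + frac x) / real q"
  proof -
    have "of_int s + frac x < real q" using s(2) frac_lt_1[of x] by linarith
    thus ?thesis using s(1) q by (subst frac_eq) auto
  qed
  finally have "frac (x / real q) = (of_int s + frac x) / real q" .
  hence "frac (x / real q) \<in> {of_int r / real q..<(of_int r + 1) / real q} \<longleftrightarrow>
      of_int r \<le> of_int s + frac x \<and> of_int s + frac x < of_int r + 1"
    using q by (simp add: divide_le_cancel divide_less_cancel)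
  also have "\<dots> \<longleftrightarrow> s = r" using frac_ge_0[of x] frac_lt_1[of x] by linarith
  finally show ?thesis by (simp add: s_def)
qed

lemma equidistributed_mod_of_mod_1:
  assumes q: "q \<ge> 1" and x: "equidistributed_mod_1 (\<lambda>n. x n / real q)"
  shows "equidistributed_mod q (\<lambda>n. \<lfloor>x n\<rfloor>)"
  unfolding equidistributed_mod_def
proof
  fix r assume r: "r \<in> {0..<int q}"
  have "(\<lambda>N. real (card {n\<in>{1..N}. frac (x n / real q) \<in> {of_int r / real q..<(of_int r + 1) / real q}}) / real N)
     \<longlonglongrightarrow> (of_int r + 1) / real q - of_int r / real q"
    using x[unfolded equidistributed_mod_1_def, rule_format, of "of_int r / real q" "(of_int r + 1) / real q"] q r
    by (simp add: divide_strict_right_mono)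
  thus "(\<lambda>N. real (card {n\<in>{1..N}. \<lfloor>x n\<rfloor> mod int q = r}) / real N) \<longlonglongrightarrow> 1 / real q"
    by (simp only: frac_divide_in_residue_interval[OF q r] flip: diff_divide_distrib) simp
qed

text \<open>At \<open>N = b m\<close> the weighted sum is exactly the sum of \<open>g (b n)\<close>
  over \<open>n\<close> from 1 to \<open>m\<close>. The normalisations differ by
  \<open>m / b m\<close>, which tends to the density; its positivity permits the division.\<close>

lemma avg_along_subset_of_positive_density:
  fixes g :: "nat \<Rightarrow> complex"
  assumes b1: "\<And>n. n \<ge> 1 \<Longrightarrow> b n \<ge> 1" and mono: "strict_mono_on {1..} b"
    and dens: "has_density (b ` {1..}) \<delta>" "\<delta> > 0"
    and lim: "avg (\<lambda>n. indicator (b ` {1..}) n * g n) \<longlonglongrightarrow> 0"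
  shows "avg (\<lambda>n. g (b n)) \<longlonglongrightarrow> 0"
proof -
  have inj: "inj_on b {1..}" using mono by (rule strict_mono_on_imp_inj_on)
  have img: "b ` {1..} \<inter> {1..b m} = b ` {1..m}" if "m \<ge> 1" for m
  proof (intro set_eqI iffI)
    fix i assume "i \<in> b ` {1..} \<inter> {1..b m}"
    then obtain j where j: "j \<ge> 1" "i = b j" "b j \<le> b m" by auto
    have "j \<le> m"
    proof (rule ccontr)
      assume "\<not> j \<le> m"
      with strict_mono_onD[OF mono, of m j] that j show False by simp
    qed
    with j show "i \<in> b ` {1..m}" by auto
  next
    fix i assume "i \<in> b ` {1..m}"
    then obtain j where j: "1 \<le> j" "j \<le> m" "i = b j" by auto
    hence "b j \<le> b m" using strict_mono_onD[OF mono, of j m] that by (cases "j = m") auto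
    with j b1[of j] show "i \<in> b ` {1..} \<inter> {1..b m}" by auto
  qed
  have inj': "inj_on b {1..m}" for m by (rule inj_on_subset[OF inj]) auto
  have ge: "m \<le> b m" if "m \<ge> 1" for m
    using that
  proof (induction m rule: dec_induct)
    case base
    show ?case using b1 by simp
  next
    case (step m)
    with strict_mono_onD[OF mono, of m "Suc m"] show ?case by simp
  qed
  have btop: "filterlim b sequentially sequentially"
    by (rule filterlim_at_top_mono[OF filterlim_ident]) (use ge in \<open>auto intro: eventually_sequentiallyI\<close>)
  have "(\<lambda>m. real (card (b ` {1..} \<inter> {1..b m})) / real (b m)) \<longlonglongrightarrow> \<delta>"
    using dens(1) unfolding has_density_def by (rule filterlim_compose[OF _ btop])
  moreover have "\<forall>\<^sub>F m in sequentially. real (card (b ` {1..} \<inter> {1..b m})) / real (b m) = real m / real (b m)"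
  proof (rule eventually_sequentiallyI[of 1])
    fix m :: nat assume m: "m \<ge> 1"
    show "real (card (b ` {1..} \<inter> {1..b m})) / real (b m) = real m / real (b m)"
      unfolding img[OF m] card_image[OF inj'] by simp
  qed
  ultimately have 1: "(\<lambda>m. real m / real (b m)) \<longlonglongrightarrow> \<delta>" by (rule Lim_transform_eventually)
  have 2: "(\<lambda>m. avg (\<lambda>n. indicator (b ` {1..}) n * g n) (b m)) \<longlonglongrightarrow> 0"
    using lim by (rule filterlim_compose[OF _ btop])
  have "(\<lambda>m. avg (\<lambda>n. indicator (b ` {1..}) n * g n) (b m) / of_real (real m / real (b m))) \<longlonglongrightarrow> 0 / of_real \<delta>"
    by (intro tendsto_divide 2 tendsto_of_real 1) (use dens(2) in simp)
  moreover have "\<forall>\<^sub>F m in sequentially. avg (\<lambda>n. indicator (b ` {1..}) n * g n) (b m) / of_real (real m / real (b m)) = avg (\<lambda>n. g (b n)) m"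
  proof (rule eventually_sequentiallyI[of 1])
    fix m :: nat assume m: "m \<ge> 1"
    have "(\<Sum>n=1..b m. indicator (b ` {1..}) n * g n) = (\<Sum>n\<in>{1..b m} \<inter> b ` {1..}. g n)"
      unfolding sum.inter_restrict[OF finite_atLeastAtMost] by (rule sum.cong) (auto simp: indicator_def)
    also have "\<dots> = (\<Sum>n\<in>b ` {1..m}. g n)" by (simp only: Int_commute img[OF m])
    also have "\<dots> = (\<Sum>n=1..m. g (b n))" by (subst sum.reindex[OF inj']) simp
    finally have "(\<Sum>n=1..b m. indicator (b ` {1..}) n * g n) = (\<Sum>n=1..m. g (b n))" .
    moreover have "b m \<noteq> 0" using b1[OF m] by simp
    ultimately show "avg (\<lambda>n. indicator (b ` {1..}) n * g n) (b m) / of_real (real m / real (b m)) = avg (\<lambda>n. g (b n)) m"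
      using m by (simp add: avg_def)
  qed
  ultimately have "avg (\<lambda>n. g (b n)) \<longlonglongrightarrow> 0 / of_real \<delta>" by (rule Lim_transform_eventually)
  thus ?thesis by simp
qed

text \<open>Growth strictly above \<open>t ^ d * ln t\<close> leaves no finite limit for the
  quotient, whereas \<open>\<Lambda> \<noteq> 0\<close> would produce one; hence \<Lambda> = 0. In
  the other case \<open>d \<ge> 1\<close> is given, and the upper bound holds because
  \<open>ln t / t\<close> tends to 0.\<close>

lemma (in hardy) tempered_of_hypotheses:
  assumes a: "a \<in> H"
    and growth: "(\<exists>d::nat. (\<lambda>t. t ^ d * ln t) \<prec>\<^sub>\<infinity> a \<and> a \<prec>\<^sub>\<infinity> (\<lambda>t. t ^ (d + 1))) \<or>
         (\<exists>d::nat. d \<ge> 1 \<and> a \<sim>\<^sub>\<infinity> (\<lambda>t. t ^ d * ln t))"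
  obtains d \<Lambda> where "tempered d a \<Lambda>" "d = 0 \<Longrightarrow> \<Lambda> = 0"
  using growth
proof (elim disjE exE conjE)
  fix d :: nat
  assume lower: "(\<lambda>t. t ^ d * ln t) \<prec>\<^sub>\<infinity> a" and upper: "a \<prec>\<^sub>\<infinity> (\<lambda>t. t ^ (d + 1))"
  have not_fin: "\<not> ((\<lambda>t. a t / (t ^ d * ln t)) \<longlongrightarrow> L) at_top" for L
  proof
    assume L: "((\<lambda>t. a t / (t ^ d * ln t)) \<longlongrightarrow> L) at_top"
    have "((\<lambda>t. (t ^ d * ln t) / a t) \<longlongrightarrow> 0) at_top" using lower by (simp add: asymp_less_def)
    from tendsto_mult[OF this L] have "((\<lambda>t. (t ^ d * ln t) / a t * (a t / (t ^ d * ln t))) \<longlongrightarrow> 0) at_top" by simp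
    moreover have "\<forall>\<^sub>F t in at_top. (t ^ d * ln t) / a t * (a t / (t ^ d * ln t)) = 1"
    proof -
      have "\<forall>\<^sub>F t in at_top. a t \<noteq> 0" using lower by (simp add: asymp_less_def)
      thus ?thesis using eventually_gt_at_top[of 1] by eventually_elim auto
    qed
    ultimately have "((\<lambda>_::real. 1::real) \<longlongrightarrow> 0) at_top" by (rule Lim_transform_eventually)
    thus False by (simp add: tendsto_const_iff)
  qed
  have "((\<lambda>t. a t / t ^ Suc d) \<longlongrightarrow> 0) at_top" using upper by (simp add: asymp_less_def)
  from tempered_of_growth[OF a this not_fin] obtain \<Lambda> where \<Lambda>: "tempered d a \<Lambda>"
    "\<Lambda> \<noteq> 0 \<Longrightarrow> ((\<lambda>t. a t / (t ^ d * ln t)) \<longlongrightarrow> 1 / \<Lambda> / fact d) at_top" by blast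
  show thesis by (rule that[OF \<Lambda>(1)]) (use \<Lambda>(2) not_fin in blast)
next
  fix d :: nat
  assume d: "d \<ge> 1" and "a \<sim>\<^sub>\<infinity> (\<lambda>t. t ^ d * ln t)"
  then obtain c where c: "c \<noteq> 0" "((\<lambda>t. a t / (t ^ d * ln t)) \<longlongrightarrow> c) at_top"
    by (auto simp: asymp_same_growth_def)
  have "((\<lambda>t. a t / (t ^ d * ln t) * (ln t / t)) \<longlongrightarrow> c * 0) at_top"
    by (intro tendsto_mult c ln_x_over_x_tendsto_0)
  moreover have "\<forall>\<^sub>F t in at_top. a t / (t ^ d * ln t) * (ln t / t) = a t / t ^ Suc d"
    using eventually_gt_at_top[of 1] by eventually_elim simp
  ultimately have "((\<lambda>t. a t / t ^ Suc d) \<longlongrightarrow> c * 0) at_top" by (rule Lim_transform_eventually)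
  hence upper: "((\<lambda>t. a t / t ^ Suc d) \<longlongrightarrow> 0) at_top" by simp
  have "\<not> ((\<lambda>t. a t / (t ^ d * ln t)) \<longlongrightarrow> 0) at_top"
    using tendsto_unique[OF _ c(2), of 0] c(1) by auto
  from tempered_of_growth[OF a upper this] obtain \<Lambda> where "tempered d a \<Lambda>" by blast
  thus thesis by (rule that) (use d in simp)
qed

theorem corollary1p4:
  fixes a :: "real \<Rightarrow> real" and b :: "nat \<Rightarrow> nat" and \<alpha> :: real
  assumes "hardy_field_function a"
    and "(\<exists>d::nat. (\<lambda>t. t ^ d * ln t) \<prec>\<^sub>\<infinity> a \<and> a \<prec>\<^sub>\<infinity> (\<lambda>t. t ^ (d + 1))) \<or>
         (\<exists>d::nat. d \<ge> 1 \<and> a \<sim>\<^sub>\<infinity> (\<lambda>t. t ^ d * ln t))"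
    and "ergodic_nat_seq b"
    and "\<alpha> \<notin> \<rat>"
  shows "equidistributed_mod_1 (\<lambda>n. a (real (b n))) \<and>
         equidistributed_mod_1 (\<lambda>n. of_int \<lfloor>a (real (b n))\<rfloor> * \<alpha>) \<and>
         (\<forall>q\<ge>1. equidistributed_mod q (\<lambda>n. \<lfloor>a (real (b n))\<rfloor>))"
proof -
  obtain H where H: "hardy_field H" "translation_invariant H" "a \<in> H"
    using assms(1) by (auto simp: hardy_field_function_def)
  interpret hardy H by standard (use H in auto)
  obtain d \<Lambda> where a: "tempered d a \<Lambda>" "d = 0 \<Longrightarrow> \<Lambda> = 0"
    using tempered_of_hypotheses[OF H(3) assms(2)] by blast
  obtain \<delta> where b: "\<And>n. n \<ge> 1 \<Longrightarrow> b n \<ge> 1" "strict_mono_on {1..} b" "\<delta> > 0" "has_density (b ` {1..}) \<delta>"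
    "ergodic_disc_seq (indicator (b ` {1..}))"
    using assms(3) by (auto simp: ergodic_nat_seq_def)
  define x where "x n = a (real (b n))" for n
  have x: "avg (\<lambda>n. ee (\<beta> * x n)) \<longlonglongrightarrow> 0" if "\<beta> \<noteq> 0" for \<beta>
  proof -
    have "avg (\<lambda>n. indicator (b ` {1..}) n * ee (\<beta> * a (real n))) \<longlonglongrightarrow> 0"
      by (rule ergodic_binary_weights_avg_tendsto_zero[OF b(5) _ that a]) (auto simp: indicator_def)
    from avg_along_subset_of_positive_density[OF b(1,2,4,3) this] show ?thesis by (simp add: x_def)
  qed
  \<comment> \<open>\<open>\<beta> = 1\<close> gives the first claim, and
    \<open>\<beta> = 1 / q\<close> the one on residues modulo \<open>q\<close>.\<close>
  have "equidistributed_mod_1 (\<lambda>n. \<beta> * x n)" if "\<beta> \<noteq> 0" for \<beta>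
  proof (rule weyl_criterion)
    fix k :: int assume "k \<noteq> 0"
    with x[of "of_int k * \<beta>"] that show "avg (\<lambda>n. ee (of_int k * (\<beta> * x n))) \<longlonglongrightarrow> 0" by (simp add: mult.assoc)
  qed
  from this[of 1] this[of "1 / real q" for q] weyl_floor_multiple[OF x assms(4)]
  show ?thesis unfolding x_def[symmetric] by (auto intro!: equidistributed_mod_of_mod_1)
qed

end
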